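(* Let $k\ge 2$. Every Lipschitz map $f:S^k\to\mathbb{H}^1$ factors through a metric tree: there exist a metric tree $Z$ and Lipschitz maps $\psi:S^k\to Z$ and $\varphi:Z\to\mathbb{H}^1$ with $f=\varphi\circ\psi$.
   Context: $\mathbb{H}^1$ is the first Heisenberg group $\mathbb{R}^3$ with law $(x,y,z)\odot(x',y',z')=(x+x',y+y',z+z'+yx')$, equipped with its Carnot–Carathéodory metric (infimum of lengths, w.r.t. the left-invariant Riemannian metric making $X=\partial_x+y\partial_z$, $Y=\partial_y$, $Z=\partial_z$ orthonormal, of $C^1$ curves tangent to the span of $X,Y$). A metric tree ($\mathbb{R}$-tree) is a geodesic metric space in which every geodesic triangle is isometric to a tripod. *)

theory Defs
  imports "HOL-Analysis.Analysis"
begin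

text \<open>Points of H^1 are triples (x,y,z). A C^1 curve on [0,1] with components
  x, y, z (derivatives x', y', z') is horizontal (tangent to span{X,Y}, where
  X = d/dx + y d/dz, Y = d/dy) iff z' = y x'. Its velocity is then x' X + y' Y,
  whose length in the left-invariant Riemannian metric making X,Y,Z orthonormal is
  sqrt(x'^2 + y'^2).\<close>

definition heis_horizontal_C1 ::
  "(real \<Rightarrow> real) \<Rightarrow> (real \<Rightarrow> real) \<Rightarrow> (real \<Rightarrow> real) \<Rightarrow>
   (real \<Rightarrow> real) \<Rightarrow> (real \<Rightarrow> real) \<Rightarrow> (real \<Rightarrow> real) \<Rightarrow> bool" where
  "heis_horizontal_C1 x y z x' y' z' \<longleftrightarrow>
     (\<forall>t\<in>{0..1}. (x has_real_derivative x' t) (at t within {0..1})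
               \<and> (y has_real_derivative y' t) (at t within {0..1})
               \<and> (z has_real_derivative z' t) (at t within {0..1}))
   \<and> continuous_on {0..1} x' \<and> continuous_on {0..1} y' \<and> continuous_on {0..1} z'
   \<and> (\<forall>t\<in>{0..1}. z' t = y t * x' t)"

definition heis_cc_dist :: "real \<times> real \<times> real \<Rightarrow> real \<times> real \<times> real \<Rightarrow> real" where
  "heis_cc_dist p q = Inf {integral {0..1} (\<lambda>t. sqrt ((x' t)\<^sup>2 + (y' t)\<^sup>2)) | x y z x' y' z'.
       heis_horizontal_C1 x y z x' y' z' \<and> (x 0, y 0, z 0) = p \<and> (x 1, y 1, z 1) = q}"

definition lipschitz_map ::
  "'a set \<Rightarrow> ('a \<Rightarrow> 'a \<Rightarrow> real) \<Rightarrow> 'b set \<Rightarrow> ('b \<Rightarrow> 'b \<Rightarrow> real) \<Rightarrow> ('a \<Rightarrow> 'b) \<Rightarrow> bool" where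
  "lipschitz_map A dA B dB f \<longleftrightarrow> f ` A \<subseteq> B \<and>
     (\<exists>C. \<forall>u\<in>A. \<forall>v\<in>A. dB (f u) (f v) \<le> C * dA u v)"

definition geodesic_segment ::
  "'a set \<Rightarrow> ('a \<Rightarrow> 'a \<Rightarrow> real) \<Rightarrow> 'a \<Rightarrow> 'a \<Rightarrow> (real \<Rightarrow> 'a) \<Rightarrow> real \<Rightarrow> bool" where
  "geodesic_segment Z d a b g L \<longleftrightarrow> 0 \<le> L \<and> g ` {0..L} \<subseteq> Z \<and> g 0 = a \<and> g L = b \<and>
     (\<forall>s\<in>{0..L}. \<forall>t\<in>{0..L}. d (g s) (g t) = \<bar>s - t\<bar>)"

definition geodesic_space :: "'a set \<Rightarrow> ('a \<Rightarrow> 'a \<Rightarrow> real) \<Rightarrow> bool" where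
  "geodesic_space Z d \<longleftrightarrow> Metric_space Z d \<and>
     (\<forall>a\<in>Z. \<forall>b\<in>Z. \<exists>g L. geodesic_segment Z d a b g L)"

text \<open>The tripod with legs of lengths l1, l2, l3: three segments glued at a common
  endpoint, realised as the union of segments on the coordinate axes of R^3 with the
  l^1 distance.\<close>
definition tripod :: "real \<Rightarrow> real \<Rightarrow> real \<Rightarrow> (real \<times> real \<times> real) set" where
  "tripod l1 l2 l3 = {(s, 0, 0) | s. 0 \<le> s \<and> s \<le> l1} \<union> {(0, s, 0) | s. 0 \<le> s \<and> s \<le> l2}
                    \<union> {(0, 0, s) | s. 0 \<le> s \<and> s \<le> l3}"

definition tripod_dist :: "real \<times> real \<times> real \<Rightarrow> real \<times> real \<times> real \<Rightarrow> real" where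
  "tripod_dist p q = \<bar>fst p - fst q\<bar> + \<bar>fst (snd p) - fst (snd q)\<bar> + \<bar>snd (snd p) - snd (snd q)\<bar>"

definition isometric_sets ::
  "'a set \<Rightarrow> ('a \<Rightarrow> 'a \<Rightarrow> real) \<Rightarrow> 'b set \<Rightarrow> ('b \<Rightarrow> 'b \<Rightarrow> real) \<Rightarrow> bool" where
  "isometric_sets A dA B dB \<longleftrightarrow>
     (\<exists>h. bij_betw h A B \<and> (\<forall>u\<in>A. \<forall>v\<in>A. dB (h u) (h v) = dA u v))"

definition metric_tree :: "'a set \<Rightarrow> ('a \<Rightarrow> 'a \<Rightarrow> real) \<Rightarrow> bool" where
  "metric_tree Z d \<longleftrightarrow> geodesic_space Z d \<and>
     (\<forall>a b c g1 L1 g2 L2 g3 L3.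
        geodesic_segment Z d a b g1 L1 \<and> geodesic_segment Z d b c g2 L2 \<and>
        geodesic_segment Z d c a g3 L3 \<longrightarrow>
        (\<exists>l1 l2 l3. 0 \<le> l1 \<and> 0 \<le> l2 \<and> 0 \<le> l3 \<and>
           isometric_sets (g1 ` {0..L1} \<union> g2 ` {0..L2} \<union> g3 ` {0..L3}) d
                          (tripod l1 l2 l3) tripod_dist))"

end

theory Submission
  imports Defs
begin

text \<open>Write \<open>f = (x, y, z)\<close>. Being Lipschitz for the Carnot--Caratheodory distance means that
  \<open>x\<close>, \<open>y\<close> are Lipschitz and \<open>dz = y dx\<close> up to an error of second order. Hence the integral of any
  form \<open>h(x,y,z) dx\<close> over a small triangle is of third order, and Goursat's subdivision argument
  shows that all such forms have primitives in a stereographic chart. In other words all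
  loops have winding number zero under any two functions \<open>u\<close>, \<open>v\<close> of \<open>f\<close>. If \<open>v\<close> were nonconstant
  on connected pieces of uncountably many levels of \<open>u\<close>, two such pieces would be close to each
  other and bound a thin rectangle whose boundary has winding number one. So \<open>f\<close> is constant on
  the components of all but countably many levels of \<open>u = |f - f(p)|\<^sup>2\<close>.

  By unicoherence of the sphere, a level separating \<open>p\<close> from \<open>q\<close> has a component that does. Thus any
  two points not joined by a connected subset of a fibre of \<open>f\<close> are separated by a connected subset
  of a third fibre. The tree is the quotient of the sphere by the pseudometric obtained from
  lengths of finer and finer chains: cut points make it additive, and they occur at every
  distance.\<close>

section \<open>Primitives of almost closed one-cochains\<close>

text \<open>The third order bound rests on an area form: along \<open>f\<close>, dz = y dx gives dy
  wedge dx = d(dz) = 0, so \<open>h dx\<close> is closed whenever dh is a combination of dx and dy.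
  As \<open>x\<close> and \<open>y\<close> are only Lipschitz, forms are replaced by functions of
  pairs of points and derivatives by quadratic remainder estimates. A component of a level may
  contain no curve, so integration along it is replaced by constancy of a primitive whose increments
  near it are quadratically small.

  A cut set has to become a single point of the tree; therefore a level helps only if
  \<open>f\<close> is constant on its separating component, and countably many bad levels do no
  harm. The distance between images cannot be the tree metric, since \<open>f\<close> may repeat a
  value on different branches: lengths are measured along the sphere. Chains are used instead of
  curves because connected pieces of fibres then get length zero even if they contain no rectifiable
  curve.\<close>

primrec dyadic_sum :: "('a::real_normed_vector \<Rightarrow> 'a \<Rightarrow> real) \<Rightarrow> nat \<Rightarrow> 'a \<Rightarrow> 'a \<Rightarrow> real" where
  "dyadic_sum \<mu> 0 p q = \<mu> p q"
| "dyadic_sum \<mu> (Suc n) p q =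
    dyadic_sum \<mu> n p (midpoint p q) + dyadic_sum \<mu> n (midpoint p q) q"

lemma dist_midpoints:
  fixes p q r :: "'a::real_normed_vector"
  shows "dist (midpoint p q) (midpoint q r) = dist p r / 2"
proof -
  have "midpoint p q - midpoint q r = (p - r) /\<^sub>R 2"
    by (simp add: midpoint_def algebra_simps)
  then show ?thesis by (simp add: dist_norm)
qed

lemma zero_if_le_halving:
  fixes a B :: real
  assumes "\<And>n. \<bar>a\<bar> \<le> B * (1/2)^n"
  shows "a = 0"
proof -
  have "(\<lambda>n. B * (1/2)^n) \<longlonglongrightarrow> B * 0"
    by (intro tendsto_intros LIMSEQ_realpow_zero) auto
  then have "\<bar>a\<bar> \<le> B * 0"
    using assms by (intro LIMSEQ_le_const) auto
  then show ?thesis by simp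
qed

text \<open>Goursat's argument: the \<open>4\<^sup>n\<close> triangles of the \<open>n\<close>-th subdivision have perimeter of order
  \<open>2\<^sup>-\<^sup>n\<close>, so defects of third order add up to zero in the limit.\<close>

lemma almost_closed_cochain_primitive:
  fixes \<mu> :: "'a::real_normed_vector \<Rightarrow> 'a \<Rightarrow> real"
  assumes C: "0 \<le> C"
    and defect: "\<And>p q r. \<bar>\<mu> p q + \<mu> q r - \<mu> p r\<bar> \<le> C * (dist p q + dist q r)^3"
  shows "\<exists>W. \<forall>p q. \<bar>W q - W p - \<mu> p q\<bar> \<le> 2 * C * (dist p q)^3"
proof -
  have diag: "\<mu> p p = 0" for p
    using defect[of p p p] by simp
  \<comment> \<open>Each refinement replaces a segment by two of half its length; the cubes of their
    lengths add up to 2/8 of the old cube, whence the ratio 1/4.\<close>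
  have step: "\<bar>dyadic_sum \<mu> (Suc n) p q - dyadic_sum \<mu> n p q\<bar> \<le> C * (dist p q)^3 * (1/4)^n" for n p q
  proof (induction n arbitrary: p q)
    case 0
    have "dist p (midpoint p q) + dist (midpoint p q) q = dist p q"
      by (simp add: dist_midpoint)
    then show ?case using defect[of p "midpoint p q" q] by simp
  next
    case (Suc n)
    let ?m = "midpoint p q"
    have "\<bar>dyadic_sum \<mu> (Suc (Suc n)) p q - dyadic_sum \<mu> (Suc n) p q\<bar>
      \<le> C * (dist p ?m)^3 * (1/4)^n + C * (dist ?m q)^3 * (1/4)^n"
      using Suc[of p ?m] Suc[of ?m q] by simp
    also have "\<dots> = C * (dist p q)^3 * (1/4)^Suc n"
      by (simp add: dist_midpoint power3_eq_cube)
    finally show ?case .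
  qed
  have conv: "\<exists>l. (\<lambda>n. dyadic_sum \<mu> n p q) \<longlonglongrightarrow> l \<and> \<bar>l - \<mu> p q\<bar> \<le> 2 * C * (dist p q)^3" for p q
  proof -
    let ?D = "\<lambda>n. dyadic_sum \<mu> (Suc n) p q - dyadic_sum \<mu> n p q"
    let ?b = "C * (dist p q)^3"
    have b: "0 \<le> ?b" using C by simp
    have geo: "summable (\<lambda>n. ?b * (1/4::real)^n)"
      by (intro summable_mult summable_geometric) auto
    then have D: "summable ?D"
      by (rule summable_comparison_test') (use step in auto)
    have "\<bar>suminf ?D\<bar> \<le> (\<Sum>n. ?b * (1/4::real)^n)"
      using norm_suminf_le[OF _ geo, of ?D] step by simp
    also have "\<dots> = ?b * (4/3)"
      by (subst suminf_mult) (auto simp: suminf_geometric)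
    finally have "\<bar>suminf ?D\<bar> \<le> 2 * ?b" using b by linarith
    moreover have "(\<lambda>n. (\<Sum>i<n. ?D i) + \<mu> p q) \<longlonglongrightarrow> suminf ?D + \<mu> p q"
      by (intro tendsto_intros summable_LIMSEQ D)
    ultimately show ?thesis
      by (intro exI[of _ "suminf ?D + \<mu> p q"]) (simp add: sum_lessThan_telescope[of "\<lambda>n. dyadic_sum \<mu> n p q"] del: dyadic_sum.simps(2))
  qed
  then obtain I where I: "\<And>p q. (\<lambda>n. dyadic_sum \<mu> n p q) \<longlonglongrightarrow> I p q"
    and I\<mu>: "\<And>p q. \<bar>I p q - \<mu> p q\<bar> \<le> 2 * C * (dist p q)^3"
    by metis
  have Im: "I p q = I p (midpoint p q) + I (midpoint p q) q" for p q
  proof (rule LIMSEQ_unique)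
    show "(\<lambda>n. dyadic_sum \<mu> (Suc n) p q) \<longlonglongrightarrow> I p q"
      using I by (rule LIMSEQ_Suc)
    show "(\<lambda>n. dyadic_sum \<mu> (Suc n) p q) \<longlonglongrightarrow> I p (midpoint p q) + I (midpoint p q) q"
      unfolding dyadic_sum.simps by (intro tendsto_intros I)
  qed
  have \<mu>anti: "\<bar>\<mu> p q + \<mu> q p\<bar> \<le> 8 * C * (dist p q)^3" for p q
    using defect[of p q p] by (simp add: diag dist_commute power3_eq_cube)
  \<comment> \<open>The start 12 = 2 + 2 + 8 comes from two passages from \<open>I\<close> to
    \<open>\<mu>\<close> and one use of \<open>\<mu>anti\<close>, whose 8 is the cube of the factor
    2 in the length of the degenerate triangle p, q, p.\<close>
  have anti: "I p q + I q p = 0" for p q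
  proof (rule zero_if_le_halving)
    show "\<bar>I p q + I q p\<bar> \<le> 12 * C * (dist p q)^3 * (1/2)^n" for n
    proof (induction n arbitrary: p q)
      case 0
      then show ?case
        using I\<mu>[of p q] I\<mu>[of q p] \<mu>anti[of p q] by (simp add: dist_commute)
    next
      case (Suc n)
      let ?m = "midpoint p q"
      have "\<bar>I p q + I q p\<bar> \<le> \<bar>I p ?m + I ?m p\<bar> + \<bar>I ?m q + I q ?m\<bar>"
        using Im[of p q] Im[of q p] by (simp add: midpoint_sym)
      also have "\<dots> \<le> 12 * C * (dist p ?m)^3 * (1/2)^n + 12 * C * (dist ?m q)^3 * (1/2)^n"
        using Suc by (intro add_mono) auto
      also have "\<dots> = (1/2) * (12 * C * (dist p q)^3 * (1/2)^Suc n)"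
        by (simp add: dist_midpoint power3_eq_cube)
      also have "\<dots> \<le> 12 * C * (dist p q)^3 * (1/2)^Suc n"
      proof -
        have "0 \<le> 12 * C * (dist p q)^3 * (1/2)^Suc n" using C by simp
        then show ?thesis by linarith
      qed
      finally show ?case .
    qed
  qed
  define J where "J p q r = I p q + I q r + I r p" for p q r
  \<comment> \<open>15 = 3 * 2 + 1 + 8: three passages from \<open>I\<close> to
    \<open>\<mu>\<close>, one triangle defect, one reversed edge. Four triangles of half the
    perimeter turn the cube into 4/8, the factor 1/2.\<close>
  have "J p q r = 0" for p q r
  proof (rule zero_if_le_halving)
    let ?P = "\<lambda>p q r::'a. dist p q + dist q r + dist r p"
    show "\<bar>J p q r\<bar> \<le> 15 * C * (?P p q r)^3 * (1/2)^n" for n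
    proof (induction n arbitrary: p q r)
      case 0
      have b: "C * t^3 \<le> C * (?P p q r)^3" if "0 \<le> t" "t \<le> ?P p q r" for t
        using that C by (intro mult_left_mono power_mono) auto
      have "\<bar>J p q r\<bar> \<le> 2 * C * (dist p q)^3 + 2 * C * (dist q r)^3 + 2 * C * (dist r p)^3
          + C * (dist p q + dist q r)^3 + 8 * C * (dist r p)^3"
        using I\<mu>[of p q] I\<mu>[of q r] I\<mu>[of r p] defect[of p q r] \<mu>anti[of r p]
        unfolding J_def by linarith
      also have "\<dots> \<le> 15 * (C * (?P p q r)^3)"
        using b[of "dist p q"] b[of "dist q r"] b[of "dist r p"] b[of "dist p q + dist q r"]
        by simp
      finally show ?case by simp
    next
      case (Suc n)
      let ?a = "midpoint p q" and ?b = "midpoint q r" and ?c = "midpoint r p"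
      \<comment> \<open>Three corner triangles and the medial one; the inner edges are run through
        in both directions and cancel.\<close>
      have "J p q r = J p ?a ?c + J ?a q ?b + J ?b r ?c + J ?a ?b ?c"
        unfolding J_def using Im[of p q] Im[of q r] Im[of r p] anti[of ?a ?c] anti[of ?a ?b]
          anti[of ?b ?c] by linarith
      then have "\<bar>J p q r\<bar> \<le> \<bar>J p ?a ?c\<bar> + \<bar>J ?a q ?b\<bar> + \<bar>J ?b r ?c\<bar> + \<bar>J ?a ?b ?c\<bar>"
        by linarith
      also have "\<dots> \<le> 4 * (15 * C * (?P p q r / 2)^3 * (1/2)^n)"
      proof -
        have e: "?P p ?a ?c = ?P p q r / 2" "?P ?a q ?b = ?P p q r / 2" "?P ?b r ?c = ?P p q r / 2"
          "?P ?a ?b ?c = ?P p q r / 2"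
          using dist_midpoints[of p q r] dist_midpoints[of q r p] dist_midpoints[of r p q]
          by (simp_all add: dist_midpoint dist_commute)
        then show ?thesis
          using Suc[of p ?a ?c] Suc[of ?a q ?b] Suc[of ?b r ?c] Suc[of ?a ?b ?c] unfolding e
          by linarith
      qed
      also have "\<dots> = 15 * C * (?P p q r)^3 * (1/2)^Suc n"
        by (simp add: power3_eq_cube)
      finally show ?case .
    qed
  qed
  then have "I 0 q - I 0 p = I p q" for p q
    using anti[of q 0] anti[of p 0] J_def[of 0 p q] by simp
  then show ?thesis
    using I\<mu> by (intro exI[of _ "I 0"]) simp
qed

section \<open>Functions differentiable along a horizontal map\<close>

definition bounded_lipschitz :: "('a::metric_space \<Rightarrow> real) \<Rightarrow> bool" where
  "bounded_lipschitz h \<longleftrightarrow> (\<exists>K\<ge>0. \<forall>p q. \<bar>h p\<bar> \<le> K \<and> \<bar>h q - h p\<bar> \<le> K * dist p q)"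

text \<open>\<open>dh = \<alpha> dx + \<beta> dy\<close>; the functions \<open>x\<close>, \<open>y\<close> themselves are only Lipschitz.\<close>

definition has_frame_deriv ::
  "('a::metric_space \<Rightarrow> real) \<Rightarrow> ('a \<Rightarrow> real) \<Rightarrow> ('a \<Rightarrow> real) \<Rightarrow> ('a \<Rightarrow> real) \<Rightarrow> ('a \<Rightarrow> real) \<Rightarrow> bool" where
  "has_frame_deriv x y h \<alpha> \<beta> \<longleftrightarrow>
    (\<exists>K\<ge>0. \<forall>p q. \<bar>h q - h p - \<alpha> p * (x q - x p) - \<beta> p * (y q - y p)\<bar> \<le> K * (dist p q)\<^sup>2)"

text \<open>\<open>frame_C1\<close> and \<open>frame_C2\<close> imitate C^{1,1} and C^{2,1}
  functions on the Heisenberg group composed with the map. The coefficients stand for horizontal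
  derivatives; \<open>h\<close> need not determine them where the map degenerates, so any admissible
  pair is accepted.\<close>

definition frame_C1 ::
  "('a::metric_space \<Rightarrow> real) \<Rightarrow> ('a \<Rightarrow> real) \<Rightarrow> ('a \<Rightarrow> real) \<Rightarrow> bool" where
  "frame_C1 x y h \<longleftrightarrow> bounded_lipschitz h \<and>
    (\<exists>\<alpha> \<beta>. bounded_lipschitz \<alpha> \<and> bounded_lipschitz \<beta> \<and> has_frame_deriv x y h \<alpha> \<beta>)"

definition frame_C2 ::
  "('a::metric_space \<Rightarrow> real) \<Rightarrow> ('a \<Rightarrow> real) \<Rightarrow> ('a \<Rightarrow> real) \<Rightarrow> bool" where
  "frame_C2 x y h \<longleftrightarrow> bounded_lipschitz h \<and>
    (\<exists>\<alpha> \<beta>. frame_C1 x y \<alpha> \<and> frame_C1 x y \<beta> \<and> has_frame_deriv x y h \<alpha> \<beta>)"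

section \<open>Sums, products and compositions along the frame\<close>

lemma bounded_lipschitzE:
  assumes "bounded_lipschitz h"
  obtains K where "0 \<le> K" "\<And>p. \<bar>h p\<bar> \<le> K" "\<And>p q. \<bar>h q - h p\<bar> \<le> K * dist p q"
  using assms unfolding bounded_lipschitz_def by blast

lemma has_frame_derivE:
  assumes "has_frame_deriv x y h \<alpha> \<beta>"
  obtains K where "0 \<le> K"
    "\<And>p q. \<bar>h q - h p - \<alpha> p * (x q - x p) - \<beta> p * (y q - y p)\<bar> \<le> K * (dist p q)\<^sup>2"
  using assms unfolding has_frame_deriv_def by blast

lemma bounded_lipschitzI:
  assumes "\<And>p. \<bar>h p\<bar> \<le> B" "\<And>p q. \<bar>h q - h p\<bar> \<le> L * dist p q"
  shows "bounded_lipschitz h"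
  unfolding bounded_lipschitz_def
proof (intro exI[of _ "max \<bar>B\<bar> \<bar>L\<bar>"] conjI allI)
  fix p q
  show "\<bar>h p\<bar> \<le> max \<bar>B\<bar> \<bar>L\<bar>" using assms(1)[of p] by linarith
  have "L * dist p q \<le> max \<bar>B\<bar> \<bar>L\<bar> * dist p q" by (intro mult_right_mono) auto
  then show "\<bar>h q - h p\<bar> \<le> max \<bar>B\<bar> \<bar>L\<bar> * dist p q" using assms(2)[of q p] by linarith
qed simp

lemma bounded_lipschitz_const: "bounded_lipschitz (\<lambda>_. c)"
  by (rule bounded_lipschitzI[of _ "\<bar>c\<bar>" 0]) auto

lemma bounded_lipschitz_add:
  assumes "bounded_lipschitz h" "bounded_lipschitz k"
  shows "bounded_lipschitz (\<lambda>p. h p + k p)"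
proof -
  obtain K where K: "0 \<le> K" "\<And>p. \<bar>h p\<bar> \<le> K" "\<And>p q. \<bar>h q - h p\<bar> \<le> K * dist p q"
    using bounded_lipschitzE[OF assms(1)] by metis
  obtain L where L: "0 \<le> L" "\<And>p. \<bar>k p\<bar> \<le> L" "\<And>p q. \<bar>k q - k p\<bar> \<le> L * dist p q"
    using bounded_lipschitzE[OF assms(2)] by metis
  show ?thesis
  proof (rule bounded_lipschitzI[of _ "K + L" "K + L"])
    show "\<bar>h p + k p\<bar> \<le> K + L" for p using K(2)[of p] L(2)[of p] by linarith
    show "\<bar>h q + k q - (h p + k p)\<bar> \<le> (K + L) * dist p q" for p q
      using K(3)[of q p] L(3)[of q p] by (simp add: distrib_right)
  qed
qed

lemma bounded_lipschitz_mult: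
  assumes "bounded_lipschitz h" "bounded_lipschitz k"
  shows "bounded_lipschitz (\<lambda>p. h p * k p)"
proof -
  obtain K where K: "0 \<le> K" "\<And>p. \<bar>h p\<bar> \<le> K" "\<And>p q. \<bar>h q - h p\<bar> \<le> K * dist p q"
    using bounded_lipschitzE[OF assms(1)] by metis
  obtain L where L: "0 \<le> L" "\<And>p. \<bar>k p\<bar> \<le> L" "\<And>p q. \<bar>k q - k p\<bar> \<le> L * dist p q"
    using bounded_lipschitzE[OF assms(2)] by metis
  show ?thesis
  proof (rule bounded_lipschitzI[of _ "K * L" "2 * K * L"])
    show "\<bar>h p * k p\<bar> \<le> K * L" for p
      using K(1) K(2)[of p] L(2)[of p] by (simp add: abs_mult mult_mono)
    show "\<bar>h q * k q - h p * k p\<bar> \<le> 2 * K * L * dist p q" for p q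
    proof -
      have "h q * k q - h p * k p = h q * (k q - k p) + (h q - h p) * k p"
        by (simp add: algebra_simps)
      then have "\<bar>h q * k q - h p * k p\<bar> \<le> \<bar>h q\<bar> * \<bar>k q - k p\<bar> + \<bar>h q - h p\<bar> * \<bar>k p\<bar>"
        by (metis abs_mult abs_triangle_ineq)
      also have "\<dots> \<le> K * (L * dist p q) + (K * dist p q) * L"
        using K(1) K(2)[of q] L(1) L(2)[of p] L(3)[of q p] K(3)[of q p]
        by (intro add_mono mult_mono) auto
      finally show ?thesis by (simp add: algebra_simps)
    qed
  qed
qed

lemma bounded_lipschitz_max0:
  assumes "bounded_lipschitz h"
  shows "bounded_lipschitz (\<lambda>p. max 0 (h p))"
proof -
  obtain K where K: "0 \<le> K" "\<And>p. \<bar>h p\<bar> \<le> K" "\<And>p q. \<bar>h q - h p\<bar> \<le> K * dist p q"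
    using bounded_lipschitzE[OF assms] by metis
  show ?thesis
  proof (rule bounded_lipschitzI[of _ K K])
    show "\<bar>max 0 (h p)\<bar> \<le> K" for p using K(2)[of p] by linarith
    show "\<bar>max 0 (h q) - max 0 (h p)\<bar> \<le> K * dist p q" for p q
      using K(3)[of q p] by linarith
  qed
qed

lemma has_frame_deriv_add:
  assumes "has_frame_deriv x y h \<alpha> \<beta>" "has_frame_deriv x y k \<alpha>' \<beta>'"
  shows "has_frame_deriv x y (\<lambda>p. h p + k p) (\<lambda>p. \<alpha> p + \<alpha>' p) (\<lambda>p. \<beta> p + \<beta>' p)"
proof -
  obtain K where K: "0 \<le> K"
    "\<And>p q. \<bar>h q - h p - \<alpha> p * (x q - x p) - \<beta> p * (y q - y p)\<bar> \<le> K * (dist p q)\<^sup>2"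
    using has_frame_derivE[OF assms(1)] by metis
  obtain L where L: "0 \<le> L"
    "\<And>p q. \<bar>k q - k p - \<alpha>' p * (x q - x p) - \<beta>' p * (y q - y p)\<bar> \<le> L * (dist p q)\<^sup>2"
    using has_frame_derivE[OF assms(2)] by metis
  show ?thesis
    unfolding has_frame_deriv_def
  proof (intro exI[of _ "K + L"] conjI allI)
    show "0 \<le> K + L" using K L by simp
    fix p q
    show "\<bar>h q + k q - (h p + k p) - (\<alpha> p + \<alpha>' p) * (x q - x p) - (\<beta> p + \<beta>' p) * (y q - y p)\<bar>
         \<le> (K + L) * (dist p q)\<^sup>2"
      using K(2)[of q p] L(2)[of q p] unfolding distrib_right by linarith
  qed
qed

lemma has_frame_deriv_mult:
  assumes "has_frame_deriv x y h \<alpha> \<beta>" "has_frame_deriv x y k \<alpha>' \<beta>'"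
    and "bounded_lipschitz h" "bounded_lipschitz k"
  shows "has_frame_deriv x y (\<lambda>p. h p * k p)
    (\<lambda>p. h p * \<alpha>' p + k p * \<alpha> p) (\<lambda>p. h p * \<beta>' p + k p * \<beta> p)"
proof -
  obtain K where K: "0 \<le> K"
    "\<And>p q. \<bar>h q - h p - \<alpha> p * (x q - x p) - \<beta> p * (y q - y p)\<bar> \<le> K * (dist p q)\<^sup>2"
    using has_frame_derivE[OF assms(1)] by metis
  obtain L where L: "0 \<le> L"
    "\<And>p q. \<bar>k q - k p - \<alpha>' p * (x q - x p) - \<beta>' p * (y q - y p)\<bar> \<le> L * (dist p q)\<^sup>2"
    using has_frame_derivE[OF assms(2)] by metis
  obtain H where H: "0 \<le> H" "\<And>p. \<bar>h p\<bar> \<le> H" "\<And>p q. \<bar>h q - h p\<bar> \<le> H * dist p q"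
    using bounded_lipschitzE[OF assms(3)] by metis
  obtain M where M: "0 \<le> M" "\<And>p. \<bar>k p\<bar> \<le> M" "\<And>p q. \<bar>k q - k p\<bar> \<le> M * dist p q"
    using bounded_lipschitzE[OF assms(4)] by metis
  show ?thesis
    unfolding has_frame_deriv_def
  proof (intro exI[of _ "H * L + M * K + H * M"] conjI allI)
    show "0 \<le> H * L + M * K + H * M" using K L H M by simp
    fix p q
    let ?rh = "h q - h p - \<alpha> p * (x q - x p) - \<beta> p * (y q - y p)"
    let ?rk = "k q - k p - \<alpha>' p * (x q - x p) - \<beta>' p * (y q - y p)"
    have "h q * k q - h p * k p - (h p * \<alpha>' p + k p * \<alpha> p) * (x q - x p)
        - (h p * \<beta>' p + k p * \<beta> p) * (y q - y p)
      = h p * ?rk + k p * ?rh + (h q - h p) * (k q - k p)"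
      by (simp add: algebra_simps)
    then have "\<bar>h q * k q - h p * k p - (h p * \<alpha>' p + k p * \<alpha> p) * (x q - x p)
        - (h p * \<beta>' p + k p * \<beta> p) * (y q - y p)\<bar>
      \<le> \<bar>h p\<bar> * \<bar>?rk\<bar> + \<bar>k p\<bar> * \<bar>?rh\<bar> + \<bar>h q - h p\<bar> * \<bar>k q - k p\<bar>"
      unfolding abs_mult[symmetric] by linarith
    also have "\<dots> \<le> H * (L * (dist p q)\<^sup>2) + M * (K * (dist p q)\<^sup>2) + (H * dist p q) * (M * dist p q)"
      using H(1) M(1) H(2)[of p] M(2)[of p] H(3)[of q p] M(3)[of q p] K(2)[of q p] L(2)[of q p]
      by (intro add_mono mult_mono) auto
    finally show "\<bar>h q * k q - h p * k p - (h p * \<alpha>' p + k p * \<alpha> p) * (x q - x p)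
        - (h p * \<beta>' p + k p * \<beta> p) * (y q - y p)\<bar> \<le> (H * L + M * K + H * M) * (dist p q)\<^sup>2"
      by (simp add: algebra_simps power2_eq_square)
  qed
qed

text \<open>The Taylor remainder of \<open>\<phi>\<close> is required at values of \<open>h\<close>
  only, because the truncated cube has a uniform quadratic remainder only on bounded sets.\<close>

lemma has_frame_deriv_compose:
  assumes "has_frame_deriv x y h \<alpha> \<beta>" "bounded_lipschitz h" "bounded_lipschitz (\<lambda>p. \<phi>' (h p))"
    and K: "0 \<le> K" "\<And>p q. \<bar>\<phi> (h q) - \<phi> (h p) - \<phi>' (h p) * (h q - h p)\<bar> \<le> K * (h q - h p)\<^sup>2"
  shows "has_frame_deriv x y (\<lambda>p. \<phi> (h p)) (\<lambda>p. \<phi>' (h p) * \<alpha> p) (\<lambda>p. \<phi>' (h p) * \<beta> p)"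
proof -
  obtain L where L: "0 \<le> L"
    "\<And>p q. \<bar>h q - h p - \<alpha> p * (x q - x p) - \<beta> p * (y q - y p)\<bar> \<le> L * (dist p q)\<^sup>2"
    using has_frame_derivE[OF assms(1)] by metis
  obtain H where H: "0 \<le> H" "\<And>p. \<bar>h p\<bar> \<le> H" "\<And>p q. \<bar>h q - h p\<bar> \<le> H * dist p q"
    using bounded_lipschitzE[OF assms(2)] by metis
  obtain M where M: "0 \<le> M" "\<And>p. \<bar>\<phi>' (h p)\<bar> \<le> M"
    using bounded_lipschitzE[OF assms(3)] by metis
  show ?thesis
    unfolding has_frame_deriv_def
  proof (intro exI[of _ "K * H\<^sup>2 + M * L"] conjI allI)
    show "0 \<le> K * H\<^sup>2 + M * L" using K L M by simp
    fix p q
    let ?rh = "h q - h p - \<alpha> p * (x q - x p) - \<beta> p * (y q - y p)"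
    have "\<phi> (h q) - \<phi> (h p) - \<phi>' (h p) * \<alpha> p * (x q - x p) - \<phi>' (h p) * \<beta> p * (y q - y p)
      = (\<phi> (h q) - \<phi> (h p) - \<phi>' (h p) * (h q - h p)) + \<phi>' (h p) * ?rh"
      by (simp add: algebra_simps)
    then have "\<bar>\<phi> (h q) - \<phi> (h p) - \<phi>' (h p) * \<alpha> p * (x q - x p) - \<phi>' (h p) * \<beta> p * (y q - y p)\<bar>
      \<le> K * (h q - h p)\<^sup>2 + \<bar>\<phi>' (h p)\<bar> * \<bar>?rh\<bar>"
      using K(2)[of q p] unfolding abs_mult[symmetric] by linarith
    also have "\<dots> \<le> K * (H * dist p q)\<^sup>2 + M * (L * (dist p q)\<^sup>2)"
    proof (intro add_mono mult_left_mono mult_mono)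
      show "(h q - h p)\<^sup>2 \<le> (H * dist p q)\<^sup>2"
        using H(1) H(3)[of q p] by (intro abs_le_square_iff[THEN iffD1]) (auto simp: abs_mult)
    qed (use K M L in auto)
    finally show "\<bar>\<phi> (h q) - \<phi> (h p) - \<phi>' (h p) * \<alpha> p * (x q - x p) - \<phi>' (h p) * \<beta> p * (y q - y p)\<bar>
        \<le> (K * H\<^sup>2 + M * L) * (dist p q)\<^sup>2"
      by (simp add: algebra_simps power2_eq_square)
  qed
qed

lemma max0_square_remainder:
  fixes s t :: real
  shows "\<bar>(max 0 t)\<^sup>2 - (max 0 s)\<^sup>2 - 2 * max 0 s * (t - s)\<bar> \<le> (t - s)\<^sup>2"
proof (cases "0 \<le> s"; cases "0 \<le> t")
  assume st: "0 \<le> s" "\<not> 0 \<le> t"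
  then have "s * t \<le> 0" by (simp add: mult_nonneg_nonpos)
  then have "0 \<le> s * s - 2 * (s * t)" using zero_le_square[of s] by linarith
  then have "0 \<le> s\<^sup>2 - 2 * s * t" by (simp add: power2_eq_square)
  moreover have "s\<^sup>2 - 2 * s * t \<le> (t - s)\<^sup>2"
    by (simp add: power2_diff)
  moreover have "(max 0 t)\<^sup>2 - (max 0 s)\<^sup>2 - 2 * max 0 s * (t - s) = s\<^sup>2 - 2 * s * t"
    using st by (simp add: power2_eq_square algebra_simps)
  ultimately show ?thesis by linarith
next
  assume st: "\<not> 0 \<le> s" "0 \<le> t"
  then have "t\<^sup>2 \<le> (t - s)\<^sup>2" by (intro power_mono) auto
  then show ?thesis using st by simp
next
  assume st: "0 \<le> s" "0 \<le> t"
  then have "(max 0 t)\<^sup>2 - (max 0 s)\<^sup>2 - 2 * max 0 s * (t - s) = (t - s)\<^sup>2"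
    by (simp add: power2_eq_square algebra_simps)
  then show ?thesis by simp
qed simp

text \<open>The constant covers all sign cases; the largest factor that occurs is
  \<open>2 * s - 3 * t\<close>, at most \<open>5 * B\<close>.\<close>

lemma max0_cube_remainder:
  fixes s t :: real
  assumes "\<bar>s\<bar> \<le> B" "\<bar>t\<bar> \<le> B"
  shows "\<bar>(max 0 t)^3 - (max 0 s)^3 - 3 * (max 0 s)\<^sup>2 * (t - s)\<bar> \<le> 6 * B * (t - s)\<^sup>2"
proof (cases "0 \<le> s"; cases "0 \<le> t")
  assume st: "0 \<le> s" "0 \<le> t"
  have "t^3 - s^3 - 3 * s\<^sup>2 * (t - s) = (t + 2 * s) * (t - s)\<^sup>2"
    by (simp add: power2_eq_square power3_eq_cube algebra_simps)
  moreover have "\<bar>(t + 2 * s) * (t - s)\<^sup>2\<bar> \<le> 6 * B * (t - s)\<^sup>2"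
    using st assms by (simp add: abs_mult mult_right_mono)
  ultimately show ?thesis using st by simp
next
  assume st: "0 \<le> s" "\<not> 0 \<le> t"
  have "\<bar>- (s^3) - 3 * s\<^sup>2 * (t - s)\<bar> = \<bar>(2 * s - 3 * t) * s\<^sup>2\<bar>"
    by (simp add: power2_eq_square power3_eq_cube algebra_simps)
  also have "\<dots> \<le> (6 * B) * (t - s)\<^sup>2"
    unfolding abs_mult using st assms
    by (intro mult_mono) (auto intro!: power_mono simp: power2_commute[of t])
  finally show ?thesis using st by simp
next
  assume st: "\<not> 0 \<le> s" "0 \<le> t"
  have "t^3 = t * t\<^sup>2" by (simp add: power2_eq_square power3_eq_cube)
  also have "\<dots> \<le> (6 * B) * (t - s)\<^sup>2"
    using st assms by (intro mult_mono power_mono) auto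
  finally show ?thesis using st by simp
next
  assume "\<not> 0 \<le> s" "\<not> 0 \<le> t"
  then show ?thesis using assms by simp
qed

lemma frame_C1I:
  assumes "has_frame_deriv x y h \<alpha> \<beta>" "bounded_lipschitz h" "bounded_lipschitz \<alpha>" "bounded_lipschitz \<beta>"
  shows "frame_C1 x y h"
  using assms unfolding frame_C1_def by blast

lemma frame_C1E:
  assumes "frame_C1 x y h"
  obtains \<alpha> \<beta> where "has_frame_deriv x y h \<alpha> \<beta>" "bounded_lipschitz h"
    "bounded_lipschitz \<alpha>" "bounded_lipschitz \<beta>"
  using assms unfolding frame_C1_def by blast

lemma frame_C2I:
  assumes "has_frame_deriv x y h \<alpha> \<beta>" "bounded_lipschitz h" "frame_C1 x y \<alpha>" "frame_C1 x y \<beta>"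
  shows "frame_C2 x y h"
  using assms unfolding frame_C2_def by blast

lemma frame_C2E:
  assumes "frame_C2 x y h"
  obtains \<alpha> \<beta> where "has_frame_deriv x y h \<alpha> \<beta>" "bounded_lipschitz h"
    "frame_C1 x y \<alpha>" "frame_C1 x y \<beta>"
  using assms unfolding frame_C2_def by blast

lemma frame_C1_imp_bl: "frame_C1 x y h \<Longrightarrow> bounded_lipschitz h"
  by (simp add: frame_C1_def)

lemma frame_C2_imp_C1: "frame_C2 x y h \<Longrightarrow> frame_C1 x y h"
  unfolding frame_C1_def frame_C2_def by blast

lemma has_frame_deriv_const: "has_frame_deriv x y (\<lambda>_. c) (\<lambda>_. 0) (\<lambda>_. 0)"
  unfolding has_frame_deriv_def by (auto intro: exI[of _ 0])

lemma frame_C1_const: "frame_C1 x y (\<lambda>_. c)"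
  by (rule frame_C1I[OF has_frame_deriv_const]) (rule bounded_lipschitz_const)+

lemma frame_C2_const: "frame_C2 x y (\<lambda>_. c)"
  by (rule frame_C2I[OF has_frame_deriv_const]) (rule bounded_lipschitz_const frame_C1_const)+

lemma frame_C1_add:
  assumes "frame_C1 x y h" "frame_C1 x y k"
  shows "frame_C1 x y (\<lambda>p. h p + k p)"
proof -
  obtain \<alpha> \<beta> where h: "has_frame_deriv x y h \<alpha> \<beta>" "bounded_lipschitz h"
    "bounded_lipschitz \<alpha>" "bounded_lipschitz \<beta>"
    using assms(1) by (blast elim: frame_C1E)
  obtain \<alpha>' \<beta>' where k: "has_frame_deriv x y k \<alpha>' \<beta>'" "bounded_lipschitz k"
    "bounded_lipschitz \<alpha>'" "bounded_lipschitz \<beta>'"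
    using assms(2) by (blast elim: frame_C1E)
  show ?thesis
    by (rule frame_C1I[OF has_frame_deriv_add[OF h(1) k(1)]]; intro bounded_lipschitz_add h k)
qed

lemma frame_C1_mult:
  assumes "frame_C1 x y h" "frame_C1 x y k"
  shows "frame_C1 x y (\<lambda>p. h p * k p)"
proof -
  obtain \<alpha> \<beta> where h: "has_frame_deriv x y h \<alpha> \<beta>" "bounded_lipschitz h"
    "bounded_lipschitz \<alpha>" "bounded_lipschitz \<beta>"
    using assms(1) by (blast elim: frame_C1E)
  obtain \<alpha>' \<beta>' where k: "has_frame_deriv x y k \<alpha>' \<beta>'" "bounded_lipschitz k"
    "bounded_lipschitz \<alpha>'" "bounded_lipschitz \<beta>'"
    using assms(2) by (blast elim: frame_C1E)
  show ?thesis
    by (rule frame_C1I[OF has_frame_deriv_mult[OF h(1) k(1) h(2) k(2)]];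
        intro bounded_lipschitz_add bounded_lipschitz_mult h k)
qed

lemma frame_C1_max0_square:
  assumes "frame_C1 x y h"
  shows "frame_C1 x y (\<lambda>p. (max 0 (h p))\<^sup>2)"
proof -
  obtain \<alpha> \<beta> where h: "has_frame_deriv x y h \<alpha> \<beta>" "bounded_lipschitz h"
    "bounded_lipschitz \<alpha>" "bounded_lipschitz \<beta>"
    using assms by (blast elim: frame_C1E)
  have b: "bounded_lipschitz (\<lambda>p. 2 * max 0 (h p))"
    by (intro bounded_lipschitz_mult bounded_lipschitz_const bounded_lipschitz_max0 h)
  have b2: "bounded_lipschitz (\<lambda>p. (max 0 (h p))\<^sup>2)"
    unfolding power2_eq_square by (intro bounded_lipschitz_mult bounded_lipschitz_max0 h)
  have "has_frame_deriv x y (\<lambda>p. (max 0 (h p))\<^sup>2) (\<lambda>p. 2 * max 0 (h p) * \<alpha> p) (\<lambda>p. 2 * max 0 (h p) * \<beta> p)"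
    by (rule has_frame_deriv_compose[OF h(1,2) b, of 1 "\<lambda>t. (max 0 t)\<^sup>2"])
      (use max0_square_remainder in auto)
  then show ?thesis
    by (rule frame_C1I; intro b2 bounded_lipschitz_mult[OF b] h)
qed

lemma frame_C2_add:
  assumes "frame_C2 x y h" "frame_C2 x y k"
  shows "frame_C2 x y (\<lambda>p. h p + k p)"
proof -
  obtain \<alpha> \<beta> where h: "has_frame_deriv x y h \<alpha> \<beta>" "bounded_lipschitz h"
    "frame_C1 x y \<alpha>" "frame_C1 x y \<beta>"
    using assms(1) by (blast elim: frame_C2E)
  obtain \<alpha>' \<beta>' where k: "has_frame_deriv x y k \<alpha>' \<beta>'" "bounded_lipschitz k"
    "frame_C1 x y \<alpha>'" "frame_C1 x y \<beta>'"
    using assms(2) by (blast elim: frame_C2E)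
  show ?thesis
    by (rule frame_C2I[OF has_frame_deriv_add[OF h(1) k(1)]];
        intro bounded_lipschitz_add frame_C1_add h k)
qed

lemma frame_C2_mult:
  assumes "frame_C2 x y h" "frame_C2 x y k"
  shows "frame_C2 x y (\<lambda>p. h p * k p)"
proof -
  obtain \<alpha> \<beta> where h: "has_frame_deriv x y h \<alpha> \<beta>" "bounded_lipschitz h"
    "frame_C1 x y \<alpha>" "frame_C1 x y \<beta>"
    using assms(1) by (blast elim: frame_C2E)
  obtain \<alpha>' \<beta>' where k: "has_frame_deriv x y k \<alpha>' \<beta>'" "bounded_lipschitz k"
    "frame_C1 x y \<alpha>'" "frame_C1 x y \<beta>'"
    using assms(2) by (blast elim: frame_C2E)
  show ?thesis
    by (rule frame_C2I[OF has_frame_deriv_mult[OF h(1) k(1) h(2) k(2)]];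
        intro bounded_lipschitz_mult frame_C1_add frame_C1_mult frame_C2_imp_C1 assms h k)
qed

lemma frame_C2_diff:
  assumes "frame_C2 x y h" "frame_C2 x y k"
  shows "frame_C2 x y (\<lambda>p. h p - k p)"
proof -
  have "frame_C2 x y (\<lambda>p. h p + (-1) * k p)"
    by (intro frame_C2_add frame_C2_mult frame_C2_const assms)
  then show ?thesis by simp
qed

lemma frame_C2_max0_cube:
  assumes "frame_C2 x y h"
  shows "frame_C2 x y (\<lambda>p. (max 0 (h p))^3)"
proof -
  obtain \<alpha> \<beta> where h: "has_frame_deriv x y h \<alpha> \<beta>" "bounded_lipschitz h"
    "frame_C1 x y \<alpha>" "frame_C1 x y \<beta>"
    using assms by (blast elim: frame_C2E)
  obtain B where B: "0 \<le> B" "\<And>p. \<bar>h p\<bar> \<le> B"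
    using bounded_lipschitzE[OF h(2)] by metis
  have c: "frame_C1 x y (\<lambda>p. 3 * (max 0 (h p))\<^sup>2)"
    by (intro frame_C1_mult frame_C1_const frame_C1_max0_square frame_C2_imp_C1 assms)
  have b: "bounded_lipschitz (\<lambda>p. (max 0 (h p))^3)"
    unfolding power3_eq_cube by (intro bounded_lipschitz_mult bounded_lipschitz_max0 h)
  have "has_frame_deriv x y (\<lambda>p. (max 0 (h p))^3)
      (\<lambda>p. 3 * (max 0 (h p))\<^sup>2 * \<alpha> p) (\<lambda>p. 3 * (max 0 (h p))\<^sup>2 * \<beta> p)"
    by (rule has_frame_deriv_compose[OF h(1,2) frame_C1_imp_bl[OF c], of "6 * B" "\<lambda>t. (max 0 t)^3"])
      (use max0_cube_remainder B in auto)
  then show ?thesis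
    by (rule frame_C2I; intro b frame_C1_mult[OF c] h)
qed

text \<open>If dh = alpha dx + beta dy, the differential of the form is beta dy wedge dx, and dy
  wedge dx = d(y dx) = d(dz) = 0. In the proof this appears as a third order defect of
  \<open>\<mu>\<close>. The restriction to distance at most 1 turns the cubic error into a quadratic
  one.\<close>

lemma primitive_dx:
  fixes x y z h :: "'a::real_normed_vector \<Rightarrow> real"
  assumes xy: "bounded_lipschitz x" "bounded_lipschitz y"
    and z: "has_frame_deriv x y z y (\<lambda>_. 0)"
    and h: "frame_C1 x y h"
  shows "\<exists>W K. \<forall>p q. dist p q \<le> 1 \<longrightarrow> \<bar>W q - W p - h p * (x q - x p)\<bar> \<le> K * (dist p q)\<^sup>2"
proof -
  obtain \<alpha> \<beta> where ab: "bounded_lipschitz \<alpha>" "bounded_lipschitz \<beta>" "has_frame_deriv x y h \<alpha> \<beta>"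
    using h unfolding frame_C1_def by blast
  obtain X where X: "0 \<le> X" "\<And>p. \<bar>x p\<bar> \<le> X" "\<And>p q. \<bar>x q - x p\<bar> \<le> X * dist p q"
    using bounded_lipschitzE[OF xy(1)] by metis
  obtain A where A: "0 \<le> A" "\<And>p. \<bar>\<alpha> p\<bar> \<le> A" "\<And>p q. \<bar>\<alpha> q - \<alpha> p\<bar> \<le> A * dist p q"
    using bounded_lipschitzE[OF ab(1)] by metis
  obtain B where B: "0 \<le> B" "\<And>p. \<bar>\<beta> p\<bar> \<le> B" "\<And>p q. \<bar>\<beta> q - \<beta> p\<bar> \<le> B * dist p q"
    using bounded_lipschitzE[OF ab(2)] by metis
  obtain H where H: "0 \<le> H"
    "\<And>p q. \<bar>h q - h p - \<alpha> p * (x q - x p) - \<beta> p * (y q - y p)\<bar> \<le> H * (dist p q)\<^sup>2"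
    using has_frame_derivE[OF ab(3)] by metis
  obtain Z where Z: "0 \<le> Z" "\<And>p q. \<bar>z q - z p - y p * (x q - x p)\<bar> \<le> Z * (dist p q)\<^sup>2"
    using z unfolding has_frame_deriv_def by auto
  \<comment> \<open>The Taylor expansion of \<open>\<integral> h dx\<close> over \<open>[p, q]\<close> up to third order errors;
    \<open>z\<close> supplies the missing integral \<open>\<integral> y dx\<close>.\<close>
  define \<mu> where "\<mu> p q = h p * (x q - x p) + \<alpha> p * (x q - x p)\<^sup>2 / 2
    + \<beta> p * (z q - z p - y p * (x q - x p))" for p q
  let ?C = "H * X + A * X\<^sup>2 + B * Z"
  have defect: "\<bar>\<mu> p q + \<mu> q r - \<mu> p r\<bar> \<le> ?C * (dist p q + dist q r)^3" for p q r
  proof -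
    let ?e = "dist p q + dist q r"
    have e: "dist p q \<le> ?e" "dist q r \<le> ?e" by auto
    have tri: "\<bar>a * b + c / 2 * d + e * f\<bar> \<le> \<bar>a\<bar> * \<bar>b\<bar> + \<bar>c\<bar> / 2 * d + \<bar>e\<bar> * \<bar>f\<bar>"
      if "0 \<le> d" for a b c d e f :: real
    proof -
      have "\<bar>c / 2 * d\<bar> = \<bar>c\<bar> / 2 * d" using that by (simp add: abs_mult)
      then show ?thesis unfolding abs_mult[symmetric] by linarith
    qed
    \<comment> \<open>Everything of first and second order cancels. What remains pairs the second
      order remainder of \<open>h\<close> with dx, and first order changes of
      \<open>\<alpha>\<close>, \<open>\<beta>\<close> with second order increments.\<close>
    have "\<mu> p q + \<mu> q r - \<mu> p r =
      (h q - h p - \<alpha> p * (x q - x p) - \<beta> p * (y q - y p)) * (x r - x q)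
      + (\<alpha> q - \<alpha> p) / 2 * (x r - x q)\<^sup>2
      + (\<beta> q - \<beta> p) * (z r - z q - y q * (x r - x q))"
      unfolding \<mu>_def by (simp add: power2_eq_square field_simps)
    then have "\<bar>\<mu> p q + \<mu> q r - \<mu> p r\<bar> \<le>
      \<bar>h q - h p - \<alpha> p * (x q - x p) - \<beta> p * (y q - y p)\<bar> * \<bar>x r - x q\<bar>
      + \<bar>\<alpha> q - \<alpha> p\<bar> / 2 * (x r - x q)\<^sup>2
      + \<bar>\<beta> q - \<beta> p\<bar> * \<bar>z r - z q - y q * (x r - x q)\<bar>"
      using tri by simp
    also have "\<dots> \<le> (H * ?e\<^sup>2) * (X * ?e) + (A * ?e) * (X * ?e)\<^sup>2 + (B * ?e) * (Z * ?e\<^sup>2)"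
    proof (intro add_mono mult_mono)
      have "H * (dist p q)\<^sup>2 \<le> H * ?e\<^sup>2" using H e by (intro mult_left_mono power_mono) auto
      then show "\<bar>h q - h p - \<alpha> p * (x q - x p) - \<beta> p * (y q - y p)\<bar> \<le> H * ?e\<^sup>2"
        using H(2)[of q p] by linarith
      have xe: "X * dist q r \<le> X * ?e" using X e by (intro mult_left_mono) auto
      then show "\<bar>x r - x q\<bar> \<le> X * ?e" using X(3)[of r q] by linarith
      then show "(x r - x q)\<^sup>2 \<le> (X * ?e)\<^sup>2"
        using X by (intro abs_le_square_iff[THEN iffD1]) (auto simp: abs_mult)
      have "A * dist p q \<le> A * ?e" using A e by (intro mult_left_mono) auto
      then have "\<bar>\<alpha> q - \<alpha> p\<bar> \<le> A * ?e" using A(3)[of q p] by (rule order_trans[rotated])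
      moreover have "\<bar>\<alpha> q - \<alpha> p\<bar> / 2 \<le> \<bar>\<alpha> q - \<alpha> p\<bar>" by simp
      ultimately show "\<bar>\<alpha> q - \<alpha> p\<bar> / 2 \<le> A * ?e" by (rule order_trans[rotated])
      have "B * dist p q \<le> B * ?e" using B e by (intro mult_left_mono) auto
      then show "\<bar>\<beta> q - \<beta> p\<bar> \<le> B * ?e" using B(3)[of q p] by linarith
      have "Z * (dist q r)\<^sup>2 \<le> Z * ?e\<^sup>2" using Z e by (intro mult_left_mono power_mono) auto
      then show "\<bar>z r - z q - y q * (x r - x q)\<bar> \<le> Z * ?e\<^sup>2"
        using Z(2)[of r q] by linarith
    qed (use H A B in auto)
    also have "\<dots> = ?C * ?e^3"
      by (simp add: power2_eq_square power3_eq_cube algebra_simps)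
    finally show ?thesis .
  qed
  have C0: "0 \<le> ?C" using H X A B Z by simp
  then obtain W where W: "\<And>p q. \<bar>W q - W p - \<mu> p q\<bar> \<le> 2 * ?C * (dist p q)^3"
    using almost_closed_cochain_primitive[of ?C \<mu>] defect by blast
  let ?K = "2 * ?C + A * X\<^sup>2 + B * Z"
  have "\<bar>W q - W p - h p * (x q - x p)\<bar> \<le> ?K * (dist p q)\<^sup>2" if "dist p q \<le> 1" for p q
  proof -
    have "(dist p q)^3 \<le> (dist p q)\<^sup>2"
      using that by (simp add: power_decreasing)
    then have 1: "2 * ?C * (dist p q)^3 \<le> 2 * ?C * (dist p q)\<^sup>2"
      using C0 by (intro mult_left_mono) auto
    have 2: "\<bar>\<alpha> p * (x q - x p)\<^sup>2 / 2\<bar> \<le> A * (X * dist p q)\<^sup>2"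
    proof -
      have "\<bar>\<alpha> p\<bar> * (x q - x p)\<^sup>2 \<le> A * (X * dist p q)\<^sup>2"
        using A(1) A(2)[of p] X(1) X(3)[of q p]
        by (intro mult_mono abs_le_square_iff[THEN iffD1]) (auto simp: abs_mult)
      moreover have "\<bar>\<alpha> p * (x q - x p)\<^sup>2 / 2\<bar> \<le> \<bar>\<alpha> p\<bar> * (x q - x p)\<^sup>2"
        by (simp add: abs_mult)
      ultimately show ?thesis by (rule order_trans[rotated])
    qed
    have 3: "\<bar>\<beta> p * (z q - z p - y p * (x q - x p))\<bar> \<le> B * (Z * (dist p q)\<^sup>2)"
      unfolding abs_mult using B(1) B(2)[of p] Z(2)[of q p] by (intro mult_mono) auto
    have "\<bar>W q - W p - h p * (x q - x p)\<bar> \<le>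
        2 * ?C * (dist p q)\<^sup>2 + A * (X * dist p q)\<^sup>2 + B * (Z * (dist p q)\<^sup>2)"
      using W[of q p] 1 2 3 unfolding \<mu>_def by linarith
    then show ?thesis by (simp add: power_mult_distrib algebra_simps)
  qed
  then show ?thesis by blast
qed

lemma has_frame_deriv_swap:
  assumes "has_frame_deriv x y h \<alpha> \<beta>"
  shows "has_frame_deriv y x h \<beta> \<alpha>"
proof -
  have "h q - h p - \<beta> p * (y q - y p) - \<alpha> p * (x q - x p)
      = h q - h p - \<alpha> p * (x q - x p) - \<beta> p * (y q - y p)" for p q
    by simp
  then show ?thesis using assms unfolding has_frame_deriv_def by presburger
qed

lemma frame_C1_swap: "frame_C1 x y h \<Longrightarrow> frame_C1 y x h"
  unfolding frame_C1_def using has_frame_deriv_swap by blast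

text \<open>The form \<open>h dy\<close> is reduced to \<open>h dx\<close> by the swap \<open>(x, y, z) \<mapsto> (y, x, xy - z)\<close>, which
  preserves horizontality since \<open>d(xy - z) = x dy\<close>.\<close>

lemma primitive_dy:
  fixes x y z h :: "'a::real_normed_vector \<Rightarrow> real"
  assumes xy: "bounded_lipschitz x" "bounded_lipschitz y"
    and z: "has_frame_deriv x y z y (\<lambda>_. 0)"
    and h: "frame_C1 x y h"
  shows "\<exists>W K. \<forall>p q. dist p q \<le> 1 \<longrightarrow> \<bar>W q - W p - h p * (y q - y p)\<bar> \<le> K * (dist p q)\<^sup>2"
proof -
  have "has_frame_deriv x y x (\<lambda>_. 1) (\<lambda>_. 0)" "has_frame_deriv x y y (\<lambda>_. 0) (\<lambda>_. 1)"
    unfolding has_frame_deriv_def by (auto intro!: exI[of _ 0])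
  then have "has_frame_deriv x y (\<lambda>p. x p * y p) (\<lambda>p. x p * 0 + y p * 1) (\<lambda>p. x p * 1 + y p * 0)"
    using xy has_frame_deriv_mult by blast
  moreover have "has_frame_deriv x y (\<lambda>p. - z p) (\<lambda>p. - y p) (\<lambda>_. 0)"
  proof -
    have "\<bar>- z q - - z p - - y p * (x q - x p) - 0 * (y q - y p)\<bar>
       = \<bar>z q - z p - y p * (x q - x p) - 0 * (y q - y p)\<bar>" for p q
      by (simp add: abs_if)
    then show ?thesis using z unfolding has_frame_deriv_def by presburger
  qed
  ultimately have "has_frame_deriv x y (\<lambda>p. x p * y p + - z p)
     (\<lambda>p. (x p * 0 + y p * 1) + - y p) (\<lambda>p. (x p * 1 + y p * 0) + 0)"
    by (rule has_frame_deriv_add)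
  then have "has_frame_deriv y x (\<lambda>p. x p * y p + - z p) x (\<lambda>_. 0)"
    using has_frame_deriv_swap by fastforce
  then show ?thesis
    using primitive_dx[of y x] xy h frame_C1_swap by blast
qed

text \<open>The form splits into the two previous ones with coefficients \<open>h * \<alpha>\<close>
  and \<open>h * \<beta>\<close>; these have to be \<open>frame_C1\<close>, hence \<open>u\<close>
  has to be \<open>frame_C2\<close>.\<close>

lemma primitive_du:
  fixes x y z h :: "'a::real_normed_vector \<Rightarrow> real"
  assumes xy: "bounded_lipschitz x" "bounded_lipschitz y"
    and z: "has_frame_deriv x y z y (\<lambda>_. 0)"
    and h: "frame_C1 x y h" and u: "frame_C2 x y u"
  shows "\<exists>W K. \<forall>p q. dist p q \<le> 1 \<longrightarrow> \<bar>W q - W p - h p * (u q - u p)\<bar> \<le> K * (dist p q)\<^sup>2"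
proof -
  obtain \<alpha> \<beta> where ab: "frame_C1 x y \<alpha>" "frame_C1 x y \<beta>" "has_frame_deriv x y u \<alpha> \<beta>"
    using u unfolding frame_C2_def by blast
  obtain U where U: "0 \<le> U"
    "\<And>p q. \<bar>u q - u p - \<alpha> p * (x q - x p) - \<beta> p * (y q - y p)\<bar> \<le> U * (dist p q)\<^sup>2"
    using has_frame_derivE[OF ab(3)] by metis
  obtain H where H: "0 \<le> H" "\<And>p. \<bar>h p\<bar> \<le> H"
    using bounded_lipschitzE[OF frame_C1_imp_bl[OF h]] by metis
  obtain V K where V: "\<And>p q. dist p q \<le> 1 \<Longrightarrow>
      \<bar>V q - V p - h p * \<alpha> p * (x q - x p)\<bar> \<le> K * (dist p q)\<^sup>2"
    using primitive_dx[OF xy z frame_C1_mult[OF h ab(1)]] by blast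
  obtain W L where W: "\<And>p q. dist p q \<le> 1 \<Longrightarrow>
      \<bar>W q - W p - h p * \<beta> p * (y q - y p)\<bar> \<le> L * (dist p q)\<^sup>2"
    using primitive_dy[OF xy z frame_C1_mult[OF h ab(2)]] by blast
  have "\<bar>(V q + W q) - (V p + W p) - h p * (u q - u p)\<bar> \<le> (K + L + H * U) * (dist p q)\<^sup>2"
    if pq: "dist p q \<le> 1" for p q
  proof -
    let ?r = "u q - u p - \<alpha> p * (x q - x p) - \<beta> p * (y q - y p)"
    have "(V q + W q) - (V p + W p) - h p * (u q - u p)
      = (V q - V p - h p * \<alpha> p * (x q - x p)) + (W q - W p - h p * \<beta> p * (y q - y p)) - h p * ?r"
      by (simp add: algebra_simps)
    moreover have "\<bar>h p * ?r\<bar> \<le> H * (U * (dist p q)\<^sup>2)"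
      unfolding abs_mult using H(1) H(2)[of p] U(2)[of q p] by (intro mult_mono) auto
    ultimately have "\<bar>(V q + W q) - (V p + W p) - h p * (u q - u p)\<bar>
      \<le> K * (dist p q)\<^sup>2 + L * (dist p q)\<^sup>2 + H * (U * (dist p q)\<^sup>2)"
      using V[OF pq] W[OF pq] by linarith
    then show ?thesis by (simp add: algebra_simps)
  qed
  then show ?thesis by (intro exI[of _ "\<lambda>p. V p + W p"]) blast
qed

section \<open>Levels carrying a nonconstant function\<close>

lemma has_derivative_zero_if_quadratic:
  fixes G :: "'a::real_normed_vector \<Rightarrow> real"
  assumes "0 < r" and G: "\<And>q. dist p q < r \<Longrightarrow> \<bar>G q - G p\<bar> \<le> K * (dist p q)\<^sup>2"
  shows "(G has_derivative (\<lambda>_. 0)) (at p)"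
  unfolding has_derivative_at_alt
proof (intro conjI allI impI)
  fix e :: real assume e: "0 < e"
  let ?d = "min r (e / (\<bar>K\<bar> + 1))"
  have "norm (G q - G p - 0) \<le> e * norm (q - p)" if q: "norm (q - p) < ?d" for q
  proof -
    have d: "dist p q = norm (q - p)" by (simp add: dist_norm norm_minus_commute)
    have "\<bar>K\<bar> * norm (q - p) \<le> (\<bar>K\<bar> + 1) * norm (q - p)" by (simp add: mult_right_mono)
    also have "\<dots> \<le> e" using q by (simp add: field_simps)
    finally have "K * norm (q - p) \<le> e"
      by (smt (verit) mult_right_mono norm_ge_zero abs_ge_self)
    then have "K * norm (q - p) * norm (q - p) \<le> e * norm (q - p)"
      by (rule mult_right_mono) simp
    then show ?thesis
      using G[of q] q d by (simp add: power2_eq_square mult.assoc)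
  qed
  then show "\<exists>d>0. \<forall>q. norm (q - p) < d \<longrightarrow> norm (G q - G p - 0) \<le> e * norm (q - p)"
    using e \<open>0 < r\<close> by (intro exI[of _ ?d]) auto
qed simp

text \<open>On \<open>U\<close> the derivative of \<open>G\<close> vanishes, so \<open>G\<close> is
  locally constant there. Since \<open>C\<close> may contain no curve, the estimate is asked on an
  open neighbourhood and only local constancy is passed to \<open>C\<close>.\<close>

lemma constant_on_connected_if_quadratic:
  fixes G :: "'a::real_normed_vector \<Rightarrow> real"
  assumes "open U" "connected C" "C \<subseteq> U" "0 < r"
    and G: "\<And>p q. p \<in> U \<Longrightarrow> q \<in> U \<Longrightarrow> dist p q < r \<Longrightarrow> \<bar>G q - G p\<bar> \<le> K * (dist p q)\<^sup>2"
    and "p \<in> C" "q \<in> C"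
  shows "G p = G q"
proof -
  have deriv: "(G has_derivative (\<lambda>_. 0)) (at p)" if p: "p \<in> U" for p
  proof -
    obtain e where "0 < e" "ball p e \<subseteq> U" using \<open>open U\<close> p open_contains_ball by blast
    then show ?thesis
      using G[OF p] \<open>0 < r\<close> by (intro has_derivative_zero_if_quadratic[of "min r e" p G K]) auto
  qed
  have "G constant_on C"
  proof (rule locally_constant_imp_constant[OF \<open>connected C\<close>])
    fix a assume a: "a \<in> C"
    obtain e where e: "0 < e" "ball a e \<subseteq> U" using \<open>open U\<close> a \<open>C \<subseteq> U\<close> open_contains_ball by blast
    have c: "G w = G a" if "w \<in> ball a e" for w
    proof (rule has_derivative_zero_unique[OF convex_ball[of a e]])
      show "(G has_derivative (\<lambda>_. 0)) (at x within ball a e)" if "x \<in> ball a e" for x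
        using deriv[of x] e that by (blast intro: has_derivative_at_withinI)
    qed (use e that in auto)
    show "\<exists>T. openin (top_of_set C) T \<and> a \<in> T \<and> (\<forall>w\<in>T. G w = G a)"
    proof (intro exI[of _ "C \<inter> ball a e"] conjI ballI)
      show "openin (top_of_set C) (C \<inter> ball a e)" by (simp add: openin_open_Int)
      show "a \<in> C \<inter> ball a e" using a e by simp
      show "G w = G a" if "w \<in> C \<inter> ball a e" for w using c that by blast
    qed
  qed
  then show ?thesis using assms unfolding constant_on_def by metis
qed

text \<open>Cubes rather than squares, so that the derivative is again a \<open>frame_C1\<close> function.\<close>

definition plateau :: "real \<Rightarrow> real \<Rightarrow> real \<Rightarrow> real" where
  "plateau a b t = 1 - (max 0 (1 - (1 / (b - a)^3) * (max 0 (t - a))^3))^3"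

lemma plateau_low: "t \<le> a \<Longrightarrow> plateau a b t = 0"
  by (simp add: plateau_def)

lemma plateau_high: "a < b \<Longrightarrow> b \<le> t \<Longrightarrow> plateau a b t = 1"
proof -
  assume ab: "a < b" "b \<le> t"
  then have "(b - a)^3 \<le> (t - a)^3" by (intro power_mono) auto
  moreover have "0 < (b - a)^3" using ab by simp
  ultimately have "1 \<le> (1 / (b - a)^3) * (t - a)^3" by simp
  then have "max 0 (1 - (1 / (b - a)^3) * (max 0 (t - a))^3) = 0"
    using ab by simp
  then show ?thesis unfolding plateau_def by simp
qed

lemma frame_C2_plateau:
  assumes "frame_C2 x y u"
  shows "frame_C2 x y (\<lambda>p. plateau a b (u p))"
  unfolding plateau_def
  by (intro frame_C2_diff frame_C2_mult frame_C2_const frame_C2_max0_cube assms)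

lemma continuous_on_bounded_lipschitz:
  assumes "bounded_lipschitz h"
  shows "continuous_on S h"
proof -
  obtain K where K: "0 \<le> K" "\<And>p q. \<bar>h q - h p\<bar> \<le> K * dist p q"
    using bounded_lipschitzE[OF assms] by metis
  have "K-lipschitz_on S h"
    using K by (intro lipschitz_onI) (auto simp: dist_real_def dist_commute)
  then show ?thesis by (rule lipschitz_on_continuous_on)
qed

lemma frame_C2_imp_bl: "frame_C2 x y h \<Longrightarrow> bounded_lipschitz h"
  by (simp add: frame_C2_def)

text \<open>The loop running along \<open>C\<close>, the segment \<open>[q, q']\<close>, \<open>C'\<close> and the segment \<open>[p', p]\<close> would
  have nonzero winding number under \<open>(u, v)\<close>: the exact form \<open>A(v) d(B(u))\<close> has integral
  \<open>1\<close> over \<open>[q, q']\<close> and vanishes on the other three sides.\<close>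

lemma no_crossing_levels:
  fixes x y z u v :: "'a::euclidean_space \<Rightarrow> real"
  assumes xy: "bounded_lipschitz x" "bounded_lipschitz y"
    and z: "has_frame_deriv x y z y (\<lambda>_. 0)"
    and u: "frame_C2 x y u" and v: "frame_C2 x y v"
    and s: "s < s'" and ab: "a < b"
    and C: "connected C" "\<And>w. w \<in> C \<Longrightarrow> u w = s" "p \<in> C" "q \<in> C"
    and C': "connected C'" "\<And>w. w \<in> C' \<Longrightarrow> u w = s'" "p' \<in> C'" "q' \<in> C'"
    and pp: "\<And>w. w \<in> closed_segment p p' \<Longrightarrow> v w < a"
    and qq: "\<And>w. w \<in> closed_segment q q' \<Longrightarrow> b < v w"
  shows False
proof -
  \<comment> \<open>The margins put each of the two levels into an open set on which
    \<open>B\<close> is constant.\<close>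
  define lo where "lo = s + (s' - s) / 3"
  define hi where "hi = s + 2 * (s' - s) / 3"
  have lohi: "s < lo" "lo < hi" "hi < s'" using s by (auto simp: lo_def hi_def field_simps)
  define B where "B w = plateau lo hi (u w)" for w
  define A where "A w = plateau a b (v w)" for w
  have "frame_C2 x y B" "frame_C1 x y A"
    unfolding A_def B_def using frame_C2_plateau u v frame_C2_imp_C1 by blast+
  then obtain W K where W: "\<And>p q. dist p q \<le> 1 \<Longrightarrow>
      \<bar>W q - W p - A p * (B q - B p)\<bar> \<le> K * (dist p q)\<^sup>2"
    using primitive_du[OF xy z] by metis
  have cu: "continuous_on UNIV u" and cv: "continuous_on UNIV v"
    using u v frame_C2_imp_bl continuous_on_bounded_lipschitz by blast+
  have "W p = W q"
  proof (rule constant_on_connected_if_quadratic[of "{w. u w < lo}" C 1 W K])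
    show "open {w. u w < lo}" by (intro open_Collect_less cu continuous_on_const)
    show "\<bar>W q - W p\<bar> \<le> K * (dist p q)\<^sup>2"
      if "p \<in> {w. u w < lo}" "q \<in> {w. u w < lo}" "dist p q < 1" for p q
      using W[of p q] that by (simp add: B_def plateau_low)
  qed (use C lohi in auto)
  moreover have "W p' = W q'"
  proof (rule constant_on_connected_if_quadratic[of "{w. hi < u w}" C' 1 W K])
    show "open {w. hi < u w}" by (intro open_Collect_less cu continuous_on_const)
    show "\<bar>W q - W p\<bar> \<le> K * (dist p q)\<^sup>2"
      if "p \<in> {w. hi < u w}" "q \<in> {w. hi < u w}" "dist p q < 1" for p q
      using W[of p q] that lohi by (simp add: B_def plateau_high)
  qed (use C' lohi in auto)
  moreover have "W p = W p'"
  proof (rule constant_on_connected_if_quadratic[of "{w. v w < a}" "closed_segment p p'" 1 W K])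
    show "open {w. v w < a}" by (intro open_Collect_less cv continuous_on_const)
    show "\<bar>W q - W p\<bar> \<le> K * (dist p q)\<^sup>2"
      if "p \<in> {w. v w < a}" "q \<in> {w. v w < a}" "dist p q < 1" for p q
      using W[of p q] that by (simp add: A_def plateau_low)
  qed (use pp in auto)
  moreover have "W q - B q = W q' - B q'"
  proof (rule constant_on_connected_if_quadratic[of "{w. b < v w}" "closed_segment q q'" 1
        "\<lambda>w. W w - B w" K])
    show "open {w. b < v w}" by (intro open_Collect_less cv continuous_on_const)
    show "\<bar>(W q - B q) - (W p - B p)\<bar> \<le> K * (dist p q)\<^sup>2"
      if "p \<in> {w. b < v w}" "q \<in> {w. b < v w}" "dist p q < 1" for p q
      using W[of p q] that ab by (simp add: A_def plateau_high algebra_simps)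
  qed (use qq in auto)
  moreover have "B q = 0" "B q' = 1"
    using C C' lohi by (auto simp: B_def plateau_low plateau_high)
  ultimately show False by simp
qed

lemma uncountable_imp_close_pair:
  fixes T :: "'a::{real_normed_vector, heine_borel} set"
  assumes "uncountable T" "0 < e"
  obtains s t where "s \<in> T" "t \<in> T" "s \<noteq> t" "dist s t < e"
proof -
  obtain w where w: "w islimpt T" using assms no_limpt_imp_countable by blast
  obtain s where s: "s \<in> T" "s \<noteq> w" "dist s w < e / 2"
    using w \<open>0 < e\<close> unfolding islimpt_approachable by (meson half_gt_zero)
  moreover obtain t where t: "t \<in> T" "t \<noteq> w" "dist t w < dist s w"
    using w s unfolding islimpt_approachable by (metis zero_less_dist_iff)
  moreover have "dist s t < e"
    using dist_triangle2[of s t w] s t by linarith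
  ultimately show thesis using that by blast
qed

text \<open>A bad level is recorded by a rational window and two endpoints with \<open>v\<close> on
  either side of it. One of the countably many windows serves uncountably many levels, and two of
  their endpoint pairs are close in the product space; the connected sets between the endpoints may
  stay far apart.\<close>

theorem countable_nonconstant_levels:
  fixes x y z u v :: "'a::euclidean_space \<Rightarrow> real"
  assumes xy: "bounded_lipschitz x" "bounded_lipschitz y"
    and z: "has_frame_deriv x y z y (\<lambda>_. 0)"
    and u: "frame_C2 x y u" and v: "frame_C2 x y v"
  shows "countable {s. \<exists>C. connected C \<and> (\<forall>w\<in>C. u w = s) \<and> (\<exists>p\<in>C. \<exists>q\<in>C. v p \<noteq> v q)}"
    (is "countable ?Bad")
proof (rule ccontr)
  define bad where "bad a b = {s. \<exists>C. connected C \<and> (\<forall>w\<in>C. u w = s) \<and> (\<exists>p\<in>C. \<exists>q\<in>C. v p < a \<and> b < v q)}"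
    for a b
  assume unc: "uncountable ?Bad"
  have "?Bad \<subseteq> (\<Union>(a, b)\<in>{(a, b). a \<in> \<rat> \<and> b \<in> \<rat> \<and> a < b}. bad a b)"
  proof
    fix s assume "s \<in> ?Bad"
    then obtain C p q where C: "connected C" "\<forall>w\<in>C. u w = s" "p \<in> C" "q \<in> C" "v p < v q"
      by (auto elim: linorder_neqE)
    obtain a where a: "a \<in> \<rat>" "v p < a" "a < v q" using Rats_dense_in_real C(5) by blast
    obtain b where b: "b \<in> \<rat>" "a < b" "b < v q" using Rats_dense_in_real a(3) by blast
    show "s \<in> (\<Union>(a, b)\<in>{(a, b). a \<in> \<rat> \<and> b \<in> \<rat> \<and> a < b}. bad a b)"
      using C a b unfolding bad_def by blast
  qed
  moreover have "countable {(a, b). a \<in> \<rat> \<and> b \<in> \<rat> \<and> a < (b::real)}"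
    by (rule countable_subset[of _ "\<rat> \<times> \<rat>"]) (auto intro: countable_rat)
  ultimately obtain a b where ab: "a < b" and "uncountable (bad a b)"
    using unc countable_subset countable_UN
    by (smt (verit, best) case_prod_conv mem_Collect_eq prod.exhaust_sel split_cong)
  have "\<forall>s\<in>bad a b. \<exists>p q C. connected C \<and> (\<forall>w\<in>C. u w = s) \<and> p \<in> C \<and> q \<in> C \<and> v p < a \<and> b < v q"
    unfolding bad_def by blast
  then obtain P Q D where PQ: "\<And>s. s \<in> bad a b \<Longrightarrow> connected (D s) \<and> (\<forall>w\<in>D s. u w = s) \<and>
      P s \<in> D s \<and> Q s \<in> D s \<and> v (P s) < a \<and> b < v (Q s)"
    by metis
  obtain K where K: "0 \<le> K" "\<And>p q. \<bar>v q - v p\<bar> \<le> K * dist p q"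
    using bounded_lipschitzE[OF frame_C2_imp_bl[OF v]] by metis
  \<comment> \<open>Along a segment shorter than \<open>e\<close>, \<open>v\<close> changes by less
    than a third of the window, so the middle third still separates the ends. The 1 in
    \<open>K + 1\<close> avoids division by zero.\<close>
  let ?g = "(b - a) / 3"
  define e where "e = ?g / (K + 1)"
  have e: "0 < e" using ab K by (simp add: e_def)
  \<comment> \<open>\<open>u\<close> takes the value \<open>s\<close> at \<open>P s\<close>, so the
    endpoint determines the level.\<close>
  have "inj_on (\<lambda>s. (P s, Q s)) (bad a b)"
    by (rule inj_onI) (metis PQ fst_conv)
  then have "uncountable ((\<lambda>s. (P s, Q s)) ` bad a b)"
    using \<open>uncountable (bad a b)\<close> countable_image_inj_on by blast
  then obtain s t where st: "s \<in> bad a b" "t \<in> bad a b" "s \<noteq> t" and d: "dist (P s, Q s) (P t, Q t) < e"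
    using uncountable_imp_close_pair[OF _ e] by (smt (verit, best) imageE)
  have *: "s < t \<longrightarrow> False"
    if st: "s \<in> bad a b" "t \<in> bad a b" and d: "dist (P s) (P t) < e" "dist (Q s) (Q t) < e" for s t
  proof
    assume "s < t"
    have near: "\<bar>v w - v p\<bar> < ?g" if "dist p p' < e" "w \<in> closed_segment p p'" for p p' w
    proof -
      have "K * dist p w \<le> K * dist p p'"
        using that K segment_bound1[of w p p'] by (intro mult_left_mono) (auto simp: dist_norm norm_minus_commute)
      also have "\<dots> \<le> (K + 1) * dist p p'" by (simp add: mult_right_mono)
      also have "\<dots> < ?g" using that K by (simp add: e_def field_simps)
      finally show ?thesis using K(2)[of w p] by simp
    qed
    have "\<And>w. w \<in> closed_segment (P s) (P t) \<Longrightarrow> v w < a + ?g"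
      using near[OF d(1)] PQ[OF st(1)] by (smt (verit))
    moreover have "\<And>w. w \<in> closed_segment (Q s) (Q t) \<Longrightarrow> b - ?g < v w"
      using near[OF d(2)] PQ[OF st(1)] by (smt (verit))
    moreover have "a + ?g < b - ?g" using ab by (simp add: field_simps)
    ultimately show False
      using no_crossing_levels[OF xy z u v \<open>s < t\<close>, of "a + ?g" "b - ?g" "D s" "P s" "Q s" "D t" "P t" "Q t"]
        PQ[OF st(1)] PQ[OF st(2)] by blast
  qed
  have "dist (P s) (P t) < e" "dist (Q s) (Q t) < e"
    using d dist_fst_le[of "(P s, Q s)" "(P t, Q t)"] dist_snd_le[of "(P s, Q s)" "(P t, Q t)"] by auto
  then show False
    using *[of s t] *[of t s] st by (auto simp: dist_commute)
qed

section \<open>Separation on the sphere\<close>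

text \<open>Inversion in the unit sphere multiplies the distance of \<open>a\<close> and
  \<open>b\<close> by \<open>1 / (norm a * norm b)\<close>.\<close>

lemma norm_inversion_diff_le:
  fixes a b :: "'a::real_inner"
  assumes "1 \<le> norm a" "1 \<le> norm b"
  shows "norm (a /\<^sub>R (norm a)\<^sup>2 - b /\<^sub>R (norm b)\<^sup>2) \<le> norm (a - b)"
proof -
  have nz: "a \<noteq> 0" "b \<noteq> 0" using assms by auto
  have "(norm (a /\<^sub>R (norm a)\<^sup>2 - b /\<^sub>R (norm b)\<^sup>2))\<^sup>2
     = (norm (a - b))\<^sup>2 / ((norm a)\<^sup>2 * (norm b)\<^sup>2)"
  proof -
    have "(norm (a /\<^sub>R (norm a)\<^sup>2 - b /\<^sub>R (norm b)\<^sup>2))\<^sup>2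
       = inverse ((norm a)\<^sup>2) * inverse ((norm a)\<^sup>2) * (a \<bullet> a)
         - 2 * (inverse ((norm a)\<^sup>2) * inverse ((norm b)\<^sup>2) * (a \<bullet> b))
         + inverse ((norm b)\<^sup>2) * inverse ((norm b)\<^sup>2) * (b \<bullet> b)"
      unfolding power2_norm_eq_inner[of "_ - _"] by (simp add: inner_diff inner_commute algebra_simps)
    also have "\<dots> = ((norm b)\<^sup>2 - 2 * (a \<bullet> b) + (norm a)\<^sup>2) / ((norm a)\<^sup>2 * (norm b)\<^sup>2)"
      using nz unfolding power2_norm_eq_inner[symmetric] by (simp add: field_simps power2_eq_square)
    also have "(norm b)\<^sup>2 - 2 * (a \<bullet> b) + (norm a)\<^sup>2 = (norm (a - b))\<^sup>2"
      unfolding power2_norm_eq_inner by (simp add: inner_diff inner_commute)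
    finally show ?thesis .
  qed
  also have "\<dots> \<le> (norm (a - b))\<^sup>2 / 1"
  proof (rule divide_left_mono)
    have "1 \<le> (norm a)\<^sup>2" "1 \<le> (norm b)\<^sup>2" using assms by auto
    then show "1 \<le> (norm a)\<^sup>2 * (norm b)\<^sup>2" by (metis mult_mono mult_1 zero_le_one zero_le_power2)
  qed (use nz in auto)
  finally have "(norm (a /\<^sub>R (norm a)\<^sup>2 - b /\<^sub>R (norm b)\<^sup>2))\<^sup>2 \<le> (norm (a - b))\<^sup>2"
    unfolding div_by_1 .
  then show ?thesis by (rule power2_le_imp_le) simp
qed

text \<open>Inverse stereographic projection from \<open>N\<close>, precomposed with the orthogonal projection onto
  the equatorial hyperplane; \<open>\<sigma>\<close> and \<open>R\<close> are given by the same inversion centred at \<open>N\<close>.\<close>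

lemma stereographic_chart:
  fixes N :: "'a::euclidean_space"
  assumes N: "norm N = 1"
  obtains R \<sigma> :: "'a \<Rightarrow> 'a" where "\<And>v w. dist (R v) (R w) \<le> 4 * dist v w"
    "\<And>v. R v \<in> sphere 0 1" "continuous_on (sphere 0 1 - {N}) \<sigma>"
    "\<And>p. p \<in> sphere 0 1 - {N} \<Longrightarrow> R (\<sigma> p) = p"
proof -
  define inv where "inv a = a /\<^sub>R (norm a)\<^sup>2" for a :: 'a
  \<comment> \<open>The projection makes \<open>R\<close> a map on the whole space, so no type of
    smaller dimension has to be introduced, and it keeps \<open>\<pi> v - N\<close> outside the unit
    ball, where inversion does not expand.\<close>
  define \<pi> where "\<pi> v = v - (v \<bullet> N) *\<^sub>R N" for v
  define R where "R v = N + 2 *\<^sub>R inv (\<pi> v - N)" for v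
  define \<sigma> where "\<sigma> p = N + 2 *\<^sub>R inv (p - N)" for p
  have NN: "N \<bullet> N = 1" using N by (simp add: norm_eq_1)
  have \<pi>N: "\<pi> v \<bullet> N = 0" for v by (simp add: \<pi>_def inner_diff NN)
  have sq: "(norm (\<pi> v - N))\<^sup>2 = (norm (\<pi> v))\<^sup>2 + 1" for v
    unfolding power2_norm_eq_inner using \<pi>N[of v] by (simp add: inner_diff inner_commute NN)
  have ge1: "1 \<le> norm (\<pi> v - N)" for v
    using sq[of v] by (smt (verit) norm_ge_zero power2_le_imp_le one_power2 zero_le_power2)
  \<comment> \<open>One factor 2 belongs to the inversion, the other is a crude bound for the
    projection.\<close>
  have "dist (R v) (R w) \<le> 4 * dist v w" for v w
  proof -
    have "dist (R v) (R w) = 2 * norm (inv (\<pi> v - N) - inv (\<pi> w - N))"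
      unfolding R_def dist_norm by (simp flip: scaleR_diff_right)
    also have "\<dots> \<le> 2 * norm ((\<pi> v - N) - (\<pi> w - N))"
      unfolding inv_def using norm_inversion_diff_le[OF ge1 ge1] by simp
    also have "(\<pi> v - N) - (\<pi> w - N) = (v - w) - ((v - w) \<bullet> N) *\<^sub>R N"
      by (simp add: \<pi>_def inner_diff algebra_simps)
    also have "norm \<dots> \<le> norm (v - w) + norm (((v - w) \<bullet> N) *\<^sub>R N)" by (rule norm_triangle_ineq4)
    also have "norm (((v - w) \<bullet> N) *\<^sub>R N) \<le> norm (v - w)"
      using Cauchy_Schwarz_ineq2[of "v - w" N] N by simp
    finally show ?thesis by (simp add: dist_norm)
  qed
  moreover have "R v \<in> sphere 0 1" for v
  proof -
    let ?a = "\<pi> v - N"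
    have a: "norm ?a \<noteq> 0" "N \<bullet> ?a = - 1"
      using ge1[of v] \<pi>N[of v] by (auto simp: inner_diff inner_commute NN)
    define c where "c = 2 / (norm ?a)\<^sup>2"
    have "(norm (R v))\<^sup>2 = (N + c *\<^sub>R ?a) \<bullet> (N + c *\<^sub>R ?a)"
      unfolding R_def inv_def c_def power2_norm_eq_inner[of "_ + _"] by (simp add: divide_inverse)
    also have "\<dots> = 1 + 2 * c * (N \<bullet> ?a) + c * c * (?a \<bullet> ?a)"
      unfolding inner_add inner_scaleR_left inner_scaleR_right inner_commute[of ?a N] NN by algebra
    also have "\<dots> = 1"
      unfolding a(2) power2_norm_eq_inner[symmetric] c_def using a(1)
      by (simp add: power2_eq_square field_simps)
    finally show ?thesis
      by (simp add: power2_eq_1_iff) (smt (verit) norm_ge_zero)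
  qed
  moreover have "continuous_on (sphere 0 1 - {N}) \<sigma>"
    unfolding \<sigma>_def inv_def by (intro continuous_intros) auto
  moreover have "R (\<sigma> p) = p" if p: "p \<in> sphere 0 1 - {N}" for p
  proof -
    let ?a = "p - N"
    have a: "norm ?a \<noteq> 0" using p by auto
    have pp: "p \<bullet> p = 1" using p by (simp add: norm_eq_1)
    have "(norm ?a)\<^sup>2 = - 2 * (?a \<bullet> N)"
      unfolding power2_norm_eq_inner by (simp add: inner_diff inner_commute NN pp)
    moreover have "(norm ?a)\<^sup>2 \<noteq> 0" using a by simp
    ultimately have "2 * (inverse ((norm ?a)\<^sup>2) * (?a \<bullet> N)) = - 1"
      by (simp add: divide_simps)
    then have "\<sigma> p \<bullet> N = 0"
      unfolding \<sigma>_def inv_def inner_add inner_scaleR_left NN by simp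
    then have "\<pi> (\<sigma> p) - N = 2 *\<^sub>R inv ?a" by (simp add: \<pi>_def \<sigma>_def)
    moreover have "inv (2 *\<^sub>R inv ?a) = (1/2) *\<^sub>R ?a"
    proof -
      define c where "c = 2 * inverse ((norm ?a)\<^sup>2)"
      have "2 *\<^sub>R inv ?a = c *\<^sub>R ?a" by (simp add: inv_def c_def)
      moreover have "(norm (c *\<^sub>R ?a))\<^sup>2 = c\<^sup>2 * (norm ?a)\<^sup>2"
        by (simp only: norm_scaleR power_mult_distrib power2_abs)
      moreover have "inverse (c\<^sup>2 * (norm ?a)\<^sup>2) * c = 1/2"
        unfolding c_def using a by (simp add: power2_eq_square field_simps)
      ultimately show ?thesis unfolding inv_def[of "2 *\<^sub>R inv ?a"] by (simp only: scaleR_scaleR)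
    qed
    ultimately show ?thesis by (simp add: R_def)
  qed
  ultimately show thesis using that by blast
qed

text \<open>The set sought is the boundary of \<open>V\<close>, where \<open>U\<close> is the
  component of \<open>p\<close> off \<open>L\<close> and \<open>V\<close> that of \<open>q\<close>
  off \<open>closure U\<close>. It is the intersection of \<open>closure V\<close> and
  \<open>X - V\<close>, closed connected sets that cover \<open>X\<close>, so unicoherence applies.
  Removing the connected set \<open>closure U\<close> instead of \<open>L\<close> is what makes
  \<open>X - V\<close> connected.\<close>

lemma separating_connected_subset:
  fixes X :: "'a::euclidean_space set"
  assumes X: "unicoherent X" "connected X" "locally connected X" "closed X"
    and L: "closed L" "L \<subseteq> X" and pq: "p \<in> X - L" "q \<in> X - L"
    and sep: "\<And>T. connected T \<Longrightarrow> T \<subseteq> X \<Longrightarrow> p \<in> T \<Longrightarrow> q \<in> T \<Longrightarrow> T \<inter> L \<noteq> {}"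
  obtains C where "connected C" "C \<subseteq> L"
    "\<And>T. connected T \<Longrightarrow> T \<subseteq> X \<Longrightarrow> p \<in> T \<Longrightarrow> q \<in> T \<Longrightarrow> T \<inter> C \<noteq> {}"
proof -
  \<comment> \<open>Components are relatively closed, so their other limit points lie outside
    \<open>Y\<close>.\<close>
  have comp_closed: "b \<in> U" if U: "U \<in> components Y" "b \<in> closure U" "b \<in> Y" for U Y :: "'a set" and b
  proof -
    obtain K where K: "closed K" "U = Y \<inter> K"
      using closedin_component[OF U(1)] closedin_closed by metis
    then have "closure U \<subseteq> K" by (simp add: closure_minimal)
    then show ?thesis using U K by blast
  qed
  have comp_open: "openin (top_of_set X) U" if "U \<in> components (X - Q)" "closed Q" for U Q
  proof (rule openin_trans)
    have o: "openin (top_of_set X) (X - Q)"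
      using that by (simp add: Diff_eq openin_open_Int open_Compl)
    then have "locally connected (X - Q)" using X(3) locally_open_subset by blast
    then show "openin (top_of_set (X - Q)) U"
      using that openin_components_locally_connected by blast
    show "openin (top_of_set X) (X - Q)" by (rule o)
  qed
  define U where "U = connected_component_set (X - L) p"
  have U: "U \<in> components (X - L)" "p \<in> U" "connected U" "U \<subseteq> X - L"
    using pq by (auto simp: U_def componentsI connected_component_subset)
  have clU: "closure U \<subseteq> X" using U(4) X(4) by (metis closure_minimal Diff_subset subset_trans)
  have q: "q \<notin> closure U"
  proof
    assume "q \<in> closure U"
    then have "q \<in> U" using comp_closed U(1) pq by blast
    then show False using sep[of U] U by blast
  qed
  define V where "V = connected_component_set (X - closure U) q"
  have V: "V \<in> components (X - closure U)" "q \<in> V" "connected V" "V \<subseteq> X - closure U"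
    using pq q by (auto simp: V_def componentsI connected_component_subset)
  have clV: "closure V \<subseteq> X" using V(4) X(4) by (metis closure_minimal Diff_subset subset_trans)
  have Vo: "openin (top_of_set X) V" and Uo: "openin (top_of_set X) U"
    using comp_open U(1) V(1) L(1) by auto
  have pV: "p \<notin> V" using V(4) U(2) closure_subset by blast
  let ?B = "closure V \<inter> (X - V)"
  have "connected ?B"
  proof (rule unicoherentD[OF X(1)])
    show "connected (closure V)" using V(3) by (rule connected_imp_connected_closure)
    show "connected (X - V)"
      using component_diff_connected[OF _ X(2) clU V(1)] U(3) connected_imp_connected_closure by blast
    show "X = closure V \<union> (X - V)" using clV closure_subset by blast
    show "closedin (top_of_set X) (closure V)" using clV by (simp add: closed_subset)
    show "closedin (top_of_set X) (X - V)" using Vo by (simp add: closedin_diff)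
  qed
  \<comment> \<open>A boundary point of \<open>V\<close> cannot lie in \<open>X - closure U\<close>,
    so it lies in \<open>closure U\<close>; it is not in \<open>U\<close>, which is open and
    disjoint from \<open>V\<close>; hence it cannot lie in \<open>X - L\<close>.\<close>
  moreover have "?B \<subseteq> L"
  proof
    fix b assume b: "b \<in> ?B"
    have "b \<in> closure U" using comp_closed[OF V(1), of b] b by blast
    moreover have "b \<notin> U"
    proof
      assume "b \<in> U"
      obtain O' where O': "open O'" "U = X \<inter> O'" using Uo openin_open by metis
      then have "O' \<inter> V \<noteq> {}" using b \<open>b \<in> U\<close> open_Int_closure_eq_empty by fastforce
      then have "U \<inter> V \<noteq> {}" using O' V(4) by blast
      then show False using V(4) closure_subset by blast
    qed
    ultimately show "b \<in> L" using comp_closed[OF U(1), of b] b by blast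
  qed
  moreover have "T \<inter> ?B \<noteq> {}" if T: "connected T" "T \<subseteq> X" "p \<in> T" "q \<in> T" for T
  proof
    assume e: "T \<inter> ?B = {}"
    \<comment> \<open>Missing the boundary makes \<open>T \<inter> V\<close> relatively clopen,
      although it contains \<open>q\<close> and not \<open>p\<close>.\<close>
    then have "T \<inter> V = T \<inter> closure V" using T closure_subset by blast
    then have "closedin (top_of_set T) (T \<inter> V)" by (simp add: closedin_closed_Int)
    moreover have "openin (top_of_set T) (T \<inter> V)"
    proof -
      obtain O' where O': "open O'" "V = X \<inter> O'" using Vo openin_open by metis
      then have "T \<inter> V = T \<inter> O'" using T(2) by blast
      then show ?thesis using O'(1) by (simp add: openin_open_Int)
    qed
    ultimately have "T \<inter> V = {} \<or> T \<inter> V = T" using T(1) connected_clopen by blast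
    then show False using T V(2) pV by blast
  qed
  ultimately show thesis using that by blast
qed

text \<open>These bounds are all that is kept of the Lipschitz condition: first order for
  \<open>x\<close> and \<open>y\<close>, second order for the contact form dz - y dx.\<close>

locale horizontal_sphere_map =
  fixes x y z :: "'a::euclidean_space \<Rightarrow> real" and L :: real
  assumes dim: "3 \<le> DIM('a)" and L_nonneg: "0 \<le> L"
    and x_lip: "\<And>p q. \<lbrakk>p \<in> sphere 0 1; q \<in> sphere 0 1\<rbrakk> \<Longrightarrow> \<bar>x q - x p\<bar> \<le> L * dist p q"
    and y_lip: "\<And>p q. \<lbrakk>p \<in> sphere 0 1; q \<in> sphere 0 1\<rbrakk> \<Longrightarrow> \<bar>y q - y p\<bar> \<le> L * dist p q"
    and z_horizontal: "\<And>p q. \<lbrakk>p \<in> sphere 0 1; q \<in> sphere 0 1\<rbrakk>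
      \<Longrightarrow> \<bar>z q - z p - y p * (x q - x p)\<bar> \<le> L * (dist p q)\<^sup>2"
begin

abbreviation S :: "'a set" where "S \<equiv> sphere 0 1"

section \<open>Fibres of the map and levels of the distance from a value\<close>

definition f :: "'a \<Rightarrow> real \<times> real \<times> real" where
  "f p = (x p, y p, z p)"

text \<open>The squared Euclidean distance is a polynomial in \<open>x\<close>, \<open>y\<close>,
  \<open>z\<close>, hence \<open>frame_C2\<close> in a chart, and it still vanishes exactly on the
  fibre through \<open>c\<close>.\<close>

definition gap :: "'a \<Rightarrow> 'a \<Rightarrow> real" where
  "gap c p = (x p - x c)\<^sup>2 + (y p - y c)\<^sup>2 + (z p - z c)\<^sup>2"

lemma gap_nonneg: "0 \<le> gap c p"
  by (simp add: gap_def)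

lemma gap_eq_0_iff: "gap c p = 0 \<longleftrightarrow> f p = f c"
  by (auto simp: gap_def f_def add_nonneg_eq_0_iff)

lemma gap_cong: "f p = f q \<Longrightarrow> gap c p = gap c q"
  by (simp add: f_def gap_def)

lemma sphere_dist_le: "p \<in> S \<Longrightarrow> q \<in> S \<Longrightarrow> dist p q \<le> 2"
  using norm_triangle_ineq4[of p q] by (simp add: dist_norm)

lemma lipschitz_bounded:
  assumes "0 \<le> K" "\<And>p q. p \<in> S \<Longrightarrow> q \<in> S \<Longrightarrow> \<bar>h q - h p\<bar> \<le> K * dist p q"
  shows "\<exists>B. \<forall>p\<in>S. \<bar>h p\<bar> \<le> B"
proof (cases "S = {}")
  case False
  then obtain N where N: "N \<in> S" by blast
  have "\<bar>h p\<bar> \<le> \<bar>h N\<bar> + K * 2" if "p \<in> S" for p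
  proof -
    have "K * dist N p \<le> K * 2" using assms(1) sphere_dist_le[OF N that] by (intro mult_left_mono) auto
    then show ?thesis using assms(2)[OF N that] by linarith
  qed
  then show ?thesis by blast
qed simp

lemma z_lip: "\<exists>K\<ge>0. \<forall>p\<in>S. \<forall>q\<in>S. \<bar>z q - z p\<bar> \<le> K * dist p q"
proof -
  obtain B where B: "\<And>p. p \<in> S \<Longrightarrow> \<bar>y p\<bar> \<le> B"
    using lipschitz_bounded[OF L_nonneg y_lip] by blast
  have "\<bar>z q - z p\<bar> \<le> (\<bar>B\<bar> * L + L * 2) * dist p q" if pq: "p \<in> S" "q \<in> S" for p q
  proof -
    have "\<bar>y p * (x q - x p)\<bar> \<le> \<bar>B\<bar> * (L * dist p q)"
      unfolding abs_mult using B[OF pq(1)] x_lip[OF pq] by (intro mult_mono) auto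
    moreover have "L * (dist p q)\<^sup>2 \<le> L * (2 * dist p q)"
      using sphere_dist_le[OF pq] L_nonneg
      by (intro mult_left_mono) (auto simp: power2_eq_square mult_right_mono)
    ultimately have "\<bar>z q - z p\<bar> \<le> \<bar>B\<bar> * (L * dist p q) + L * (2 * dist p q)"
      using z_horizontal[OF pq] by linarith
    then show ?thesis by (simp add: algebra_simps)
  qed
  moreover have "0 \<le> \<bar>B\<bar> * L + L * 2" using L_nonneg by simp
  ultimately show ?thesis by blast
qed

lemma continuous_on_f_components:
  "continuous_on S x" "continuous_on S y" "continuous_on S z"
proof -
  have c: "continuous_on S h" if "0 \<le> K" "\<And>p q. p \<in> S \<Longrightarrow> q \<in> S \<Longrightarrow> \<bar>h q - h p\<bar> \<le> K * dist p q" for h K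
  proof -
    have "K-lipschitz_on S h"
      proof (rule lipschitz_onI)
      show "dist (h p) (h q) \<le> K * dist p q" if "p \<in> S" "q \<in> S" for p q
        using \<open>\<And>p q. p \<in> S \<Longrightarrow> q \<in> S \<Longrightarrow> \<bar>h q - h p\<bar> \<le> K * dist p q\<close>[of q p] that
        by (simp add: dist_real_def dist_commute)
    qed (use that in simp)
    then show ?thesis by (rule lipschitz_on_continuous_on)
  qed
  show "continuous_on S x" "continuous_on S y"
    using c L_nonneg x_lip y_lip by blast+
  show "continuous_on S z" using z_lip c by metis
qed

lemma continuous_on_gap: "continuous_on S (gap c)"
  unfolding gap_def by (intro continuous_intros continuous_on_f_components)

text \<open>In the stereographic chart the level theorem applies to \<open>gap c\<close> and each of
  the three coordinates. The chart misses \<open>N\<close>; the single level through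
  \<open>N\<close> is added to the exceptional set.\<close>

lemma countable_nonconstant_gap_levels:
  "countable {s. \<exists>C\<subseteq>S. connected C \<and> (\<forall>w\<in>C. gap c w = s) \<and> (\<exists>p\<in>C. \<exists>q\<in>C. f p \<noteq> f q)}"
    (is "countable ?Bad")
proof -
  obtain N :: 'a where N: "norm N = 1" using vector_choose_size zero_le_one by blast
  obtain R \<sigma> :: "'a \<Rightarrow> 'a" where R: "\<And>v w. dist (R v) (R w) \<le> 4 * dist v w" "\<And>v. R v \<in> S"
    and \<sigma>: "continuous_on (S - {N}) \<sigma>" "\<And>p. p \<in> S - {N} \<Longrightarrow> R (\<sigma> p) = p"
    using stereographic_chart[OF N] by metis
  have bl: "bounded_lipschitz (\<lambda>v. h (R v))"
    if K: "0 \<le> K" "\<And>p q. p \<in> S \<Longrightarrow> q \<in> S \<Longrightarrow> \<bar>h q - h p\<bar> \<le> K * dist p q" for h K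
  proof -
    obtain B where B: "\<And>p. p \<in> S \<Longrightarrow> \<bar>h p\<bar> \<le> B" using lipschitz_bounded[OF K] by blast
    show ?thesis
    proof (rule bounded_lipschitzI[of _ B "K * 4"])
      show "\<bar>h (R v)\<bar> \<le> B" for v using B R(2) by blast
      show "\<bar>h (R w) - h (R v)\<bar> \<le> K * 4 * dist v w" for v w
        using K(2)[OF R(2) R(2), of w v] mult_left_mono[OF R(1)[of v w] K(1)] by simp
    qed
  qed
  let ?x = "\<lambda>v. x (R v)" and ?y = "\<lambda>v. y (R v)" and ?z = "\<lambda>v. z (R v)"
  have blx: "bounded_lipschitz ?x" and bly: "bounded_lipschitz ?y"
    using bl[OF L_nonneg] x_lip y_lip by blast+
  have blz: "bounded_lipschitz ?z" using z_lip bl[of _ z] by metis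
  have hz: "has_frame_deriv ?x ?y ?z ?y (\<lambda>_. 0)"
    unfolding has_frame_deriv_def
  proof (intro exI[of _ "L * 16"] conjI allI)
    show "0 \<le> L * 16" using L_nonneg by simp
    show "\<bar>z (R w) - z (R v) - y (R v) * (x (R w) - x (R v)) - 0 * (y (R w) - y (R v))\<bar>
        \<le> L * 16 * (dist v w)\<^sup>2" for v w
    proof -
      have "L * (dist (R v) (R w))\<^sup>2 \<le> L * (4 * dist v w)\<^sup>2"
        using R(1)[of v w] L_nonneg by (intro mult_left_mono power_mono) auto
      then show ?thesis
        using z_horizontal[OF R(2) R(2), of w v] by (simp add: power_mult_distrib)
    qed
  qed
  have "has_frame_deriv ?x ?y ?x (\<lambda>_. 1) (\<lambda>_. 0)" "has_frame_deriv ?x ?y ?y (\<lambda>_. 0) (\<lambda>_. 1)"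
    unfolding has_frame_deriv_def by (auto intro: exI[of _ 0])
  then have X: "frame_C2 ?x ?y ?x" and Y: "frame_C2 ?x ?y ?y"
    using frame_C2I blx bly frame_C1_const by metis+
  have Z: "frame_C2 ?x ?y ?z"
    by (rule frame_C2I[OF hz blz frame_C2_imp_C1[OF Y] frame_C1_const])
  have G: "frame_C2 ?x ?y (\<lambda>v. gap c (R v))"
    unfolding gap_def power2_eq_square
    by (intro frame_C2_add frame_C2_mult frame_C2_diff frame_C2_const X Y Z)
  let ?B = "\<lambda>h. {s. \<exists>C. connected C \<and> (\<forall>v\<in>C. gap c (R v) = s) \<and> (\<exists>p\<in>C. \<exists>q\<in>C. h (R p) \<noteq> h (R q))}"
  have "countable (?B x)" "countable (?B y)" "countable (?B z)"
    using countable_nonconstant_levels[OF blx bly hz G] X Y Z by blast+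
  then have "countable ({gap c N} \<union> ?B x \<union> ?B y \<union> ?B z)" by simp
  moreover have "?Bad \<subseteq> {gap c N} \<union> ?B x \<union> ?B y \<union> ?B z"
  proof
    fix s assume "s \<in> ?Bad"
    then obtain C p q where C: "C \<subseteq> S" "connected C" "\<forall>w\<in>C. gap c w = s" "p \<in> C" "q \<in> C" "f p \<noteq> f q"
      by blast
    show "s \<in> {gap c N} \<union> ?B x \<union> ?B y \<union> ?B z"
    proof (cases "N \<in> C")
      case True
      then have "s = gap c N" using C(3) by simp
      then show ?thesis by (intro UnI1) simp
    next
      case False
      then have CS: "C \<subseteq> S - {N}" using C(1) by blast
      have "connected (\<sigma> ` C)"
        using connected_continuous_image[OF continuous_on_subset[OF \<sigma>(1) CS] C(2)] .
      moreover have R\<sigma>: "R (\<sigma> w) = w" if "w \<in> C" for w using that CS \<sigma>(2) by blast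
      moreover have "\<forall>v\<in>\<sigma> ` C. gap c (R v) = s" using C(3) R\<sigma> by simp
      moreover have "\<exists>a\<in>\<sigma> ` C. \<exists>b\<in>\<sigma> ` C. h (R a) \<noteq> h (R b)" if "h p \<noteq> h q" for h :: "'a \<Rightarrow> real"
        using that C(4,5) R\<sigma> by (intro bexI[of _ "\<sigma> p"] bexI[of _ "\<sigma> q"]) auto
      ultimately have *: "s \<in> ?B h" if "h p \<noteq> h q" for h :: "'a \<Rightarrow> real"
        using that unfolding mem_Collect_eq by (intro exI[of _ "\<sigma> ` C"] conjI) auto
      have "x p \<noteq> x q \<or> y p \<noteq> y q \<or> z p \<noteq> z q" using C(6) by (auto simp: f_def)
      then show ?thesis using *[of x] *[of y] *[of z] by (elim disjE) (intro UnI1 UnI2, assumption)+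
    qed
  qed
  ultimately show ?thesis using countable_subset by blast
qed

text \<open>If \<open>f p\<close> and \<open>f q\<close> differ, the intermediate value theorem
  suffices. Otherwise the points lie in different components of a compact fibre, which a relatively
  clopen subset separates (Sura-Bura). Off disjoint neighbourhoods of the two parts
  \<open>gap p\<close> is bounded below by a positive \<open>e\<close>, and every connected set from
  \<open>p\<close> to \<open>q\<close> leaves these neighbourhoods. The alternative for
  \<open>gap p q\<close> keeps \<open>q\<close> off the levels below \<open>e\<close>.\<close>

lemma gap_barrier:
  assumes p: "p \<in> S" and q: "q \<in> S"
    and no: "\<nexists>K. connected K \<and> K \<subseteq> S \<and> p \<in> K \<and> q \<in> K \<and> (\<forall>w\<in>K. f w = f p)"
  obtains e where "0 < e" "gap p q = 0 \<or> e \<le> gap p q"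
    "\<And>T s. \<lbrakk>connected T; T \<subseteq> S; p \<in> T; q \<in> T; 0 < s; s < e\<rbrakk> \<Longrightarrow> \<exists>w\<in>T. gap p w = s"
proof -
  have ivt: "\<exists>w\<in>T. gap p w = s" if T: "connected T" "T \<subseteq> S" "p \<in> T" "b \<in> T" "0 < s" "s < gap p b" for T s b
  proof -
    have "connected (gap p ` T)"
      using T(1,2) connected_continuous_image continuous_on_gap continuous_on_subset by blast
    moreover have "gap p p = 0" by (simp add: gap_def)
    ultimately have "s \<in> gap p ` T"
      using connectedD_interval[of "gap p ` T" "gap p p" "gap p b" s] T by auto
    then show ?thesis by blast
  qed
  show thesis
  proof (cases "gap p q = 0")
    case False
    then have "0 < gap p q" using gap_nonneg[of p q] by linarith
    then show thesis using that[of "gap p q"] ivt by blast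
  next
    case True
    define \<Phi> where "\<Phi> = {w \<in> S. gap p w = 0}"
    have p\<Phi>: "p \<in> \<Phi>" "q \<in> \<Phi>" using p q True by (auto simp: \<Phi>_def gap_def)
    have "closed \<Phi>" unfolding \<Phi>_def
      by (rule continuous_closed_preimage_constant[OF continuous_on_gap closed_sphere])
    then have comp\<Phi>: "compact \<Phi>"
      using compact_Int_closed[OF compact_sphere[of 0 1], of \<Phi>] by (metis \<Phi>_def Int_absorb1 mem_Collect_eq subsetI)
    define C0 where "C0 = connected_component_set \<Phi> p"
    have C0: "C0 \<in> components \<Phi>" "connected C0" "p \<in> C0" "C0 \<subseteq> \<Phi>"
      using p\<Phi> by (auto simp: C0_def componentsI connected_component_subset)
    have "\<forall>w\<in>C0. f w = f p" "C0 \<subseteq> S"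
      using C0(4) gap_eq_0_iff[of p] by (auto simp: \<Phi>_def)
    then have "q \<notin> C0" using no C0(2,3) by blast
    then obtain T where T: "C0 \<subseteq> T" "openin (top_of_set \<Phi>) T" "closedin (top_of_set \<Phi>) T" "q \<notin> T"
      using Sura_Bura_compact[OF comp\<Phi> C0(1)] by blast
    have "closed T" using T(3) \<open>closed \<Phi>\<close> closedin_closed_trans by blast
    have "closedin (top_of_set \<Phi>) (\<Phi> - T)" using T(2) by (simp add: closedin_diff)
    then have "closed (\<Phi> - T)" using \<open>closed \<Phi>\<close> closedin_closed_trans by blast
    then obtain U V where UV: "open U" "open V" "T \<subseteq> U" "\<Phi> - T \<subseteq> V" "U \<inter> V = {}"
      using separation_normal[OF \<open>closed T\<close>, of "\<Phi> - T"] by blast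
    define M where "M = S - (U \<union> V)"
    have "compact M" unfolding M_def using UV by (simp add: compact_diff open_Un)
    have Mpos: "0 < gap p w" if "w \<in> M" for w
      using that UV gap_nonneg[of p w] by (cases "gap p w = 0") (auto simp: M_def \<Phi>_def)
    obtain e where e: "0 < e" "\<And>w. w \<in> M \<Longrightarrow> e \<le> gap p w"
    proof (cases "M = {}")
      case False
      then obtain m where "m \<in> M" "\<forall>w\<in>M. gap p m \<le> gap p w"
        using continuous_attains_inf[OF \<open>compact M\<close>, of "gap p"] continuous_on_subset[OF continuous_on_gap]
        by (metis Diff_subset M_def)
      then show ?thesis using that Mpos by blast
    qed (use that[of 1] in auto)
    show thesis
    proof (rule that[OF e(1)])
      show "\<exists>w\<in>D. gap p w = s" if D: "connected D" "D \<subseteq> S" "p \<in> D" "q \<in> D" "0 < s" "s < e" for D s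
      proof -
        have "p \<in> U" "q \<in> V" using C0(3) T UV p\<Phi> by blast+
        then have "\<not> D \<subseteq> U \<union> V"
          using connectedD[OF D(1) UV(1,2)] UV(5) D(3,4) by blast
        then obtain w where w: "w \<in> D" "w \<in> M" using D(2) unfolding M_def by blast
        then show ?thesis using ivt[OF D(1-3) w(1) D(5)] e(2)[OF w(2)] D(6) by auto
      qed
    qed (use True in blast)
  qed
qed

theorem cut_by_fibre:
  assumes p: "p \<in> S" and q: "q \<in> S"
    and no: "\<nexists>K. connected K \<and> K \<subseteq> S \<and> p \<in> K \<and> q \<in> K \<and> (\<forall>w\<in>K. f w = f p)"
  obtains C c where "connected C" "C \<subseteq> S" "c \<in> C" "\<And>w. w \<in> C \<Longrightarrow> f w = f c" "f c \<noteq> f p" "f c \<noteq> f q"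
    "\<And>T. \<lbrakk>connected T; T \<subseteq> S; p \<in> T; q \<in> T\<rbrakk> \<Longrightarrow> T \<inter> C \<noteq> {}"
proof -
  obtain e where e: "0 < e" "gap p q = 0 \<or> e \<le> gap p q"
    and bar: "\<And>T s. \<lbrakk>connected T; T \<subseteq> S; p \<in> T; q \<in> T; 0 < s; s < e\<rbrakk> \<Longrightarrow> \<exists>w\<in>T. gap p w = s"
    using gap_barrier[OF p q no] by blast
  let ?Bad = "{s. \<exists>C\<subseteq>S. connected C \<and> (\<forall>w\<in>C. gap p w = s) \<and> (\<exists>p\<in>C. \<exists>q\<in>C. f p \<noteq> f q)}"
  have "uncountable ({0<..<e} - ?Bad)"
    using e(1) countable_nonconstant_gap_levels uncountable_open_interval
    by (simp add: uncountable_minus_countable)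
  then obtain s where s: "0 < s" "s < e" "s \<notin> ?Bad"
    by (metis (no_types, lifting) Diff_iff countable_empty equals0I greaterThanLessThan_iff)
  define Lv where "Lv = {w \<in> S. gap p w = s}"
  have "closed Lv" unfolding Lv_def
    by (rule continuous_closed_preimage_constant[OF continuous_on_gap closed_sphere])
  have dim2: "2 \<le> DIM('a)" using dim by linarith
  have "gap p p = 0" by (simp add: gap_def)
  then have pq: "p \<in> S - Lv" "q \<in> S - Lv" using p q s e by (auto simp: Lv_def)
  \<comment> \<open>Here the dimension matters: the circle is not unicoherent.\<close>
  have "unicoherent S" using Borsukian_imp_unicoherent Borsukian_sphere dim by blast
  moreover have "connected S" using connected_sphere dim2 by blast
  moreover have "locally connected S" by (rule locally_connected_sphere)
  ultimately obtain C where C: "connected C" "C \<subseteq> Lv"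
    "\<And>T. connected T \<Longrightarrow> T \<subseteq> S \<Longrightarrow> p \<in> T \<Longrightarrow> q \<in> T \<Longrightarrow> T \<inter> C \<noteq> {}"
  proof (rule separating_connected_subset[OF _ _ _ _ \<open>closed Lv\<close> _ pq])
    show "T \<inter> Lv \<noteq> {}" if "connected T" "T \<subseteq> S" "p \<in> T" "q \<in> T" for T
      using bar[OF that s(1,2)] that(2) unfolding Lv_def by blast
  qed (auto simp: Lv_def)
  obtain c where c: "c \<in> C" using C(3)[OF \<open>connected S\<close>] p q by blast
  have CS: "C \<subseteq> S" and Cs: "\<And>w. w \<in> C \<Longrightarrow> gap p w = s" using C(2) by (auto simp: Lv_def)
  show thesis
  proof (rule that[OF C(1) CS c _ _ _ C(3)])
    show "f w = f c" if "w \<in> C" for w using s(3) C(1) CS Cs c that by blast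
    show "f c \<noteq> f p" using Cs[OF c] s(1) gap_eq_0_iff[of p c] by auto
    show "f c \<noteq> f q"
      using Cs[OF c] gap_cong[of c q p] s e(2) by force
  qed
qed

end

section \<open>The chain pseudometric\<close>

lemma norm_normalize_diff_le:
  fixes a b :: "'a::real_normed_vector"
  assumes "1/2 \<le> norm a" "1/2 \<le> norm b"
  shows "norm (a /\<^sub>R norm a - b /\<^sub>R norm b) \<le> 4 * norm (a - b)"
proof -
  have nz: "norm a \<noteq> 0" "norm b \<noteq> 0" using assms by auto
  have "a /\<^sub>R norm a - b /\<^sub>R norm b
      = (a - b) /\<^sub>R norm a + ((norm b - norm a) * inverse (norm a) * inverse (norm b)) *\<^sub>R b"
  proof -
    have "(norm b - norm a) * inverse (norm a) * inverse (norm b) = inverse (norm a) - inverse (norm b)"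
      using nz by (simp add: field_simps)
    then show ?thesis by (simp only: scaleR_diff_left scaleR_diff_right) simp
  qed
  also have "norm \<dots> \<le> norm ((a - b) /\<^sub>R norm a)
      + norm (((norm b - norm a) * inverse (norm a) * inverse (norm b)) *\<^sub>R b)"
    by (rule norm_triangle_ineq)
  also have "norm (((norm b - norm a) * inverse (norm a) * inverse (norm b)) *\<^sub>R b)
      = \<bar>norm b - norm a\<bar> * inverse (norm a)"
    using nz by (simp add: abs_mult)
  also have "norm ((a - b) /\<^sub>R norm a) = norm (a - b) * inverse (norm a)"
    by simp
  also have "norm (a - b) * inverse (norm a) + \<bar>norm b - norm a\<bar> * inverse (norm a)
      \<le> norm (a - b) * 2 + norm (a - b) * 2"
  proof (intro add_mono mult_mono)
    show "inverse (norm a) \<le> 2"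
      using le_imp_inverse_le[OF assms(1)] by simp
    then show "inverse (norm a) \<le> 2" .
    show "\<bar>norm b - norm a\<bar> \<le> norm (a - b)" by (metis norm_minus_commute norm_triangle_ineq3)
  qed auto
  finally show ?thesis by simp
qed

text \<open>The chord is projected radially. An angle of at most 120 degrees keeps it at distance at
  least 1/2 from the centre, where the projection is 4-Lipschitz.\<close>

lemma sphere_arc:
  fixes p q :: "'a::euclidean_space"
  assumes p: "p \<in> sphere 0 1" and q: "q \<in> sphere 0 1" and pq: "- 1/2 \<le> p \<bullet> q"
  obtains g where "\<And>t. t \<in> {0..1} \<Longrightarrow> g t \<in> sphere 0 1" "g 0 = p" "g 1 = q"
    "\<And>s t. s \<in> {0..1} \<Longrightarrow> t \<in> {0..1} \<Longrightarrow> dist (g s) (g t) \<le> 4 * dist p q * \<bar>s - t\<bar>"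
proof -
  define h where "h t = (1 - t) *\<^sub>R p + t *\<^sub>R q" for t :: real
  define g where "g t = h t /\<^sub>R norm (h t)" for t
  have unit: "p \<bullet> p = 1" "q \<bullet> q = 1" using p q by (auto simp: norm_eq_1)
  have h: "1/2 \<le> norm (h t)" if t: "t \<in> {0..1}" for t
  proof -
    have "(norm (h t))\<^sup>2 = (1 - t)\<^sup>2 + t\<^sup>2 + 2 * (t * (1 - t)) * (p \<bullet> q)"
      unfolding power2_norm_eq_inner h_def
      by (simp add: inner_add inner_commute unit power2_eq_square algebra_simps)
    moreover have "(t * (1 - t)) * (- 1/2) \<le> (t * (1 - t)) * (p \<bullet> q)"
      using t pq by (intro mult_left_mono) auto
    moreover have "(1 - t)\<^sup>2 + t\<^sup>2 - t * (1 - t) = (1/2)\<^sup>2 + 3 * (t - 1/2)\<^sup>2"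
      by (simp add: power2_eq_square algebra_simps)
    ultimately have "(1/2)\<^sup>2 \<le> (norm (h t))\<^sup>2"
      using zero_le_power2[of "t - 1/2"] by linarith
    then show ?thesis by (rule power2_le_imp_le) simp
  qed
  have "dist (g s) (g t) \<le> 4 * dist p q * \<bar>s - t\<bar>" if st: "s \<in> {0..1}" "t \<in> {0..1}" for s t
  proof -
    have "h s - h t = (t - s) *\<^sub>R (p - q)" by (simp add: h_def algebra_simps)
    then have "norm (h s - h t) = \<bar>s - t\<bar> * dist p q" by (simp add: dist_norm abs_minus_commute)
    then show ?thesis
      using norm_normalize_diff_le[OF h[OF st(1)] h[OF st(2)]] by (simp add: g_def dist_norm mult.assoc mult.commute)
  qed
  moreover have "g t \<in> sphere 0 1" if "t \<in> {0..1}" for t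
  proof -
    have "norm (h t) \<noteq> 0" using h[OF that] by linarith
    then show ?thesis by (simp add: g_def)
  qed
  moreover have "g 0 = p" "g 1 = q" using p q by (auto simp: g_def h_def)
  ultimately show thesis using that by blast
qed

text \<open>Steps are short in \<open>X\<close>, while \<open>k\<close> will measure their images.
  The total cost is an index of the relation, so chains can be joined, reversed and cut.\<close>

inductive chain :: "'a::metric_space set \<Rightarrow> ('a \<Rightarrow> 'a \<Rightarrow> real) \<Rightarrow> real \<Rightarrow> 'a \<Rightarrow> 'a \<Rightarrow> real \<Rightarrow> bool"
  for X k \<delta> where
  refl: "p \<in> X \<Longrightarrow> chain X k \<delta> p p 0"
| step: "\<lbrakk>chain X k \<delta> p q c; r \<in> X; dist q r < \<delta>\<rbrakk> \<Longrightarrow> chain X k \<delta> p r (c + k q r)"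

lemma chain_in:
  assumes "chain X k \<delta> p q c"
  shows "p \<in> X" "q \<in> X"
  using assms by (induction) auto

lemma chain_nonneg:
  assumes "chain X k \<delta> p q c" "\<And>p q. 0 \<le> k p q"
  shows "0 \<le> c"
  using assms by (induction) auto

lemma chain_mono:
  assumes "chain X k \<delta> p q c" "\<delta> \<le> \<epsilon>"
  shows "chain X k \<epsilon> p q c"
  using assms by (induction) (auto intro: chain.intros)

lemma chain_single:
  assumes "p \<in> X" "q \<in> X" "dist p q < \<delta>"
  shows "chain X k \<delta> p q (k p q)"
  using chain.step[OF chain.refl[OF assms(1)] assms(2,3)] by simp

lemma chain_trans:
  assumes "chain X k \<delta> q r c'" "chain X k \<delta> p q c"
  shows "chain X k \<delta> p r (c + c')"
  using assms
proof (induction)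
  case (step q' r c' s)
  then show ?case
    using chain.step[OF step.IH[OF step.prems] step.hyps(2,3)] by (simp add: add.assoc)
qed simp

lemma chain_sym:
  assumes "chain X k \<delta> p q c" "\<And>p q. k p q = k q p"
  shows "chain X k \<delta> q p c"
  using assms
proof (induction)
  case (refl p)
  then show ?case by (intro chain.refl)
next
  case (step p q c r)
  have "chain X k \<delta> r q (k r q)"
    using chain_single[of r X q] step.hyps chain_in(2)[OF step.hyps(1)] by (simp add: dist_commute)
  then have "chain X k \<delta> r p (k r q + c)"
    using chain_trans[OF step.IH[OF step.prems]] by blast
  then show ?case using step.prems[of r q] by (simp add: add.commute)
qed

lemma chain_along_curve:
  assumes gX: "\<And>t. t \<in> {0..1} \<Longrightarrow> g t \<in> X" and M: "0 \<le> M"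
    and g: "\<And>s t. s \<in> {0..1} \<Longrightarrow> t \<in> {0..1} \<Longrightarrow> dist (g s) (g t) \<le> M * \<bar>s - t\<bar>"
    and K: "0 \<le> K" "\<And>p q. p \<in> X \<Longrightarrow> q \<in> X \<Longrightarrow> k p q \<le> K * dist p q"
    and "0 < \<delta>"
  shows "\<exists>c\<le>K * M. chain X k \<delta> (g 0) (g (1::real)) c"
proof -
  obtain N :: nat where N: "M / \<delta> < real N" using reals_Archimedean2 by blast
  have "0 \<le> M / \<delta>" using M \<open>0 < \<delta>\<close> by simp
  then have N0: "0 < real N" using N by linarith
  have small: "M / real N < \<delta>" using N N0 \<open>0 < \<delta>\<close> by (simp add: field_simps)
  have "\<exists>c\<le>K * M * (real i / real N). chain X k \<delta> (g 0) (g (real i / real N)) c" if "i \<le> N" for i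
    using that
  proof (induction i)
    case 0
    then show ?case using chain.refl[of "g 0" X] gX by auto
  next
    case (Suc i)
    then obtain c where c: "c \<le> K * M * (real i / real N)" "chain X k \<delta> (g 0) (g (real i / real N)) c"
      by auto
    have t: "real i / real N \<in> {0..1}" "real (Suc i) / real N \<in> {0..1}"
      using Suc.prems N0 by (auto simp: field_simps)
    have "dist (g (real i / real N)) (g (real (Suc i) / real N))
        \<le> M * \<bar>real i / real N - real (Suc i) / real N\<bar>"
      by (rule g[OF t])
    also have "\<bar>real i / real N - real (Suc i) / real N\<bar> = 1 / real N"
      using N0 by (simp add: diff_divide_distrib[symmetric])
    finally have d: "dist (g (real i / real N)) (g (real (Suc i) / real N)) \<le> M * (1 / real N)" .
    then have "chain X k \<delta> (g 0) (g (real (Suc i) / real N))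
        (c + k (g (real i / real N)) (g (real (Suc i) / real N)))"
      using chain.step[OF c(2) gX[OF t(2)]] small by simp
    moreover have "k (g (real i / real N)) (g (real (Suc i) / real N)) \<le> K * (M * (1 / real N))"
      using K(2)[OF gX[OF t(1)] gX[OF t(2)]] mult_left_mono[OF d K(1)] by linarith
    then have "c + k (g (real i / real N)) (g (real (Suc i) / real N)) \<le> K * M * (real (Suc i) / real N)"
      using c(1) by (simp add: add_divide_distrib distrib_left)
    ultimately show ?case by blast
  qed
  from this[of N] show ?thesis using N0 by simp
qed

text \<open>Linking consecutive points of a fine chain by small connected sets shows that the chain has
  to pass close to every set \<open>A\<close> separating its endpoints.\<close>

lemma chain_crosses:
  assumes "chain X k \<delta> p q c" and "0 \<le> M"
    and link: "\<And>a b. \<lbrakk>a \<in> X; b \<in> X; dist a b < \<delta>\<rbrakk>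
      \<Longrightarrow> \<exists>T. compact T \<and> connected T \<and> T \<subseteq> X \<and> a \<in> T \<and> b \<in> T \<and> T \<subseteq> cball a M"
  shows "(\<exists>w a c1 c2. a \<in> A \<and> a \<in> X \<and> chain X k \<delta> p w c1 \<and> chain X k \<delta> w q c2 \<and> c1 + c2 = c
      \<and> dist w a \<le> M)
    \<or> (\<exists>T. compact T \<and> connected T \<and> T \<subseteq> X \<and> p \<in> T \<and> q \<in> T \<and> T \<inter> A = {})"
  using assms(1)
proof (induction)
  case (refl p)
  show ?case
  proof (cases "p \<in> A")
    case True
    then show ?thesis
      using chain.refl[of p X k \<delta>] refl \<open>0 \<le> M\<close>
      by (intro disjI1 exI[of _ p] exI[of _ 0]) auto
  next
    case False
    then show ?thesis using refl by (intro disjI2 exI[of _ "{p}"]) auto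
  qed
next
  case (step p q c r)
  have q: "q \<in> X" using chain_in step.hyps(1) by blast
  then obtain T' where T': "compact T'" "connected T'" "T' \<subseteq> X" "q \<in> T'" "r \<in> T'" "T' \<subseteq> cball q M"
    using link[of q r] step.hyps by blast
  from step.IH show ?case
  proof
    assume "\<exists>w a c1 c2. a \<in> A \<and> a \<in> X \<and> chain X k \<delta> p w c1 \<and> chain X k \<delta> w q c2 \<and> c1 + c2 = c
      \<and> dist w a \<le> M"
    then obtain w a c1 c2 where w: "a \<in> A" "a \<in> X" "chain X k \<delta> p w c1" "chain X k \<delta> w q c2"
      "c1 + c2 = c" "dist w a \<le> M" by blast
    have "chain X k \<delta> w r (c2 + k q r)" by (rule chain.step[OF w(4) step.hyps(2,3)])
    moreover have "c1 + (c2 + k q r) = c + k q r" using w(5) by simp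
    ultimately show ?thesis using w by blast
  next
    assume "\<exists>T. compact T \<and> connected T \<and> T \<subseteq> X \<and> p \<in> T \<and> q \<in> T \<and> T \<inter> A = {}"
    then obtain T where T: "compact T" "connected T" "T \<subseteq> X" "p \<in> T" "q \<in> T" "T \<inter> A = {}" by blast
    show ?thesis
    proof (cases "T' \<inter> A = {}")
      case True
      have "connected (T \<union> T')" using T(2,5) T'(2,4) by (intro connected_Un) auto
      then show ?thesis using T T' True by (intro disjI2 exI[of _ "T \<union> T'"]) auto
    next
      case False
      then obtain a where a: "a \<in> T'" "a \<in> A" by blast
      have "chain X k \<delta> q r (k q r)" by (rule chain_single[OF q step.hyps(2,3)])
      then show ?thesis
        using a T' step.hyps(1) by (intro disjI1 exI[of _ q] exI[of _ a] exI[of _ c] exI[of _ "k q r"]) auto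
    qed
  qed
qed

section \<open>Cost of a step and the pseudometric on the sphere\<close>

context horizontal_sphere_map
begin

text \<open>Comparable to the Carnot--Caratheodory distance of \<open>f p\<close> and \<open>f q\<close>, but symmetric and explicit.\<close>

definition cost :: "'a \<Rightarrow> 'a \<Rightarrow> real" where
  "cost p q = \<bar>x q - x p\<bar> + \<bar>y q - y p\<bar> + sqrt \<bar>z q - z p - (y p + y q) / 2 * (x q - x p)\<bar>"

lemma cost_nonneg: "0 \<le> cost p q"
  by (simp add: cost_def)

lemma cost_sym: "cost p q = cost q p"
proof -
  have "z q - z p - (y p + y q) / 2 * (x q - x p) = - (z p - z q - (y q + y p) / 2 * (x p - x q))"
    by (simp add: field_simps)
  then have "\<bar>z q - z p - (y p + y q) / 2 * (x q - x p)\<bar> = \<bar>z p - z q - (y q + y p) / 2 * (x p - x q)\<bar>"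
    by simp
  then show ?thesis by (simp add: cost_def abs_minus_commute)
qed

lemma cost_eq_0: "f p = f q \<Longrightarrow> cost p q = 0"
  by (simp add: cost_def f_def)

definition cost_lip :: real where "cost_lip = 2 * L + sqrt (L + L\<^sup>2)"

lemma cost_lip_nonneg: "0 \<le> cost_lip"
  using L_nonneg by (simp add: cost_lip_def)

text \<open>The argument of the root is of second order: \<open>L\<close> comes from horizontality,
  \<open>L^2\<close> from replacing \<open>y p\<close> by the mean of \<open>y p\<close> and
  \<open>y q\<close>.\<close>

lemma cost_le:
  assumes pq: "p \<in> S" "q \<in> S"
  shows "cost p q \<le> cost_lip * dist p q"
proof -
  let ?d = "dist p q"
  have "z q - z p - (y p + y q) / 2 * (x q - x p)
      = (z q - z p - y p * (x q - x p)) - (y q - y p) / 2 * (x q - x p)"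
    by (simp add: field_simps)
  then have "\<bar>z q - z p - (y p + y q) / 2 * (x q - x p)\<bar>
      \<le> \<bar>z q - z p - y p * (x q - x p)\<bar> + \<bar>y q - y p\<bar> / 2 * \<bar>x q - x p\<bar>"
    by (metis abs_divide abs_mult abs_numeral abs_triangle_ineq4)
  also have "\<dots> \<le> L * ?d\<^sup>2 + (L * ?d) * (L * ?d)"
  proof (intro add_mono mult_mono)
    show "\<bar>y q - y p\<bar> / 2 \<le> L * ?d" using y_lip[OF pq] abs_ge_zero[of "y q - y p"] by argo
  qed (use x_lip[OF pq] z_horizontal[OF pq] L_nonneg in auto)
  also have "\<dots> = (L + L\<^sup>2) * ?d\<^sup>2" by (simp add: power2_eq_square algebra_simps)
  finally have "sqrt \<bar>z q - z p - (y p + y q) / 2 * (x q - x p)\<bar> \<le> sqrt (L + L\<^sup>2) * ?d"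
    using real_sqrt_le_mono by (fastforce simp: real_sqrt_mult)
  then show ?thesis
    using x_lip[OF pq] y_lip[OF pq] by (simp add: cost_def cost_lip_def algebra_simps)
qed

text \<open>For angles above 120 degrees \<open>\<delta>\<close> exceeds 1, and the whole sphere, of
  diameter 2, serves as the link; otherwise an arc does.\<close>

lemma link:
  assumes pq: "p \<in> S" "q \<in> S" and d: "dist p q < \<delta>"
  shows "\<exists>T. compact T \<and> connected T \<and> T \<subseteq> S \<and> p \<in> T \<and> q \<in> T \<and> T \<subseteq> cball p (4 * \<delta>)"
proof (cases "- 1/2 \<le> p \<bullet> q")
  case True
  then obtain g where g: "\<And>t. t \<in> {0..1} \<Longrightarrow> g t \<in> S" "g 0 = p" "g 1 = q"
    "\<And>s t. s \<in> {0..1} \<Longrightarrow> t \<in> {0..1} \<Longrightarrow> dist (g s) (g t) \<le> 4 * dist p q * \<bar>s - t\<bar>"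
    using sphere_arc[OF pq] by metis
  have "(4 * dist p q)-lipschitz_on {0..1} g"
    using g(4) by (intro lipschitz_onI) (auto simp: dist_real_def)
  then have "continuous_on {0..1} g" by (rule lipschitz_on_continuous_on)
  then have "compact (g ` {0..1})" "connected (g ` {0..1})"
    by (auto intro: compact_continuous_image connected_continuous_image)
  moreover have "g ` {0..1} \<subseteq> cball p (4 * \<delta>)"
  proof
    fix w assume "w \<in> g ` {0..1}"
    then obtain t where t: "t \<in> {0..1}" "w = g t" by blast
    have "dist p w \<le> 4 * dist p q * \<bar>0 - t\<bar>" using g(4)[of 0 t] t g(2) by simp
    also have "\<dots> \<le> 4 * dist p q * 1" using t by (intro mult_left_mono) auto
    finally show "w \<in> cball p (4 * \<delta>)" using d by simp
  qed
  moreover have "p \<in> g ` {0..1}" "q \<in> g ` {0..1}"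
    using g(2,3) by (metis atLeastAtMost_iff image_eqI order_refl zero_le_one)+
  ultimately show ?thesis using g(1) by (intro exI[of _ "g ` {0..1}"]) auto
next
  case False
  have unit: "p \<bullet> p = 1" "q \<bullet> q = 1" using pq by (auto simp: norm_eq_1)
  have "(dist p q)\<^sup>2 = 2 - 2 * (p \<bullet> q)"
    unfolding dist_norm power2_norm_eq_inner by (simp add: inner_diff inner_commute unit)
  then have "1\<^sup>2 \<le> (dist p q)\<^sup>2" using False by simp
  then have "1 \<le> dist p q" by (rule power2_le_imp_le) simp
  then have "S \<subseteq> cball p (4 * \<delta>)" using sphere_dist_le[OF pq(1)] d by force
  moreover have "connected S" using connected_sphere dim by force
  ultimately show ?thesis using pq by (intro exI[of _ S]) auto
qed

definition chain_lip :: real where "chain_lip = 8 * cost_lip"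

lemma chain_lip_nonneg: "0 \<le> chain_lip"
  using cost_lip_nonneg by (simp add: chain_lip_def)

text \<open>For angles above 120 degrees the chain passes through a unit vector orthogonal to
  \<open>p\<close>, with its sign chosen towards \<open>q\<close>. Neither leg is longer than
  \<open>dist p q\<close>, and each arc costs at most \<open>4 * cost_lip\<close> times its chord,
  whence the 8 in \<open>chain_lip\<close>.\<close>

lemma chain_exists:
  assumes pq: "p \<in> S" "q \<in> S" and "0 < \<delta>"
  shows "\<exists>c\<le>chain_lip * dist p q. chain S cost \<delta> p q c"
proof -
  have near: "\<exists>c\<le>cost_lip * (4 * dist p q). chain S cost \<delta> p q c"
    if ab: "p \<in> S" "q \<in> S" "- 1/2 \<le> p \<bullet> q" for p q
  proof -
    obtain g where g: "\<And>t. t \<in> {0..1} \<Longrightarrow> g t \<in> S" "g 0 = p" "g 1 = q"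
      "\<And>s t. s \<in> {0..1} \<Longrightarrow> t \<in> {0..1} \<Longrightarrow> dist (g s) (g t) \<le> 4 * dist p q * \<bar>s - t\<bar>"
      using sphere_arc[OF ab] by metis
    show ?thesis
      using chain_along_curve[OF g(1) _ g(4) cost_lip_nonneg cost_le \<open>0 < \<delta>\<close>] g(2,3) by simp
  qed
  show ?thesis
  proof (cases "- 1/2 \<le> p \<bullet> q")
    case True
    have "cost_lip * (4 * dist p q) \<le> chain_lip * dist p q"
      using cost_lip_nonneg by (simp add: chain_lip_def)
    then show ?thesis using near[OF pq True] by (meson order_trans)
  next
    case False
    have unit: "p \<bullet> p = 1" "q \<bullet> q = 1" using pq by (auto simp: norm_eq_1)
    obtain r0 where r0: "r0 \<noteq> 0" "orthogonal p r0"
      using orthogonal_to_vector_exists[of p] dim by auto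
    define r where "r = (if 0 \<le> r0 \<bullet> q then 1 else -1) *\<^sub>R (r0 /\<^sub>R norm r0)"
    have r: "r \<in> S" "p \<bullet> r = 0" "0 \<le> r \<bullet> q"
      using r0 by (auto simp: r_def orthogonal_def mult_nonneg_nonpos)
    have rr: "r \<bullet> r = 1" using r(1) by (auto simp: norm_eq_1)
    have dd: "(dist a b)\<^sup>2 = 2 - 2 * (a \<bullet> b)" if "a \<bullet> a = 1" "b \<bullet> b = 1" for a b :: 'a
      unfolding dist_norm power2_norm_eq_inner using that by (simp add: inner_diff inner_commute)
    have "(dist p r)\<^sup>2 \<le> (dist p q)\<^sup>2" "(dist r q)\<^sup>2 \<le> (dist p q)\<^sup>2"
      using dd unit rr r False by auto
    then have le: "dist p r \<le> dist p q" "dist r q \<le> dist p q"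
      by (auto intro: power2_le_imp_le)
    obtain c1 where c1: "c1 \<le> cost_lip * (4 * dist p r)" "chain S cost \<delta> p r c1"
      using near[OF pq(1) r(1)] r(2) by auto
    obtain c2 where c2: "c2 \<le> cost_lip * (4 * dist r q)" "chain S cost \<delta> r q c2"
      using near[OF r(1) pq(2)] r(3) by auto
    have "c1 + c2 \<le> chain_lip * dist p q"
      using c1(1) c2(1) mult_left_mono[OF le(1) cost_lip_nonneg] mult_left_mono[OF le(2) cost_lip_nonneg]
      unfolding chain_lip_def by simp
    then show ?thesis using chain_trans[OF c2(2) c1(2)] by blast
  qed
qed

text \<open>The least cost of a \<open>\<delta>\<close>-chain grows as \<open>\<delta>\<close>
  shrinks; this is its limit at 0, written as one infimum instead of a supremum of infima.\<close>

definition tree_dist :: "'a \<Rightarrow> 'a \<Rightarrow> real" where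
  "tree_dist p q = Inf {c. \<forall>\<delta>>0. \<exists>c'\<le>c. chain S cost \<delta> p q c'}"

lemma tree_dist_bdd: "bdd_below {c. \<forall>\<delta>>0. \<exists>c'\<le>c. chain S cost \<delta> p q c'}"
proof (rule bdd_belowI[of _ 0])
  fix c assume "c \<in> {c. \<forall>\<delta>>0. \<exists>c'\<le>c. chain S cost \<delta> p q c'}"
  then obtain c' where "c' \<le> c" "chain S cost 1 p q c'" using zero_less_one by blast
  then show "0 \<le> c" using chain_nonneg cost_nonneg by fastforce
qed

lemma tree_dist_approx:
  assumes "p \<in> S" "q \<in> S" "0 < \<delta>" "0 < e"
  obtains c where "c < tree_dist p q + e" "chain S cost \<delta> p q c"
proof -
  have "chain_lip * dist p q \<in> {c. \<forall>\<delta>>0. \<exists>c'\<le>c. chain S cost \<delta> p q c'}"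
    using chain_exists assms by blast
  then obtain c where "c < tree_dist p q + e" "\<forall>\<delta>>0. \<exists>c'\<le>c. chain S cost \<delta> p q c'"
    using cInf_lessD[of "{c. \<forall>\<delta>>0. \<exists>c'\<le>c. chain S cost \<delta> p q c'}" "tree_dist p q + e"] \<open>0 < e\<close>
    unfolding tree_dist_def by auto
  then show thesis using that \<open>0 < \<delta>\<close> by (meson le_less_trans)
qed

lemma tree_dist_le:
  assumes "\<And>\<delta> e. \<lbrakk>0 < \<delta>; 0 < e\<rbrakk> \<Longrightarrow> \<exists>c'\<le>c + e. chain S cost \<delta> p q c'"
  shows "tree_dist p q \<le> c"
proof (rule field_le_epsilon)
  fix e :: real assume "0 < e"
  then show "tree_dist p q \<le> c + e"
    unfolding tree_dist_def using assms by (intro cInf_lower tree_dist_bdd) auto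
qed

lemma tree_dist_nonneg:
  assumes "p \<in> S" "q \<in> S"
  shows "0 \<le> tree_dist p q"
proof (rule field_le_epsilon)
  fix e :: real assume "0 < e"
  then obtain c where "c < tree_dist p q + e" "chain S cost 1 p q c"
    using tree_dist_approx[OF assms zero_less_one] by blast
  then show "0 \<le> tree_dist p q + e" using chain_nonneg[of S cost] cost_nonneg by fastforce
qed

lemma tree_dist_refl: "p \<in> S \<Longrightarrow> tree_dist p p = 0"
  using tree_dist_nonneg[of p p] tree_dist_le[of 0 p p] chain.refl[of p S] by (meson add_nonneg_nonneg less_imp_le order_antisym order_refl)

lemma tree_dist_sym: "tree_dist p q = tree_dist q p"
proof -
  have "chain S cost \<delta> p q c \<longleftrightarrow> chain S cost \<delta> q p c" for \<delta> c
    using chain_sym cost_sym by blast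
  then show ?thesis by (simp add: tree_dist_def)
qed

lemma tree_dist_triangle:
  assumes "p \<in> S" "q \<in> S" "r \<in> S"
  shows "tree_dist p r \<le> tree_dist p q + tree_dist q r"
proof (rule tree_dist_le)
  fix \<delta> e :: real assume "0 < \<delta>" "0 < e"
  obtain c where c: "c < tree_dist p q + e/2" "chain S cost \<delta> p q c"
    using tree_dist_approx[OF assms(1,2) \<open>0 < \<delta>\<close>] \<open>0 < e\<close> half_gt_zero by blast
  obtain c' where c': "c' < tree_dist q r + e/2" "chain S cost \<delta> q r c'"
    using tree_dist_approx[OF assms(2,3) \<open>0 < \<delta>\<close>] \<open>0 < e\<close> half_gt_zero by blast
  have "c + c' \<le> tree_dist p q + tree_dist q r + e" using c c' by (simp add: field_simps)
  then show "\<exists>c'\<le>tree_dist p q + tree_dist q r + e. chain S cost \<delta> p r c'"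
    using chain_trans[OF c'(2) c(2)] by blast
qed

lemma tree_dist_le_dist:
  assumes "p \<in> S" "q \<in> S"
  shows "tree_dist p q \<le> chain_lip * dist p q"
proof (rule tree_dist_le)
  fix \<delta> e :: real assume "0 < \<delta>" "0 < e"
  then show "\<exists>c'\<le>chain_lip * dist p q + e. chain S cost \<delta> p q c'"
    using chain_exists[OF assms] by (meson add_increasing2 less_imp_le order_trans)
qed

text \<open>As in the group law, a new step adds to the z-defect its own defect and an area of order
  \<open>(c + k) * k\<close>, with \<open>k\<close> the cost of the step;
  \<open>2 * (c + k)^2\<close> has room for both. The bounds do not involve \<open>\<delta>\<close>,
  so they survive in the limit and make \<open>f\<close> Lipschitz on the tree.\<close>

lemma chain_lower_bounds:
  assumes "chain S cost \<delta> p q c"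
  shows "\<bar>x q - x p\<bar> \<le> c \<and> \<bar>y q - y p\<bar> \<le> c \<and> \<bar>z q - z p - y p * (x q - x p)\<bar> \<le> 2 * c\<^sup>2"
  using assms
proof (induction)
  case (step p q c r)
  let ?k = "cost q r" and ?w = "z r - z q - (y q + y r) / 2 * (x r - x q)"
  have c0: "0 \<le> c" using chain_nonneg[OF step.hyps(1) cost_nonneg] .
  have parts: "\<bar>x r - x q\<bar> + \<bar>y r - y q\<bar> + sqrt \<bar>?w\<bar> = ?k" by (simp add: cost_def)
  have s0: "0 \<le> sqrt \<bar>?w\<bar>" by simp
  have k: "\<bar>x r - x q\<bar> \<le> ?k" "\<bar>y r - y q\<bar> \<le> ?k" "sqrt \<bar>?w\<bar> \<le> ?k"
    using parts s0 abs_ge_zero[of "x r - x q"] abs_ge_zero[of "y r - y q"] by linarith+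
  have "(sqrt \<bar>?w\<bar>)\<^sup>2 \<le> ?k\<^sup>2" using k(3) s0 by (rule power_mono)
  then have w: "\<bar>?w\<bar> \<le> ?k\<^sup>2" by simp
  have "z r - z p - y p * (x r - x p)
      = (z q - z p - y p * (x q - x p)) + ?w + ((y q - y p) + (y r - y q) / 2) * (x r - x q)"
    by (simp add: field_simps)
  moreover have "\<bar>((y q - y p) + (y r - y q) / 2) * (x r - x q)\<bar> \<le> (c + ?k) * ?k"
    unfolding abs_mult
  proof (rule mult_mono)
    have "\<bar>(y r - y q) / 2\<bar> \<le> ?k" using k(2) by simp
    then show "\<bar>(y q - y p) + (y r - y q) / 2\<bar> \<le> c + ?k" using step.IH by linarith
  qed (use k c0 cost_nonneg in auto)
  ultimately have "\<bar>z r - z p - y p * (x r - x p)\<bar> \<le> 2 * c\<^sup>2 + ?k\<^sup>2 + (c + ?k) * ?k"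
    using step.IH w by linarith
  also have "\<dots> \<le> 2 * (c + ?k)\<^sup>2"
  proof -
    have "0 \<le> c * ?k" using c0 cost_nonneg by simp
    then show ?thesis by (simp add: power2_eq_square algebra_simps)
  qed
  finally show ?case using step.IH k by auto
qed auto

lemma tree_dist_lower_bounds:
  assumes "p \<in> S" "q \<in> S"
  shows "\<bar>x q - x p\<bar> \<le> tree_dist p q" "\<bar>y q - y p\<bar> \<le> tree_dist p q" "\<bar>z q - z p - y p * (x q - x p)\<bar> \<le> 2 * (tree_dist p q)\<^sup>2"
proof -
  have *: "\<bar>x q - x p\<bar> \<le> tree_dist p q + e \<and> \<bar>y q - y p\<bar> \<le> tree_dist p q + e
      \<and> \<bar>z q - z p - y p * (x q - x p)\<bar> \<le> 2 * (tree_dist p q + e)\<^sup>2" if e: "0 < e" for e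
  proof -
    obtain c where c: "c < tree_dist p q + e" "chain S cost 1 p q c" using tree_dist_approx[OF assms zero_less_one e] .
    have "0 \<le> c" using chain_nonneg[OF c(2) cost_nonneg] .
    then have "c\<^sup>2 \<le> (tree_dist p q + e)\<^sup>2" using c(1) by (intro power_mono) auto
    then show ?thesis using chain_lower_bounds[OF c(2)] c(1) by auto
  qed
  show "\<bar>x q - x p\<bar> \<le> tree_dist p q" "\<bar>y q - y p\<bar> \<le> tree_dist p q"
    using * by (blast intro: field_le_epsilon)+
  have "((\<lambda>e. 2 * (tree_dist p q + e)\<^sup>2) \<longlongrightarrow> 2 * (tree_dist p q + 0)\<^sup>2) (at_right 0)"
    by (intro tendsto_intros)
  moreover have "eventually (\<lambda>e. \<bar>z q - z p - y p * (x q - x p)\<bar> \<le> 2 * (tree_dist p q + e)\<^sup>2) (at_right 0)"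
    using * by (auto simp: eventually_at_right_field intro: exI[of _ 1])
  ultimately show "\<bar>z q - z p - y p * (x q - x p)\<bar> \<le> 2 * (tree_dist p q)\<^sup>2"
    using tendsto_lowerbound[of "\<lambda>e. 2 * (tree_dist p q + e)\<^sup>2"] by fastforce
qed

lemma tree_dist_eq_0_imp_f_eq:
  assumes "p \<in> S" "q \<in> S" "tree_dist p q = 0"
  shows "f p = f q"
  using tree_dist_lower_bounds[OF assms(1,2)] assms(3) by (simp add: f_def)

text \<open>A connected set can be chained by steps of any given size, whether or not it contains a
  curve, and steps inside a fibre cost nothing.\<close>

lemma tree_dist_eq_0_on_fibre:
  assumes "connected K" "K \<subseteq> S" "\<And>w w'. w \<in> K \<Longrightarrow> w' \<in> K \<Longrightarrow> f w = f w'" "p \<in> K" "q \<in> K"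
  shows "tree_dist p q = 0"
proof -
  have "chain S cost \<delta> p q 0" if "0 < \<delta>" for \<delta>
  proof (rule connected_equivalence_relation[OF assms(1,4,5)])
    show "chain S cost \<delta> b a 0" if "chain S cost \<delta> a b 0" for a b
      using chain_sym[OF that] cost_sym by blast
    show "chain S cost \<delta> a c 0" if "chain S cost \<delta> a b 0" "chain S cost \<delta> b c 0" for a b c
      using chain_trans[OF that(2,1)] by simp
    show "\<exists>T. openin (top_of_set K) T \<and> a \<in> T \<and> (\<forall>w\<in>T. chain S cost \<delta> a w 0)" if a: "a \<in> K" for a
    proof (intro exI[of _ "K \<inter> ball a \<delta>"] conjI ballI)
      show "chain S cost \<delta> a w 0" if "w \<in> K \<inter> ball a \<delta>" for w
      proof -
        have w: "a \<in> S" "w \<in> S" "w \<in> K" "dist a w < \<delta>" using a that assms(2) by auto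
        then show ?thesis
          using chain_single[OF w(1,2,4), of cost] cost_eq_0[OF assms(3)[OF a w(3)]] by simp
      qed
    qed (use a \<open>0 < \<delta>\<close> in \<open>auto simp: openin_open_Int\<close>)
  qed
  then have "tree_dist p q \<le> 0" by (intro tree_dist_le) (auto intro!: exI[of _ 0])
  then show ?thesis using tree_dist_nonneg[of p q] assms by fastforce
qed

end

section \<open>Cut points\<close>

context horizontal_sphere_map
begin

definition tree_class :: "'a \<Rightarrow> 'a set" where "tree_class m = {w \<in> S. tree_dist m w = 0}"

text \<open>The whole zero class is the obstacle, since it becomes one point of the quotient. The
  endpoints count as cutting. Compactness of the test sets lets the relation pass to limits of
  \<open>m\<close>.\<close>

definition cuts :: "'a \<Rightarrow> 'a \<Rightarrow> 'a \<Rightarrow> bool" where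
  "cuts m p q \<longleftrightarrow> m \<in> S \<and>
    (\<forall>T. compact T \<and> connected T \<and> T \<subseteq> S \<and> p \<in> T \<and> q \<in> T \<longrightarrow> T \<inter> tree_class m \<noteq> {})"

lemma cutsD:
  assumes "cuts m p q" "compact T" "connected T" "T \<subseteq> S" "p \<in> T" "q \<in> T"
  shows "\<exists>w\<in>T. tree_dist m w = 0"
  using assms unfolding cuts_def tree_class_def by blast

lemma cuts_left: "p \<in> S \<Longrightarrow> cuts p p q"
  and cuts_right: "q \<in> S \<Longrightarrow> cuts q p q"
  using tree_dist_refl by (auto simp: cuts_def tree_class_def)

text \<open>Continua from \<open>p\<close> to \<open>r\<close> and from \<open>r\<close> to
  \<open>q\<close> avoiding the class join to one from \<open>p\<close> to \<open>q\<close>. The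
  tree property \<open>split\<close> descends from this.\<close>

lemma cuts_split:
  assumes "cuts m p q"
  shows "cuts m p r \<or> cuts m r q"
proof (rule ccontr)
  assume neg: "\<not> ?thesis"
  have mS: "m \<in> S" using assms by (simp add: cuts_def)
  obtain T where T: "compact T" "connected T" "T \<subseteq> S" "p \<in> T" "r \<in> T" "T \<inter> tree_class m = {}"
    using neg mS unfolding cuts_def by blast
  obtain T' where T': "compact T'" "connected T'" "T' \<subseteq> S" "r \<in> T'" "q \<in> T'" "T' \<inter> tree_class m = {}"
    using neg mS unfolding cuts_def by blast
  have "connected (T \<union> T')" using T(2,5) T'(2,4) by (intro connected_Un) auto
  moreover have "compact (T \<union> T')" using T(1) T'(1) by (rule compact_Un)
  ultimately have "(T \<union> T') \<inter> tree_class m \<noteq> {}"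
    using assms T T' unfolding cuts_def by blast
  then show False using T(6) T'(6) by blast
qed

text \<open>A nearly optimal fine chain must come close to the class of \<open>m\<close>; a nearly
  free detour to \<open>m\<close> splits it into chains from \<open>p\<close> to \<open>m\<close>
  and from \<open>m\<close> to \<open>q\<close>. The slack is \<open>7 * e\<close>: \<open>e\<close>
  for near optimality, \<open>2 * e\<close> for two uses of \<open>far\<close>, and
  \<open>4 * e\<close> for a detour of cost below \<open>2 * e\<close> run twice.\<close>

lemma cuts_additive:
  assumes m: "cuts m p q" and pq: "p \<in> S" "q \<in> S"
  shows "tree_dist p q = tree_dist p m + tree_dist m q"
proof (rule antisym)
  have mS: "m \<in> S" using m by (simp add: cuts_def)
  show "tree_dist p q \<le> tree_dist p m + tree_dist m q" by (rule tree_dist_triangle[OF pq(1) mS pq(2)])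
  have "tree_dist p m + tree_dist m q \<le> tree_dist p q + 7 * e" if e: "0 < e" for e
  proof -
    \<comment> \<open>Least costs increase to \<open>tree_dist\<close> as \<open>\<delta>\<close>
      shrinks, so some \<open>\<delta>\<close> bounds all chains from below up to
      \<open>e\<close>.\<close>
    have far: "\<exists>\<delta>>0. \<forall>c. chain S cost \<delta> a b c \<longrightarrow> tree_dist a b - e < c" for a b
    proof (rule ccontr)
      assume "\<not> ?thesis"
      then have *: "\<exists>c\<le>tree_dist a b - e. chain S cost \<delta> a b c" if "0 < \<delta>" for \<delta>
        using that by (meson not_less)
      have "tree_dist a b \<le> tree_dist a b - e"
      proof (rule tree_dist_le)
        fix \<delta> e' :: real assume "0 < \<delta>" "0 < e'"
        then show "\<exists>c\<le>tree_dist a b - e + e'. chain S cost \<delta> a b c"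
          using *[of \<delta>] by (meson add_increasing2 less_imp_le order_trans order_refl)
      qed
      then show False using e by simp
    qed
    obtain \<delta>1 where \<delta>1: "0 < \<delta>1" "\<And>c. chain S cost \<delta>1 p m c \<Longrightarrow> tree_dist p m - e < c" using far by blast
    obtain \<delta>2 where \<delta>2: "0 < \<delta>2" "\<And>c. chain S cost \<delta>2 m q c \<Longrightarrow> tree_dist m q - e < c" using far by blast
    define \<delta> where "\<delta> = min \<delta>1 \<delta>2"
    have \<delta>0: "0 < \<delta>" using \<delta>1 \<delta>2 by (simp add: \<delta>_def)
    \<comment> \<open>Links have radius \<open>4 * \<eta>\<close>: the first term makes this a
      permitted step of a \<open>\<delta>\<close>-chain, the second makes it cost at most
      \<open>e\<close>.\<close>
    define \<eta> where "\<eta> = min (\<delta> / 8) (e / (4 * cost_lip + 1))"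
    have \<eta>: "0 < \<eta>" using \<delta>0 e cost_lip_nonneg by (auto simp: \<eta>_def)
    have \<eta>8: "\<eta> \<le> \<delta> / 8" unfolding \<eta>_def by (rule min.cobounded1)
    have "cost_lip * (4 * \<eta>) \<le> (4 * cost_lip + 1) * \<eta>" using \<eta> by (simp add: algebra_simps)
    also have "\<dots> \<le> (4 * cost_lip + 1) * (e / (4 * cost_lip + 1))"
      using cost_lip_nonneg by (intro mult_left_mono) (auto simp: \<eta>_def)
    also have "\<dots> = e" using cost_lip_nonneg by (simp add: field_simps)
    finally have \<eta>e: "cost_lip * (4 * \<eta>) \<le> e" .
    obtain c where c: "c < tree_dist p q + e" "chain S cost \<eta> p q c"
      using tree_dist_approx[OF pq \<eta> e] by blast
    have \<eta>4: "0 \<le> 4 * \<eta>" using \<eta> by simp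
    have "\<not> (\<exists>T. compact T \<and> connected T \<and> T \<subseteq> S \<and> p \<in> T \<and> q \<in> T \<and> T \<inter> tree_class m = {})"
      using m unfolding cuts_def by blast
    then obtain w a c1 c2 where w: "a \<in> tree_class m" "a \<in> S" "chain S cost \<eta> p w c1" "chain S cost \<eta> w q c2"
      "c1 + c2 = c" "dist w a \<le> 4 * \<eta>"
      using chain_crosses[OF c(2) \<eta>4 link, of "tree_class m"] by blast
    have wS: "w \<in> S" using chain_in(2)[OF w(3)] .
    have wa: "dist w a < \<delta>" using w(6) \<eta> \<eta>8 \<delta>0 by linarith
    have "chain S cost \<delta> w a (cost w a)" using chain_single[OF wS w(2) wa] .
    moreover obtain c3 where c3: "c3 < tree_dist a m + e" "chain S cost \<delta> a m c3"
      using tree_dist_approx[OF w(2) mS \<delta>0 e] by blast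
    ultimately have wm: "chain S cost \<delta> w m (cost w a + c3)" using chain_trans by blast
    then have mw: "chain S cost \<delta> m w (cost w a + c3)" using chain_sym cost_sym by blast
    have "tree_dist a m = 0" using w(1) tree_dist_sym by (simp add: tree_class_def)
    then have small: "cost w a + c3 < 2 * e"
      using c3(1) cost_le[OF wS w(2)] mult_left_mono[OF w(6) cost_lip_nonneg] \<eta>e by linarith
    have le: "\<eta> \<le> \<delta>" "\<delta> \<le> \<delta>1" "\<delta> \<le> \<delta>2" using \<eta>8 \<delta>0 by (auto simp: \<delta>_def)
    have "chain S cost \<delta>1 p m (c1 + (cost w a + c3))"
      using chain_mono[OF chain_trans[OF wm chain_mono[OF w(3) le(1)]] le(2)] .
    moreover have "chain S cost \<delta>2 m q ((cost w a + c3) + c2)"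
      using chain_mono[OF chain_trans[OF chain_mono[OF w(4) le(1)] mw] le(3)] .
    ultimately have "tree_dist p m - e < c1 + (cost w a + c3)" "tree_dist m q - e < (cost w a + c3) + c2"
      using \<delta>1(2) \<delta>2(2) by blast+
    then show ?thesis using small w(5) c(1) by linarith
  qed
  note key = this
  have "tree_dist p m + tree_dist m q \<le> tree_dist p q + e" if "0 < e" for e
    using key[of "e / 7"] that by simp
  then show "tree_dist p m + tree_dist m q \<le> tree_dist p q" by (rule field_le_epsilon)
qed

lemma fibre_subset_tree_class:
  assumes "connected C" "C \<subseteq> S" "c \<in> C" "\<And>w. w \<in> C \<Longrightarrow> f w = f c"
  shows "C \<subseteq> tree_class c"
proof
  fix w assume "w \<in> C"
  have "tree_dist c w = 0"
  proof (rule tree_dist_eq_0_on_fibre[OF assms(1,2) _ assms(3) \<open>w \<in> C\<close>])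
    show "f v = f v'" if "v \<in> C" "v' \<in> C" for v v'
      using assms(4)[OF that(1)] assms(4)[OF that(2)] by (rule trans[OF _ sym])
  qed
  then show "w \<in> tree_class c" using \<open>w \<in> C\<close> assms(2) by (auto simp: tree_class_def)
qed

lemma cuts_or_fibre:
  assumes "p \<in> S" "q \<in> S"
  shows "(\<exists>K. connected K \<and> K \<subseteq> S \<and> p \<in> K \<and> q \<in> K \<and> (\<forall>w\<in>K. f w = f p))
    \<or> (\<exists>m. cuts m p q \<and> 0 < tree_dist p m \<and> 0 < tree_dist m q)"
proof (cases "\<exists>m. cuts m p q \<and> 0 < tree_dist p m \<and> 0 < tree_dist m q")
  case False
  have "\<exists>K. connected K \<and> K \<subseteq> S \<and> p \<in> K \<and> q \<in> K \<and> (\<forall>w\<in>K. f w = f p)"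
  proof (rule ccontr)
    assume "\<not> ?thesis"
    then obtain C c where C: "connected C" "C \<subseteq> S" "c \<in> C" "\<And>w. w \<in> C \<Longrightarrow> f w = f c" "f c \<noteq> f p" "f c \<noteq> f q"
      "\<And>T. \<lbrakk>connected T; T \<subseteq> S; p \<in> T; q \<in> T\<rbrakk> \<Longrightarrow> T \<inter> C \<noteq> {}"
      using cut_by_fibre[OF assms] by blast
    have cS: "c \<in> S" using C(2,3) by blast
    have "cuts c p q"
      using C(7) fibre_subset_tree_class[OF C(1-4)] cS unfolding cuts_def by blast
    moreover have "tree_dist p c \<noteq> 0" "tree_dist c q \<noteq> 0"
      using tree_dist_eq_0_imp_f_eq assms cS C(5,6) by metis+
    ultimately show False
      using False tree_dist_nonneg[OF assms(1) cS] tree_dist_nonneg[OF cS assms(2)] by (auto simp: less_le)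
  qed
  then show ?thesis by blast
qed blast

lemma cut_point_exists:
  assumes "p \<in> S" "q \<in> S" "tree_dist p q \<noteq> 0"
  obtains m where "cuts m p q" "0 < tree_dist p m" "0 < tree_dist m q"
proof -
  have "\<not> (\<exists>K. connected K \<and> K \<subseteq> S \<and> p \<in> K \<and> q \<in> K \<and> (\<forall>w\<in>K. f w = f p))"
    using tree_dist_eq_0_on_fibre[of _ p q] assms(3) by metis
  then show thesis using cuts_or_fibre[OF assms(1,2)] that by blast
qed

text \<open>By additivity nothing cuts strictly between two points at distance zero, so
  \<open>cuts_or_fibre\<close> joins them inside a fibre of \<open>f\<close>, which has diameter
  zero itself. A class can therefore be added to any continuum it meets.\<close>

lemma connected_tree_class:
  assumes m: "m \<in> S"
  shows "connected (tree_class m)"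
proof -
  have star: "\<exists>K. connected K \<and> K \<subseteq> tree_class m \<and> m \<in> K \<and> w \<in> K" if w: "w \<in> tree_class m" for w
  proof -
    have wS: "w \<in> S" "tree_dist m w = 0" using w by (auto simp: tree_class_def)
    have "\<not> (\<exists>c. cuts c m w \<and> 0 < tree_dist m c \<and> 0 < tree_dist c w)"
      using cuts_additive[OF _ m wS(1)] wS(2) by fastforce
    then obtain K where K: "connected K" "K \<subseteq> S" "m \<in> K" "w \<in> K" "\<forall>v\<in>K. f v = f m"
      using cuts_or_fibre[OF m wS(1)] by blast
    then show ?thesis using fibre_subset_tree_class[OF K(1,2,3)] by blast
  qed
  have pair: "\<exists>K. connected K \<and> K \<subseteq> tree_class m \<and> v \<in> K \<and> w \<in> K" if vw: "v \<in> tree_class m" "w \<in> tree_class m" for v w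
  proof -
    obtain K where K: "connected K" "K \<subseteq> tree_class m" "m \<in> K" "v \<in> K"
      using star[OF vw(1)] by blast
    obtain K' where K': "connected K'" "K' \<subseteq> tree_class m" "m \<in> K'" "w \<in> K'"
      using star[OF vw(2)] by blast
    have "connected (K \<union> K')" using K(1,3) K'(1,3) by (intro connected_Un) auto
    then show ?thesis using K K' by (intro exI[of _ "K \<union> K'"]) auto
  qed
  show ?thesis
    by (rule connected_iff_connected_component[THEN iffD2])
      (use pair in \<open>auto simp: connected_component_def\<close>)
qed

section \<open>Compactness of classes and cut sets; existence of intermediate points\<close>

lemma continuous_on_D: "p \<in> S \<Longrightarrow> continuous_on S (tree_dist p)"
proof -
  assume p: "p \<in> S"
  have "chain_lip-lipschitz_on S (tree_dist p)"
  proof (rule lipschitz_onI[OF _ chain_lip_nonneg])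
    fix v w assume vw: "v \<in> S" "w \<in> S"
    have "\<bar>tree_dist p v - tree_dist p w\<bar> \<le> tree_dist v w"
      using tree_dist_triangle[OF p vw] tree_dist_triangle[OF p vw(2,1)] tree_dist_sym[of v w] by linarith
    then show "dist (tree_dist p v) (tree_dist p w) \<le> chain_lip * dist v w"
      using tree_dist_le_dist[OF vw] by (simp add: dist_real_def)
  qed
  then show ?thesis by (rule lipschitz_on_continuous_on)
qed

lemma compact_tree_class:
  assumes "m \<in> S"
  shows "compact (tree_class m)"
proof -
  have "closed (tree_class m)" unfolding tree_class_def
    by (rule continuous_closed_preimage_constant[OF continuous_on_D[OF assms] closed_sphere])
  moreover have "S \<inter> tree_class m = tree_class m" by (auto simp: tree_class_def)
  ultimately show ?thesis using compact_Int_closed[OF compact_sphere[of 0 1], of "tree_class m"] by simp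
qed

lemma tree_dist_cong:
  assumes "m \<in> S" "m' \<in> S" "tree_dist m m' = 0" "w \<in> S"
  shows "tree_dist m w = tree_dist m' w"
  using tree_dist_triangle[OF assms(1,2,4)] tree_dist_triangle[OF assms(2,1,4)] assms(3) tree_dist_sym[of m' m] by linarith

text \<open>A test continuum meets the class of each \<open>X n\<close>. Such points accumulate in
  it, and continuity of \<open>tree_dist\<close> puts the limit into the class of
  \<open>m\<close>.\<close>

lemma compact_cuts:
  assumes "p \<in> S" "q \<in> S"
  shows "compact {m. cuts m p q}"
proof -
  have "closed {m. cuts m p q}"
    unfolding closed_sequential_limits
  proof (intro allI impI, elim conjE)
    fix X m assume X: "\<forall>n. X n \<in> {m. cuts m p q}" and lim: "X \<longlonglongrightarrow> m"
    have XS: "X n \<in> S" for n using X by (auto simp: cuts_def)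
    have mS: "m \<in> S" using closed_sequentially[OF closed_sphere] XS lim by blast
    have "T \<inter> tree_class m \<noteq> {}" if T: "compact T" "connected T" "T \<subseteq> S" "p \<in> T" "q \<in> T" for T
    proof -
      have "\<forall>n. \<exists>w\<in>T. tree_dist (X n) w = 0" using X cutsD[OF _ T] by blast
      then obtain t where t: "\<And>n. t n \<in> T" "\<And>n. tree_dist (X n) (t n) = 0" by metis
      obtain l r where l: "l \<in> T" "strict_mono r" "(t \<circ> r) \<longlonglongrightarrow> l"
        using T(1) t(1) unfolding compact_def by meson
      have tS: "t n \<in> S" for n using t(1) T(3) by blast
      have lS: "l \<in> S" using l(1) T(3) by blast
      have "(\<lambda>n. tree_dist m ((t \<circ> r) n)) \<longlonglongrightarrow> tree_dist m l"
        by (rule continuous_on_tendsto_compose[OF continuous_on_D[OF mS] l(3) lS])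
          (use tS in \<open>auto intro!: always_eventually\<close>)
      moreover have "(\<lambda>n. tree_dist m ((t \<circ> r) n)) \<longlonglongrightarrow> 0"
      proof -
        have "(\<lambda>n. tree_dist m ((X \<circ> r) n)) \<longlonglongrightarrow> tree_dist m m"
          by (rule continuous_on_tendsto_compose[OF continuous_on_D[OF mS] LIMSEQ_subseq_LIMSEQ[OF lim l(2)] mS])
            (use XS in \<open>auto intro!: always_eventually\<close>)
        moreover have "tree_dist m ((t \<circ> r) n) = tree_dist m ((X \<circ> r) n)" for n
          using tree_dist_cong[OF XS tS t(2) mS, of "r n"] tree_dist_sym[of m] by simp
        ultimately show ?thesis using tree_dist_refl[OF mS] by simp
      qed
      ultimately have "tree_dist m l = 0" using LIMSEQ_unique by blast
      then have "l \<in> tree_class m" using lS by (simp add: tree_class_def)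
      then show ?thesis using l(1) by blast
    qed
    then show "m \<in> {m. cuts m p q}" using mS unfolding cuts_def by blast
  qed
  moreover have "{m. cuts m p q} \<subseteq> S" by (auto simp: cuts_def)
  ultimately show ?thesis
    using compact_Int_closed[OF compact_sphere[of 0 1]] by (metis Int_absorb1)
qed

text \<open>The heights of cut points form a compact set containing 0 and the full distance. If it
  had a gap, a further cut point between those at the ends of the gap would have its height
  inside.\<close>

lemma cut_point_at:
  assumes p: "p \<in> S" and q: "q \<in> S" and s: "0 \<le> s" "s \<le> tree_dist p q"
  shows "\<exists>m. cuts m p q \<and> tree_dist p m = s"
proof (rule ccontr)
  assume no: "\<not> ?thesis"
  define H where "H = tree_dist p ` {m. cuts m p q}"
  have sub: "{m. cuts m p q} \<subseteq> S" by (auto simp: cuts_def)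
  have "compact H" unfolding H_def
    using compact_continuous_image[OF continuous_on_subset[OF continuous_on_D[OF p] sub] compact_cuts[OF p q]] .
  then have cl: "compact (H \<inter> {..s})" "compact (H \<inter> {s..})" by (auto intro: compact_Int_closed)
  have "0 \<in> H" using cuts_left[OF p, of q] tree_dist_refl[OF p] unfolding H_def by force
  moreover have "tree_dist p q \<in> H" using cuts_right[OF q, of p] unfolding H_def by blast
  moreover have "s \<notin> H" using no unfolding H_def by blast
  ultimately have ne: "H \<inter> {..s} \<noteq> {}" "H \<inter> {s..} \<noteq> {}" using s by auto
  obtain s1 where s1: "s1 \<in> H" "s1 \<le> s" "\<And>t. t \<in> H \<Longrightarrow> t \<le> s \<Longrightarrow> t \<le> s1"
    using compact_attains_sup[OF cl(1) ne(1)] by auto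
  obtain s2 where s2: "s2 \<in> H" "s \<le> s2" "\<And>t. t \<in> H \<Longrightarrow> s \<le> t \<Longrightarrow> s2 \<le> t"
    using compact_attains_inf[OF cl(2) ne(2)] by auto
  have lt: "s1 < s" "s < s2" using s1(1,2) s2(1,2) \<open>s \<notin> H\<close> by (metis less_le)+
  obtain m1 where m1: "cuts m1 p q" "tree_dist p m1 = s1" using s1(1) by (auto simp: H_def)
  obtain m2 where m2: "cuts m2 p q" "tree_dist p m2 = s2" using s2(1) by (auto simp: H_def)
  have mS: "m1 \<in> S" "m2 \<in> S" using m1 m2 by (auto simp: cuts_def)
  \<comment> \<open>\<open>m2\<close> is farther from \<open>p\<close> than \<open>m1\<close>; so it
    must cut \<open>m1\<close> from \<open>q\<close>, and the heights subtract.\<close>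
  have "\<not> cuts m2 p m1"
    using cuts_additive[of m2 p m1] p mS m1(2) m2(2) tree_dist_nonneg[OF mS(2,1)] lt by auto
  then have "cuts m2 m1 q" using cuts_split[OF m2(1)] by blast
  then have d12: "tree_dist m1 m2 = s2 - s1"
    using cuts_additive[of m2 m1 q] cuts_additive[OF m1(1) p q] cuts_additive[OF m2(1) p q] mS q m1(2) m2(2)
    by auto
  then have "tree_dist m1 m2 \<noteq> 0" using lt by simp
  then obtain m where m: "cuts m m1 m2" "0 < tree_dist m1 m" "0 < tree_dist m m2"
    using cut_point_exists[OF mS] by blast
  have mm: "m \<in> S" using m(1) by (simp add: cuts_def)
  have cm: "cuts m p q"
    unfolding cuts_def
  proof (intro conjI allI impI mm)
    fix T assume T: "compact T \<and> connected T \<and> T \<subseteq> S \<and> p \<in> T \<and> q \<in> T"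
    \<comment> \<open>\<open>m\<close> is only known to cut \<open>m1\<close> from
      \<open>m2\<close>. Adding their classes to \<open>T\<close> gives a continuum through both
      points; it meets the class of \<open>m\<close>, which is disjoint from the added classes, so
      the meeting takes place in \<open>T\<close>.\<close>
    let ?T = "T \<union> tree_class m1 \<union> tree_class m2"
    have meet: "T \<inter> tree_class m1 \<noteq> {}" "T \<inter> tree_class m2 \<noteq> {}" using m1(1) m2(1) T unfolding cuts_def by blast+
    have "connected (T \<union> tree_class m1)" using T meet(1) connected_tree_class[OF mS(1)] by (intro connected_Un) auto
    then have "connected ?T"
      by (rule connected_Un[OF _ connected_tree_class[OF mS(2)]]) (use meet(2) in blast)
    moreover have "compact ?T" using T compact_tree_class mS by (intro compact_Un) auto
    moreover have "?T \<subseteq> S" using T by (auto simp: tree_class_def)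
    moreover have "m1 \<in> ?T" "m2 \<in> ?T" using mS tree_dist_refl by (auto simp: tree_class_def)
    ultimately have "?T \<inter> tree_class m \<noteq> {}" using m(1) unfolding cuts_def by blast
    moreover have "tree_class m1 \<inter> tree_class m = {}"
    proof -
      have "tree_dist m1 m = 0" if "w \<in> S" "tree_dist m1 w = 0" "tree_dist m w = 0" for w
        using tree_dist_triangle[OF mS(1) that(1) mm] tree_dist_sym[of w m] that tree_dist_nonneg[OF mS(1) mm] by linarith
      then show ?thesis using m(2) by (fastforce simp: tree_class_def)
    qed
    moreover have "tree_class m2 \<inter> tree_class m = {}"
    proof -
      have "tree_dist m m2 = 0" if "w \<in> S" "tree_dist m2 w = 0" "tree_dist m w = 0" for w
        using tree_dist_triangle[OF mm that(1) mS(2)] tree_dist_sym[of w m2] that tree_dist_nonneg[OF mm mS(2)] by linarith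
      then show ?thesis using m(3) by (fastforce simp: tree_class_def)
    qed
    ultimately show "T \<inter> tree_class m \<noteq> {}" by blast
  qed
  have "tree_dist p m + tree_dist m q = tree_dist p q" using cuts_additive[OF cm p q] by simp
  moreover have "tree_dist p m \<le> s1 + tree_dist m1 m" using tree_dist_triangle[OF p mS(1) mm] m1(2) by simp
  moreover have "tree_dist m q \<le> tree_dist m m2 + (tree_dist p q - s2)"
    using tree_dist_triangle[OF mm mS(2) q] cuts_additive[OF m2(1) p q] m2(2) by simp
  moreover have "tree_dist m1 m + tree_dist m m2 = s2 - s1" using cuts_additive[OF m(1) mS] d12 by simp
  ultimately have "tree_dist p m = s1 + tree_dist m1 m" by linarith
  then have "s1 < tree_dist p m" "tree_dist p m < s2"
    using m(2,3) \<open>tree_dist m1 m + tree_dist m m2 = s2 - s1\<close> by linarith+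
  moreover have "tree_dist p m \<in> H" using cm by (auto simp: H_def)
  ultimately show False using s1(3)[of "tree_dist p m"] s2(3)[of "tree_dist p m"] by linarith
qed

lemma tree_dist_between:
  assumes "p \<in> S" "q \<in> S" "0 \<le> s" "s \<le> tree_dist p q"
  shows "\<exists>m\<in>S. tree_dist p m = s \<and> tree_dist m q = tree_dist p q - s"
proof -
  obtain m where m: "cuts m p q" "tree_dist p m = s" using cut_point_at[OF assms] by blast
  then have "m \<in> S" "tree_dist m q = tree_dist p q - s"
    using cuts_additive[OF m(1) assms(1,2)] by (auto simp: cuts_def)
  then show ?thesis using m by blast
qed

text \<open>A point metrically between \<open>p\<close> and \<open>q\<close> has distance zero from
  the cut point at its height (by \<open>cuts_split\<close> with third point \<open>m\<close>), and
  so inherits the topological alternative.\<close>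

lemma tree_dist_split:
  assumes S: "p \<in> S" "q \<in> S" "r \<in> S" "m \<in> S" and m: "tree_dist p m + tree_dist m q = tree_dist p q"
  shows "tree_dist p m + tree_dist m r = tree_dist p r \<or> tree_dist r m + tree_dist m q = tree_dist r q"
proof -
  have "0 \<le> tree_dist p m" "tree_dist p m \<le> tree_dist p q" using tree_dist_nonneg S m by (auto, smt (verit))
  then obtain m' where m': "cuts m' p q" "tree_dist p m' = tree_dist p m" using cut_point_at[OF S(1,2)] by blast
  have m'S: "m' \<in> S" using m' by (simp add: cuts_def)
  have "tree_dist m' m = 0"
    using cuts_split[OF m'(1), of m]
  proof
    assume "cuts m' p m"
    then show ?thesis using cuts_additive S m'(2) by fastforce
  next
    assume "cuts m' m q"
    then have "tree_dist m q = tree_dist m m' + tree_dist m' q" using cuts_additive S by blast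
    moreover have "tree_dist p q = tree_dist p m' + tree_dist m' q" using cuts_additive[OF m'(1) S(1,2)] .
    ultimately show ?thesis using m m'(2) tree_dist_sym[of m m'] by linarith
  qed
  then have eq: "tree_dist m w = tree_dist m' w" if "w \<in> S" for w using tree_dist_cong[OF m'S S(4) _ that] by simp
  show ?thesis
    using cuts_split[OF m'(1), of r]
  proof
    assume "cuts m' p r"
    then have "tree_dist p r = tree_dist p m' + tree_dist m' r" using cuts_additive S by blast
    then show ?thesis using m'(2) eq[OF S(3)] by simp
  next
    assume "cuts m' r q"
    then have "tree_dist r q = tree_dist r m' + tree_dist m' q" using cuts_additive S by blast
    then show ?thesis using eq[OF S(3)] eq[OF S(2)] tree_dist_sym[of r] by simp
  qed
qed

end

section \<open>A criterion for metric trees\<close>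

text \<open>\<open>between\<close> supplies geodesics; \<open>split\<close> says that each point on
  a side of a triangle lies on another side, which is 0-hyperbolicity. Both speak of distances only
  and so pass from a pseudometric to its quotient.\<close>

locale tree_like = Metric_space +
  assumes between: "\<And>a b s. \<lbrakk>a \<in> M; b \<in> M; 0 \<le> s; s \<le> d a b\<rbrakk>
      \<Longrightarrow> \<exists>m\<in>M. d a m = s \<and> d m b = d a b - s"
    and split: "\<And>a b c m. \<lbrakk>a \<in> M; b \<in> M; c \<in> M; m \<in> M; d a m + d m b = d a b\<rbrakk>
      \<Longrightarrow> d a m + d m c = d a c \<or> d c m + d m b = d c b"
begin

definition interval :: "'a \<Rightarrow> 'a \<Rightarrow> 'a set" where
  "interval a b = {v \<in> M. d a v + d v b = d a b}"

lemma interval_commute: "interval a b = interval b a"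
  by (auto simp: interval_def commute add.commute)

text \<open>Applied to two points of an interval, \<open>split\<close> orders them by their distance
  from \<open>a\<close>; intervals therefore embed isometrically into the line.\<close>

lemma interval_dist:
  assumes "a \<in> M" "b \<in> M" "v \<in> interval a b" "w \<in> interval a b"
  shows "d v w = \<bar>d a v - d a w\<bar>"
proof -
  have *: "d v w = d a w - d a v"
    if "v \<in> interval a b" "w \<in> interval a b" "d a v \<le> d a w" for v w
  proof -
    have "d a v + d v w = d a w \<or> d w v + d v b = d w b"
      using split[of a b w v] that assms by (auto simp: interval_def)
    moreover have "d a v + d v b = d a b" "d a w + d w b = d a b" "0 \<le> d w v"
      using that by (auto simp: interval_def)
    ultimately show ?thesis
      using that(3) commute[of v w] by linarith
  qed
  show ?thesis
    using *[OF assms(3,4)] *[OF assms(4,3)] commute[of v w] by fastforce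
qed

lemma interval_trans:
  assumes "a \<in> M" "b \<in> M" "m \<in> interval a b"
  shows "interval a b = interval a m \<union> interval m b"
proof (intro equalityI subsetI)
  fix v assume v: "v \<in> interval a b"
  have "d v m = \<bar>d a v - d a m\<bar>"
    using interval_dist assms v by blast
  then show "v \<in> interval a m \<union> interval m b"
    using v assms commute[of v m] by (auto simp: interval_def)
next
  fix v assume "v \<in> interval a m \<union> interval m b"
  then have v: "v \<in> M" and m: "m \<in> M" and "d a v + d v m = d a m \<or> d m v + d v b = d m b"
    using assms by (auto simp: interval_def)
  then have "d a v + d v b \<le> d a b"
    using triangle[of v m b] triangle[of a m v] assms by (auto simp: interval_def)
  then show "v \<in> interval a b"
    using triangle[of a v b] v assms by (auto simp: interval_def)
qed

text \<open>Geodesics have a unique image, so a triangle depends on its vertices only.\<close>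

lemma segment_image:
  assumes "geodesic_segment M d a b g L"
  shows "g ` {0..L} = interval a b"
proof -
  have L: "0 \<le> L" and gM: "\<And>t. t \<in> {0..L} \<Longrightarrow> g t \<in> M" and "g 0 = a" "g L = b"
    and g: "\<And>s t. s \<in> {0..L} \<Longrightarrow> t \<in> {0..L} \<Longrightarrow> d (g s) (g t) = \<bar>s - t\<bar>"
    using assms by (auto simp: geodesic_segment_def)
  have ab: "a \<in> M" "b \<in> M" "d a b = L"
    using gM[of 0] gM[of L] g[of 0 L] L \<open>g 0 = a\<close> \<open>g L = b\<close> by auto
  have 1: "d a (g t) = t \<and> g t \<in> interval a b" if "t \<in> {0..L}" for t
    using g[of 0 t] g[of t L] that L \<open>g 0 = a\<close> \<open>g L = b\<close> ab gM by (auto simp: interval_def)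
  have "v \<in> g ` {0..L}" if v: "v \<in> interval a b" for v
  proof -
    have t: "d a v \<in> {0..L}"
    proof -
      have "d a v + d v b = L" "0 \<le> d v b"
        using v ab by (auto simp: interval_def)
      then show ?thesis unfolding atLeastAtMost_iff using nonneg[of a v] by linarith
    qed
    have "d v (g (d a v)) = 0"
      using interval_dist[OF ab(1,2) v] 1[OF t] by auto
    then have "v = g (d a v)"
      using v gM[OF t] zero by (auto simp: interval_def)
    then show ?thesis using t by blast
  qed
  then show ?thesis using 1 by blast
qed

text \<open>\<open>?s\<close> is the Gromov product of \<open>b\<close> and \<open>c\<close> seen
  from \<open>a\<close>; with this choice both alternatives of \<open>split\<close> yield the same
  distance from \<open>m\<close> to \<open>c\<close>.\<close>

lemma branch_point:
  assumes "a \<in> M" "b \<in> M" "c \<in> M"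
  obtains m where "m \<in> interval a b" "m \<in> interval b c" "m \<in> interval c a"
proof -
  let ?s = "(d a b + d a c - d b c) / 2"
  have "0 \<le> ?s" "?s \<le> d a b"
    using assms triangle[of b a c] triangle[of a b c] commute[of a b] by auto
  then obtain m where m: "m \<in> M" "d a m = ?s" "d m b = d a b - ?s"
    using between assms by blast
  then have "d a m + d m c = d a c \<or> d c m + d m b = d c b"
    using split[of a b c m] assms by auto
  then have "d m c = d a c - ?s"
    using m commute[of c m] commute[of c b] by (auto simp: field_simps)
  then have "m \<in> interval a b" "m \<in> interval b c" "m \<in> interval c a"
    using m commute[of c m] commute[of c a] commute[of m b] commute[of m a]
    by (auto simp: interval_def field_simps)
  then show thesis using that by blast
qed

lemma interval_add:
  assumes "a \<in> M" "b \<in> M" "m \<in> interval a b" "v \<in> interval a m" "w \<in> interval b m"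
  shows "d v w = d v m + d w m"
proof -
  have M: "v \<in> M" "w \<in> M" "m \<in> M"
    using assms by (auto simp: interval_def)
  show ?thesis
    using assms triangle[of a v b] triangle[of v w b] triangle[of v m w] M commute[of w m]
       commute[of w b] commute[of m b]
    by (auto simp: interval_def)
qed

lemma metric_tree: "metric_tree M d"
proof -
  have geo: "\<exists>g L. geodesic_segment M d a b g L" if ab: "a \<in> M" "b \<in> M" for a b
  proof -
    have "\<forall>s\<in>{0..d a b}. \<exists>m\<in>M. d a m = s \<and> d m b = d a b - s"
      using between ab by auto
    then obtain g where g: "\<And>s. s \<in> {0..d a b} \<Longrightarrow>
        g s \<in> M \<and> d a (g s) = s \<and> d (g s) b = d a b - s"
      by metis
    have "g 0 = a"
      using g[of 0] ab zero[of a "g 0"] by simp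
    moreover have "g (d a b) = b"
      using g[of "d a b"] ab zero[of "g (d a b)" b] by simp
    moreover have "d (g s) (g t) = \<bar>s - t\<bar>" if "s \<in> {0..d a b}" "t \<in> {0..d a b}" for s t
    proof -
      have "g s \<in> interval a b" "g t \<in> interval a b"
        unfolding interval_def using g[OF that(1)] g[OF that(2)] by simp_all
      then have "d (g s) (g t) = \<bar>d a (g s) - d a (g t)\<bar>"
        using interval_dist ab by blast
      then show ?thesis using g[OF that(1)] g[OF that(2)] by metis
    qed
    moreover have "g ` {0..d a b} \<subseteq> M" using g by blast
    ultimately have "geodesic_segment M d a b g (d a b)"
      unfolding geodesic_segment_def using nonneg by blast
    then show ?thesis by blast
  qed
  have "\<exists>l1 l2 l3. 0 \<le> l1 \<and> 0 \<le> l2 \<and> 0 \<le> l3 \<and>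
           isometric_sets (g1 ` {0..L1} \<union> g2 ` {0..L2} \<union> g3 ` {0..L3}) d
                          (tripod l1 l2 l3) tripod_dist"
    if g: "geodesic_segment M d a b g1 L1" "geodesic_segment M d b c g2 L2"
      "geodesic_segment M d c a g3 L3" for a b c g1 L1 g2 L2 g3 L3
  proof -
    have abc: "a \<in> M" "b \<in> M" "c \<in> M"
      using g by (auto simp: geodesic_segment_def)
    obtain m where m: "m \<in> interval a b" "m \<in> interval b c" "m \<in> interval c a"
      using branch_point abc by blast
    then have mM: "m \<in> M" by (auto simp: interval_def)
    let ?A = "interval a m" and ?B = "interval b m" and ?C = "interval c m"
    have img: "g1 ` {0..L1} \<union> g2 ` {0..L2} \<union> g3 ` {0..L3} = ?A \<union> ?B \<union> ?C"
      unfolding segment_image[OF g(1)] segment_image[OF g(2)] segment_image[OF g(3)]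
        interval_trans[OF abc(1,2) m(1)] interval_trans[OF abc(2,3) m(2)]
        interval_trans[OF abc(3,1) m(3)]
        interval_commute[of m a] interval_commute[of m b] interval_commute[of m c] by blast
    have same: "d v w = \<bar>d v m - d w m\<bar>"
      if "p \<in> M" "v \<in> interval p m" "w \<in> interval p m" for p v w
      proof -
      have "d p v + d v m = d p m" "d p w + d w m = d p m"
        using that by (auto simp: interval_def)
      then show ?thesis using interval_dist[OF that(1) mM that(2,3)] by linarith
    qed
    have diff: "d v w = d v m + d w m"
      if "v \<in> ?A \<and> w \<in> ?B \<or> v \<in> ?B \<and> w \<in> ?C \<or> v \<in> ?C \<and> w \<in> ?A" for v w
      using that interval_add[OF abc(1,2) m(1)] interval_add[OF abc(2,3) m(2)]
        interval_add[OF abc(3,1) m(3)] by blast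
    \<comment> \<open>Each leg becomes an axis, with the distance to \<open>m\<close> as coordinate.
      A point on two legs has distance 0 to \<open>m\<close> (take \<open>w = v\<close> in
      \<open>diff\<close>), so the cases agree.\<close>
    define h where "h v = ((if v \<in> ?A then d v m else 0), (if v \<in> ?B then d v m else 0),
      (if v \<in> ?C then d v m else 0))" for v
    have z: "d v m = 0" if "v \<in> ?A \<and> v \<in> ?B \<or> v \<in> ?B \<and> v \<in> ?C \<or> v \<in> ?C \<and> v \<in> ?A" for v
    proof -
      have "v \<in> M" using that by (auto simp: interval_def)
      then show ?thesis using diff[OF that] by simp
    qed
    have hA: "h v = (d v m, 0, 0)" if "v \<in> ?A" for v
      using z that by (auto simp: h_def)
    have hB: "h v = (0, d v m, 0)" if "v \<in> ?B" for v
      using z that by (auto simp: h_def)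
    have hC: "h v = (0, 0, d v m)" if "v \<in> ?C" for v
      using z that by (auto simp: h_def)
    have sym: "tripod_dist (h v) (h w) = tripod_dist (h w) (h v)" for v w
      by (simp add: tripod_dist_def abs_minus_commute)
    have iso_same: "tripod_dist (h v) (h w) = d v w"
      if "v \<in> ?A \<and> w \<in> ?A \<or> v \<in> ?B \<and> w \<in> ?B \<or> v \<in> ?C \<and> w \<in> ?C" for v w
      using that
    proof (elim disjE conjE)
      assume "v \<in> ?A" "w \<in> ?A" then show ?thesis
        using same[of a v w] abc by (simp add: tripod_dist_def hA)
    next
      assume "v \<in> ?B" "w \<in> ?B" then show ?thesis
        using same[of b v w] abc by (simp add: tripod_dist_def hB)
    next
      assume "v \<in> ?C" "w \<in> ?C" then show ?thesis
        using same[of c v w] abc by (simp add: tripod_dist_def hC)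
    qed
    have iso_diff: "tripod_dist (h v) (h w) = d v w"
      if "v \<in> ?A \<and> w \<in> ?B \<or> v \<in> ?B \<and> w \<in> ?C \<or> v \<in> ?C \<and> w \<in> ?A" for v w
      unfolding diff[OF that] using that
    proof (elim disjE conjE)
      assume "v \<in> ?A" "w \<in> ?B" then show "tripod_dist (h v) (h w) = d v m + d w m"
        by (simp add: tripod_dist_def hA hB)
    next
      assume "v \<in> ?B" "w \<in> ?C" then show "tripod_dist (h v) (h w) = d v m + d w m"
        by (simp add: tripod_dist_def hB hC)
    next
      assume "v \<in> ?C" "w \<in> ?A" then show "tripod_dist (h v) (h w) = d v m + d w m"
        by (simp add: tripod_dist_def hC hA)
    qed
    have iso: "tripod_dist (h v) (h w) = d v w"
      if "v \<in> ?A \<union> ?B \<union> ?C" "w \<in> ?A \<union> ?B \<union> ?C" for v w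
      using iso_same[of v w] iso_diff[of v w] iso_diff[of w v] sym[of v w] commute[of v w] that
      by (metis Un_iff)
    have inj: "inj_on h (?A \<union> ?B \<union> ?C)"
    proof (rule inj_onI)
      fix v w assume vw: "v \<in> ?A \<union> ?B \<union> ?C" "w \<in> ?A \<union> ?B \<union> ?C" "h v = h w"
      then have "d v w = 0"
        using iso[OF vw(1,2)] by (simp add: tripod_dist_def)
      then show "v = w" using vw zero by (auto simp: interval_def)
    qed
    have leg: "(\<lambda>v. d v m) ` interval p m = {0..d p m}" if p: "p \<in> M" for p
    proof -
      have "s \<in> (\<lambda>v. d v m) ` interval p m" if s: "s \<in> {0..d p m}" for s
      proof -
        obtain v where "v \<in> M" "d p v = d p m - s" "d v m = d p m - (d p m - s)"
          using between[of p m "d p m - s"] s p mM by auto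
        then show ?thesis by (force simp: interval_def image_iff)
      qed
      moreover have "d v m \<in> {0..d p m}" if "v \<in> interval p m" for v
      proof -
        have "d p v + d v m = d p m" "0 \<le> d p v"
          using that by (auto simp: interval_def)
        then show ?thesis unfolding atLeastAtMost_iff using nonneg[of v m] by linarith
      qed
      ultimately show ?thesis by blast
    qed
    have tri: "tripod l1 l2 l3 =
      (\<lambda>s. (s,0,0)) ` {0..l1} \<union> (\<lambda>s. (0,s,0)) ` {0..l2} \<union> (\<lambda>s. (0,0,s)) ` {0..l3}" for l1 l2 l3
      by (auto simp: tripod_def)
    have "h ` (?A \<union> ?B \<union> ?C) = tripod (d a m) (d b m) (d c m)"
      unfolding tri leg[OF abc(1), symmetric] leg[OF abc(2), symmetric] leg[OF abc(3), symmetric]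
        image_Un image_image
      using hA hB hC by (simp cong: image_cong)
    then have "isometric_sets (?A \<union> ?B \<union> ?C) d (tripod (d a m) (d b m) (d c m)) tripod_dist"
      unfolding isometric_sets_def using inj iso by (blast intro: bij_betw_imageI)
    then show ?thesis
      unfolding img using nonneg by blast
  qed
  then show ?thesis
    using geo unfolding metric_tree_def geodesic_space_def
    by (auto intro: Metric_space_axioms)
qed

end

section \<open>Bounds for the Carnot--Caratheodory distance\<close>

text \<open>The z-defect is the integral of \<open>(y t - y 0) * x' t\<close>: the first factor is
  at most \<open>l\<close>, and the absolute value of the second integrates to at most
  \<open>l\<close>.\<close>

lemma horizontal_curve_bounds:
  assumes h: "heis_horizontal_C1 x y z x' y' z'"
  defines "l \<equiv> integral {0..1} (\<lambda>t. sqrt ((x' t)\<^sup>2 + (y' t)\<^sup>2))"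
  shows "\<bar>x 1 - x 0\<bar> \<le> l" "\<bar>y 1 - y 0\<bar> \<le> l" "\<bar>z 1 - z 0 - y 0 * (x 1 - x 0)\<bar> \<le> l\<^sup>2"
proof -
  let ?s = "\<lambda>t. sqrt ((x' t)\<^sup>2 + (y' t)\<^sup>2)"
  have c: "continuous_on {0..1} x'" "continuous_on {0..1} y'"
    and d: "\<And>t. t \<in> {0..1} \<Longrightarrow> (x has_real_derivative x' t) (at t within {0..1})"
      "\<And>t. t \<in> {0..1} \<Longrightarrow> (y has_real_derivative y' t) (at t within {0..1})"
      "\<And>t. t \<in> {0..1} \<Longrightarrow> (z has_real_derivative z' t) (at t within {0..1})"
    and z': "\<And>t. t \<in> {0..1} \<Longrightarrow> z' t = y t * x' t"
    using h unfolding heis_horizontal_C1_def by auto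
  have cs: "continuous_on {0..1} ?s" by (intro continuous_intros c)
  have int_s: "?s integrable_on {0..t}" if "t \<in> {0..1}" for t
    using that by (intro integrable_continuous_real continuous_on_subset[OF cs]) auto
  have ftc: "(u' has_integral u t - u 0) {0..t}"
    if "t \<in> {0..1}" "\<And>t. t \<in> {0..1} \<Longrightarrow> (u has_real_derivative u' t) (at t within {0..1})" for u u' and t :: real
  proof (rule fundamental_theorem_of_calculus)
    show "(u has_vector_derivative u' w) (at w within {0..t})" if "w \<in> {0..t}" for w
      using that \<open>t \<in> {0..1}\<close> \<open>\<And>t. t \<in> {0..1} \<Longrightarrow> (u has_real_derivative u' t) (at t within {0..1})\<close>[of w]
      by (auto simp: has_real_derivative_iff_has_vector_derivative intro: has_vector_derivative_within_subset)
  qed (use that in auto)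
  have part: "\<bar>u t - u 0\<bar> \<le> l"
    if t: "t \<in> {0..1}" and u: "\<And>t. t \<in> {0..1} \<Longrightarrow> (u has_real_derivative u' t) (at t within {0..1})"
      and le: "\<And>t. \<bar>u' t\<bar> \<le> ?s t" for u u' and t :: real
  proof -
    have i: "(u' has_integral u t - u 0) {0..t}" by (rule ftc[OF t u])
    have "\<bar>u t - u 0\<bar> \<le> integral {0..t} ?s"
      using integral_norm_bound_integral[of u' "{0..t}" ?s] i int_s[OF t] le
      by (auto simp: has_integral_iff)
    also have "\<dots> \<le> l"
      unfolding l_def using t int_s[OF t] int_s[of 1]
      by (intro integral_subset_le) auto
    finally show ?thesis .
  qed
  have ler: "\<bar>x' t\<bar> \<le> ?s t" "\<bar>y' t\<bar> \<le> ?s t" for t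
    by (auto intro!: real_le_rsqrt)
  show "\<bar>x 1 - x 0\<bar> \<le> l" "\<bar>y 1 - y 0\<bar> \<le> l"
    using part[OF _ d(1) ler(1), of 1] part[OF _ d(2) ler(2), of 1] by auto
  have l0: "0 \<le> l" using part[OF _ d(1) ler(1), of 1] by auto
  have "(z' has_integral z 1 - z 0) {0..1}" using ftc[OF _ d(3), of 1] by simp
  moreover have "((\<lambda>t. y 0 * x' t) has_integral y 0 * (x 1 - x 0)) {0..1}"
    using has_integral_mult_right[OF ftc[OF _ d(1), of 1]] by simp
  ultimately have "((\<lambda>t. z' t - y 0 * x' t) has_integral z 1 - z 0 - y 0 * (x 1 - x 0)) {0..1}"
    by (rule has_integral_diff)
  moreover have "((\<lambda>t. l * ?s t) has_integral l * l) {0..1}"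
    using has_integral_mult_right[OF integrable_integral[OF int_s[of 1]], of l] by (simp add: l_def)
  moreover have "norm (z' t - y 0 * x' t) \<le> l * ?s t" if t: "t \<in> {0..1}" for t
  proof -
    have "z' t - y 0 * x' t = (y t - y 0) * x' t" using z'[OF t] by (simp add: algebra_simps)
    then show ?thesis
      using part[OF t d(2) ler(2)] ler(1)[of t] l0 by (simp add: abs_mult mult_mono)
  qed
  ultimately have "norm (z 1 - z 0 - y 0 * (x 1 - x 0)) \<le> l * l"
    using integral_norm_bound_integral[of "\<lambda>t. z' t - y 0 * x' t" "{0..1}" "\<lambda>t. l * ?s t"]
    by (auto simp: has_integral_iff)
  then show "\<bar>z 1 - z 0 - y 0 * (x 1 - x 0)\<bar> \<le> l\<^sup>2"
    by (simp add: power2_eq_square)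
qed

text \<open>The two endpoints are joined by the segment perturbed by \<open>D t (1 - t)\<close> in \<open>x\<close> and
  \<open>b t (1 - t) (1 - 2t)\<close> in \<open>y\<close>; the area swept by this perturbation is \<open>b D / 30\<close> plus a
  term independent of \<open>b\<close>, which determines \<open>b\<close>. For \<open>D = 0\<close> all quantities vanish.\<close>

lemma horizontal_curve_exists:
  fixes x0 y0 z0 x1 y1 z1 D :: real
  assumes D: "\<bar>x1 - x0\<bar> \<le> D" "\<bar>y1 - y0\<bar> \<le> D" "\<bar>z1 - z0 - y0 * (x1 - x0)\<bar> \<le> 2 * D\<^sup>2"
  obtains x y z x' y' z' where "heis_horizontal_C1 x y z x' y' z'"
    "(x 0, y 0, z 0) = (x0, y0, z0)" "(x 1, y 1, z 1) = (x1, y1, z1)"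
    "integral {0..1} (\<lambda>t. sqrt ((x' t)\<^sup>2 + (y' t)\<^sup>2)) \<le> 93 * D"
proof -
  \<comment> \<open>The error in z at the end of the curve with \<open>b = 0\<close>: the segment
    sweeps \<open>(x1 - x0) * (y1 - y0) / 2\<close>, and the bump in \<open>x\<close> adds
    \<open>- D * (y1 - y0) / 6\<close>.\<close>
  define e where "e = z1 - z0 - y0 * (x1 - x0) - (x1 - x0) * (y1 - y0) / 2 + D * (y1 - y0) / 6"
  define b where "b = 30 * e / D"
  have D0: "0 \<le> D" using D(1) by linarith
  have p1: "\<bar>(x1 - x0) * (y1 - y0)\<bar> \<le> D * D" "\<bar>D * (y1 - y0)\<bar> \<le> D * D"
    unfolding abs_mult using D D0 by (auto intro!: mult_mono)
  have e: "\<bar>e\<bar> \<le> 3 * D\<^sup>2"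
    unfolding e_def using D(3) p1 unfolding power2_eq_square by linarith
  have bD: "b * D = 30 * e" using e by (cases "D = 0") (auto simp: b_def)
  have b: "\<bar>b\<bar> \<le> 90 * D"
  proof (cases "D = 0")
    case False
    then have "0 < D" using D0 by simp
    then have "\<bar>b\<bar> * D = \<bar>b * D\<bar>" by (simp add: abs_mult)
    also have "\<dots> = 30 * \<bar>e\<bar>" unfolding bD by (simp add: abs_mult)
    finally have "\<bar>b\<bar> * D \<le> (90 * D) * D" using e by (simp add: power2_eq_square)
    then show ?thesis using \<open>0 < D\<close> by simp
  qed (simp add: b_def)
  define A where "A = (x1 - x0) + D"
  define x where "x t = x0 + A * t - D * t^2" for t
  define x' where "x' t = A - 2 * D * t" for t
  define y where "y t = y0 + (y1 - y0) * t + b * (t - 3 * t^2 + 2 * t^3)" for t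
  define y' where "y' t = (y1 - y0) + b * (1 - 6 * t + 6 * t^2)" for t
  \<comment> \<open>Coefficients of the polynomial \<open>y t * x' t\<close>, of which
    \<open>z\<close> is the termwise antiderivative.\<close>
  define c1 where "c1 = - 2 * D * y0 + (y1 - y0) * A + b * A"
  define c2 where "c2 = - 2 * D * (y1 - y0) - 2 * D * b - 3 * b * A"
  define c3 where "c3 = 6 * b * D + 2 * b * A"
  define z where "z t = z0 + y0 * A * t + c1 * t^2 / 2 + c2 * t^3 / 3 + c3 * t^4 / 4 - 4 * b * D * t^5 / 5" for t
  define z' where "z' t = y t * x' t" for t
  have "heis_horizontal_C1 x y z x' y' z'"
    unfolding heis_horizontal_C1_def
  proof (intro conjI ballI)
    fix t :: real assume "t \<in> {0..1}"
    show "(x has_real_derivative x' t) (at t within {0..1})"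
      unfolding x_def x'_def by (auto intro!: derivative_eq_intros)
    show "(y has_real_derivative y' t) (at t within {0..1})"
      unfolding y_def y'_def by (auto intro!: derivative_eq_intros simp: algebra_simps)
    have "(z has_real_derivative (y0 * A + c1 * t + c2 * t^2 + c3 * t^3 - 4 * b * D * t^4)) (at t within {0..1})"
      unfolding z_def by (auto intro!: derivative_eq_intros)
    moreover have "y0 * A + c1 * t + c2 * t^2 + c3 * t^3 - 4 * b * D * t^4 = z' t"
      unfolding z'_def y_def x'_def c1_def c2_def c3_def by algebra
    ultimately show "(z has_real_derivative z' t) (at t within {0..1})" by simp
  next
    show "continuous_on {0..1} x'" "continuous_on {0..1} y'" "continuous_on {0..1} z'"
      unfolding z'_def x'_def y'_def y_def by (intro continuous_intros)+
  qed (simp add: z'_def)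
  moreover have "(x 0, y 0, z 0) = (x0, y0, z0)" by (simp add: x_def y_def z_def)
  moreover have "(x 1, y 1, z 1) = (x1, y1, z1)"
  proof -
    have "z 1 = z0 + y0 * (x1 - x0) + (x1 - x0) * (y1 - y0) / 2 - D * (y1 - y0) / 6 + b * D / 30"
      unfolding z_def c1_def c2_def c3_def A_def by (simp add: field_simps)
    then have "z 1 = z1" unfolding bD e_def by (simp add: field_simps)
    then show ?thesis by (simp add: x_def y_def A_def)
  qed
  moreover have "integral {0..1} (\<lambda>t. sqrt ((x' t)\<^sup>2 + (y' t)\<^sup>2)) \<le> 93 * D"
  proof -
    have int: "(\<lambda>t. sqrt ((x' t)\<^sup>2 + (y' t)\<^sup>2)) integrable_on {0..1}"
      unfolding x'_def y'_def by (intro integrable_continuous_real continuous_intros)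
    \<comment> \<open>93 = 2 + 91: the derivative of \<open>x\<close> is at most
      \<open>2 * D\<close>, that of \<open>y\<close> at most \<open>D + 90 * D\<close>.\<close>
    have "sqrt ((x' t)\<^sup>2 + (y' t)\<^sup>2) \<le> 93 * D" if t: "t \<in> {0..1}" for t
    proof -
      have "x' t = (x1 - x0) + D * (1 - 2 * t)" by (simp add: x'_def A_def algebra_simps)
      moreover have "\<bar>D * (1 - 2 * t)\<bar> \<le> D * 1"
        unfolding abs_mult using t D0 by (intro mult_mono) auto
      ultimately have 1: "\<bar>x' t\<bar> \<le> 2 * D" using D(1) by linarith
      have "0 \<le> t * (1 - t)" using t by simp
      moreover have "t * (1 - t) \<le> 1/4"
        using zero_le_power2[of "t - 1/2"] by (simp add: power2_eq_square algebra_simps)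
      moreover have "1 - 6 * t + 6 * t^2 = 1 - 6 * (t * (1 - t))" by (simp add: power2_eq_square algebra_simps)
      ultimately have "\<bar>1 - 6 * t + 6 * t^2\<bar> \<le> 1" by linarith
      then have "\<bar>b * (1 - 6 * t + 6 * t^2)\<bar> \<le> \<bar>b\<bar> * 1"
        unfolding abs_mult by (rule mult_left_mono) simp
      then have 2: "\<bar>y' t\<bar> \<le> 91 * D" using D(2) b unfolding y'_def by linarith
      show ?thesis
        using sqrt_sum_squares_le_sum_abs[of "x' t" "y' t"] 1 2 by linarith
    qed
    then have "integral {0..1} (\<lambda>t. sqrt ((x' t)\<^sup>2 + (y' t)\<^sup>2)) \<le> integral {0..1} (\<lambda>t::real. 93 * D)"
      by (intro integral_le int) auto
    then show ?thesis by simp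
  qed
  ultimately show thesis using that by blast
qed

lemma heis_cc_dist_le:
  assumes "\<bar>x1 - x0\<bar> \<le> D" "\<bar>y1 - y0\<bar> \<le> D" "\<bar>z1 - z0 - y0 * (x1 - x0)\<bar> \<le> 2 * D\<^sup>2"
  shows "heis_cc_dist (x0, y0, z0) (x1, y1, z1) \<le> 93 * D"
proof -
  obtain x y z x' y' z' where c: "heis_horizontal_C1 x y z x' y' z'"
    "(x 0, y 0, z 0) = (x0, y0, z0)" "(x 1, y 1, z 1) = (x1, y1, z1)"
    "integral {0..1} (\<lambda>t. sqrt ((x' t)\<^sup>2 + (y' t)\<^sup>2)) \<le> 93 * D"
    using horizontal_curve_exists[OF assms] .
  have "heis_cc_dist (x0, y0, z0) (x1, y1, z1) \<le> integral {0..1} (\<lambda>t. sqrt ((x' t)\<^sup>2 + (y' t)\<^sup>2))"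
    unfolding heis_cc_dist_def
  proof (rule cInf_lower)
    show "bdd_below {integral {0..1} (\<lambda>t. sqrt ((x' t)\<^sup>2 + (y' t)\<^sup>2)) | x y z x' y' z'.
       heis_horizontal_C1 x y z x' y' z' \<and> (x 0, y 0, z 0) = (x0, y0, z0) \<and> (x 1, y 1, z 1) = (x1, y1, z1)}"
    proof (rule bdd_belowI[of _ 0])
      fix l assume "l \<in> {integral {0..1} (\<lambda>t. sqrt ((x' t)\<^sup>2 + (y' t)\<^sup>2)) | x y z x' y' z'.
       heis_horizontal_C1 x y z x' y' z' \<and> (x 0, y 0, z 0) = (x0, y0, z0) \<and> (x 1, y 1, z 1) = (x1, y1, z1)}"
      then show "0 \<le> l" using horizontal_curve_bounds(1) abs_ge_zero order_trans by blast
    qed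
  qed (use c in blast)
  then show ?thesis using c(4) by linarith
qed

lemma heis_cc_dist_bounds:
  fixes x0 y0 z0 x1 y1 z1 :: real
  defines "m \<equiv> heis_cc_dist (x0, y0, z0) (x1, y1, z1)"
  shows "\<bar>x1 - x0\<bar> \<le> m" "\<bar>y1 - y0\<bar> \<le> m" "\<bar>z1 - z0 - y0 * (x1 - x0)\<bar> \<le> m\<^sup>2"
proof -
  let ?A = "{integral {0..1} (\<lambda>t. sqrt ((x' t)\<^sup>2 + (y' t)\<^sup>2)) | x y z x' y' z'.
       heis_horizontal_C1 x y z x' y' z' \<and> (x 0, y 0, z 0) = (x0, y0, z0) \<and> (x 1, y 1, z 1) = (x1, y1, z1)}"
  let ?w = "\<bar>z1 - z0 - y0 * (x1 - x0)\<bar>"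
  \<comment> \<open>Any \<open>D\<close> satisfying the three bounds would do: the curve serves to
    make the set of lengths nonempty, without which \<open>Inf\<close> says nothing.\<close>
  define D where "D = \<bar>x1 - x0\<bar> + \<bar>y1 - y0\<bar> + sqrt ?w"
  have "?w \<le> D\<^sup>2"
    unfolding D_def by (rule sqrt_le_D) simp
  then have "?w \<le> 2 * D\<^sup>2" by (smt (verit) zero_le_power2)
  moreover have "\<bar>x1 - x0\<bar> \<le> D" "\<bar>y1 - y0\<bar> \<le> D" by (auto simp: D_def)
  ultimately obtain x y z x' y' z' where "heis_horizontal_C1 x y z x' y' z'"
    "(x 0, y 0, z 0) = (x0, y0, z0)" "(x 1, y 1, z 1) = (x1, y1, z1)"
    "integral {0..1} (\<lambda>t. sqrt ((x' t)\<^sup>2 + (y' t)\<^sup>2)) \<le> 93 * D"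
    using horizontal_curve_exists[of x1 x0 D y1 y0 z1 z0] by blast
  then have ne: "?A \<noteq> {}" by blast
  have b: "\<bar>x1 - x0\<bar> \<le> l \<and> \<bar>y1 - y0\<bar> \<le> l \<and> ?w \<le> l\<^sup>2" if l: "l \<in> ?A" for l
  proof -
    obtain x y z x' y' z' where "heis_horizontal_C1 x y z x' y' z'"
      "(x 0, y 0, z 0) = (x0, y0, z0)" "(x 1, y 1, z 1) = (x1, y1, z1)"
      "l = integral {0..1} (\<lambda>t. sqrt ((x' t)\<^sup>2 + (y' t)\<^sup>2))"
      using l by blast
    then show ?thesis using horizontal_curve_bounds[of x y z x' y' z'] by simp
  qed
  show "\<bar>x1 - x0\<bar> \<le> m" "\<bar>y1 - y0\<bar> \<le> m"
    unfolding m_def heis_cc_dist_def using b by (blast intro: cInf_greatest[OF ne])+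
  have "sqrt ?w \<le> m"
    unfolding m_def heis_cc_dist_def
  proof (rule cInf_greatest[OF ne])
    fix l assume "l \<in> ?A"
    then have "0 \<le> l" "?w \<le> l\<^sup>2" using b[of l] by auto
    then show "sqrt ?w \<le> l" by (simp add: real_le_lsqrt)
  qed
  then show "?w \<le> m\<^sup>2" by (rule sqrt_le_D)
qed

section \<open>Factorization\<close>

text \<open>Serves to realise the tree as a set of reals. A point is encoded by the indices of the
  basis sets containing it, a set of naturals.\<close>

lemma ex_inj_into_real:
  obtains j :: "'a::{second_countable_topology, t1_space} \<Rightarrow> real" where "inj j"
proof -
  obtain B :: "'a set set" where B: "countable B" "topological_basis B" using ex_countable_basis by blast
  define g where "g p = {n. p \<in> from_nat_into B n}" for p :: 'a
  have "inj g"
  proof (rule injI, rule ccontr)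
    fix p q assume eq: "g p = g q" and "p \<noteq> q"
    then obtain U where U: "open U" "p \<in> U" "q \<notin> U" using t1_space by blast
    then obtain V where V: "V \<in> B" "p \<in> V" "V \<subseteq> U" using B(2) topological_basisE by blast
    then obtain n where "from_nat_into B n = V" using from_nat_into_surj[OF B(1)] by blast
    then have "n \<in> g p" "n \<notin> g q" using V U by (auto simp: g_def)
    then show False using eq by blast
  qed
  moreover obtain h :: "nat set \<Rightarrow> real" where "inj h"
    using nat_sets_eqpoll_reals unfolding eqpoll_def bij_betw_def by blast
  ultimately show thesis using that inj_compose[of h g] by blast
qed

context horizontal_sphere_map
begin

theorem factors_through_tree:
  "\<exists>(Z :: real set) dZ \<psi> \<pi>. metric_tree Z dZ \<and> (\<forall>p\<in>S. \<psi> p \<in> Z) \<and> (\<forall>a\<in>Z. \<pi> a \<in> S)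
    \<and> (\<forall>p\<in>S. \<forall>q\<in>S. dZ (\<psi> p) (\<psi> q) = tree_dist p q)
    \<and> (\<forall>a\<in>Z. \<forall>b\<in>Z. dZ a b = tree_dist (\<pi> a) (\<pi> b))
    \<and> (\<forall>p\<in>S. tree_dist (\<pi> (\<psi> p)) p = 0)"
proof -
  obtain j :: "'a \<Rightarrow> real" where j: "inj j" using ex_inj_into_real .
  define rep where "rep p = (SOME w. w \<in> S \<and> tree_dist p w = 0)" for p
  have rep: "rep p \<in> S \<and> tree_dist p (rep p) = 0" if "p \<in> S" for p
    unfolding rep_def by (rule someI[of _ p]) (use that tree_dist_refl in blast)
  define \<psi> where "\<psi> p = j (rep p)" for p
  define Z where "Z = \<psi> ` S"
  define \<pi> where "\<pi> = inv j"
  have \<pi>\<psi>: "\<pi> (\<psi> p) = rep p" for p using j by (simp add: \<pi>_def \<psi>_def)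
  \<comment> \<open>\<open>Metric_space\<close> demands nonnegativity and symmetry of all arguments,
    also off \<open>Z\<close>; the default 0 provides them there.\<close>
  define dZ where "dZ a b = (if a \<in> Z \<and> b \<in> Z then tree_dist (\<pi> a) (\<pi> b) else 0)" for a b
  have dZ: "dZ (\<psi> p) (\<psi> q) = tree_dist p q" if pq: "p \<in> S" "q \<in> S" for p q
  proof -
    have r: "rep p \<in> S" "tree_dist p (rep p) = 0" "rep q \<in> S" "tree_dist q (rep q) = 0" using rep pq by auto
    have "tree_dist p q = tree_dist (rep p) q" by (rule tree_dist_cong[OF pq(1) r(1,2) pq(2)])
    also have "\<dots> = tree_dist (rep p) (rep q)"
      using tree_dist_cong[OF pq(2) r(3,4,1)] tree_dist_sym[of q "rep p"] tree_dist_sym[of "rep q" "rep p"] by simp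
    finally show ?thesis using pq by (simp add: dZ_def \<pi>\<psi> Z_def)
  qed
  \<comment> \<open>\<open>SOME\<close> applied to equal predicates gives the same point, so
    \<open>rep\<close> is constant on classes.\<close>
  have eq: "\<psi> p = \<psi> q" if pq: "p \<in> S" "q \<in> S" "tree_dist p q = 0" for p q
  proof -
    have "(w \<in> S \<and> tree_dist p w = 0) = (w \<in> S \<and> tree_dist q w = 0)" for w
      using tree_dist_cong[OF pq, of w] by auto
    then show ?thesis by (simp add: \<psi>_def rep_def)
  qed
  interpret tree_like Z dZ
  proof
    show "0 \<le> dZ a b" for a b
      unfolding dZ_def using tree_dist_nonneg rep by (auto simp: Z_def \<pi>\<psi>)
    show "dZ a b = dZ b a" for a b
      unfolding dZ_def tree_dist_sym[of "\<pi> a" "\<pi> b"] by (simp only: conj_commute)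
    show "(dZ a b = 0) = (a = b)" if ab: "a \<in> Z" "b \<in> Z" for a b
    proof -
      obtain p q where pq: "p \<in> S" "q \<in> S" "a = \<psi> p" "b = \<psi> q"
        using ab unfolding Z_def by blast
      show ?thesis
      proof
        assume "dZ a b = 0" then show "a = b" using eq[OF pq(1,2)] dZ[OF pq(1,2)] pq(3,4) by simp
      next
        assume "a = b" then show "dZ a b = 0" using dZ[OF pq(1,1)] tree_dist_refl[OF pq(1)] pq(3) by simp
      qed
    qed
    show "dZ a c \<le> dZ a b + dZ b c" if abc: "a \<in> Z" "b \<in> Z" "c \<in> Z" for a b c
    proof -
      obtain p q r where pq: "p \<in> S" "q \<in> S" "r \<in> S" "a = \<psi> p" "b = \<psi> q" "c = \<psi> r"
        using abc unfolding Z_def by blast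
      then show ?thesis using tree_dist_triangle[OF pq(1-3)] dZ by simp
    qed
    show "\<exists>m\<in>Z. dZ a m = s \<and> dZ m b = dZ a b - s" if ab: "a \<in> Z" "b \<in> Z" and s: "0 \<le> s" "s \<le> dZ a b" for a b s
    proof -
      obtain p q where pq: "p \<in> S" "q \<in> S" "a = \<psi> p" "b = \<psi> q" using ab unfolding Z_def by blast
      then obtain m where "m \<in> S" "tree_dist p m = s" "tree_dist m q = tree_dist p q - s" using tree_dist_between[OF pq(1,2) s(1)] s(2) dZ[OF pq(1,2)] by auto
      then show ?thesis using pq dZ by (intro bexI[of _ "\<psi> m"]) (auto simp: Z_def)
    qed
    show "dZ a m + dZ m c = dZ a c \<or> dZ c m + dZ m b = dZ c b"
      if abcm: "a \<in> Z" "b \<in> Z" "c \<in> Z" "m \<in> Z" and e: "dZ a m + dZ m b = dZ a b" for a b c m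
    proof -
      obtain p q r w where pq: "p \<in> S" "q \<in> S" "r \<in> S" "w \<in> S" "a = \<psi> p" "b = \<psi> q" "c = \<psi> r" "m = \<psi> w"
        using abcm unfolding Z_def by blast
      then show ?thesis using tree_dist_split[OF pq(1-4)] e dZ by simp
    qed
  qed
  show ?thesis
  proof (intro exI[of _ Z] exI[of _ dZ] exI[of _ \<psi>] exI[of _ \<pi>] conjI ballI)
    show "metric_tree Z dZ" by (rule metric_tree)
    show "\<psi> p \<in> Z" if "p \<in> S" for p using that by (simp add: Z_def)
    show "\<pi> a \<in> S" if "a \<in> Z" for a using that rep \<pi>\<psi> by (auto simp: Z_def)
    show "dZ (\<psi> p) (\<psi> q) = tree_dist p q" if "p \<in> S" "q \<in> S" for p q using dZ that .
    show "dZ a b = tree_dist (\<pi> a) (\<pi> b)" if "a \<in> Z" "b \<in> Z" for a b using that by (simp add: dZ_def)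
    show "tree_dist (\<pi> (\<psi> p)) p = 0" if "p \<in> S" for p using rep[OF that] tree_dist_sym[of "rep p" p] \<pi>\<psi> by simp
  qed
qed

end

theorem theorem5:
  fixes f :: "real^'n \<Rightarrow> real \<times> real \<times> real"
  assumes "CARD('n) \<ge> 3"
    and "lipschitz_map (sphere 0 1) dist UNIV heis_cc_dist f"
  shows "\<exists>(Z :: real set) (dZ :: real \<Rightarrow> real \<Rightarrow> real) \<psi> \<phi>.
           metric_tree Z dZ \<and>
           lipschitz_map (sphere 0 1) dist Z dZ \<psi> \<and>
           lipschitz_map Z dZ UNIV heis_cc_dist \<phi> \<and>
           (\<forall>x\<in>sphere 0 1. f x = \<phi> (\<psi> x))"
proof -
  obtain C where C: "\<And>u v. u \<in> sphere 0 1 \<Longrightarrow> v \<in> sphere 0 1 \<Longrightarrow> heis_cc_dist (f u) (f v) \<le> C * dist u v"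
    using assms(2) unfolding lipschitz_map_def by blast
  define x where "x p = fst (f p)" for p
  define y where "y p = fst (snd (f p))" for p
  define z where "z p = snd (snd (f p))" for p
  have f: "f p = (x p, y p, z p)" for p by (simp add: x_def y_def z_def)
  \<comment> \<open>\<open>C\<^sup>2\<close> is for the second order bound; the absolute value
    covers a negative \<open>C\<close>.\<close>
  define L where "L = \<bar>C\<bar> + C\<^sup>2"
  have bounds: "\<bar>x q - x p\<bar> \<le> L * dist p q \<and> \<bar>y q - y p\<bar> \<le> L * dist p q
      \<and> \<bar>z q - z p - y p * (x q - x p)\<bar> \<le> L * (dist p q)\<^sup>2"
    if pq: "p \<in> sphere 0 1" "q \<in> sphere 0 1" for p q
  proof -
    let ?m = "heis_cc_dist (f p) (f q)"
    have b: "\<bar>x q - x p\<bar> \<le> ?m" "\<bar>y q - y p\<bar> \<le> ?m" "\<bar>z q - z p - y p * (x q - x p)\<bar> \<le> ?m\<^sup>2"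
      unfolding f by (rule heis_cc_dist_bounds)+
    have m0: "0 \<le> ?m" using b(1) by linarith
    have m: "?m \<le> C * dist p q" using C pq by blast
    have "C * dist p q \<le> L * dist p q" unfolding L_def by (intro mult_right_mono) (auto intro: add_increasing2)
    moreover have "?m\<^sup>2 \<le> (C * dist p q)\<^sup>2" using m m0 by (rule power_mono)
    moreover have "(C * dist p q)\<^sup>2 \<le> L * (dist p q)\<^sup>2"
      unfolding L_def power_mult_distrib by (intro mult_right_mono) auto
    ultimately show ?thesis using b m by linarith
  qed
  interpret H: horizontal_sphere_map x y z L
  proof
    show "3 \<le> DIM(real^'n)" using assms(1) by simp
    show "0 \<le> L" by (simp add: L_def)
  qed (use bounds in blast)+
  obtain Z :: "real set" and dZ \<psi> \<pi> where tree: "metric_tree Z dZ"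
    and maps: "\<forall>p\<in>sphere 0 1. \<psi> p \<in> Z" "\<forall>a\<in>Z. \<pi> a \<in> sphere 0 1"
    and d\<psi>: "\<forall>p\<in>sphere 0 1. \<forall>q\<in>sphere 0 1. dZ (\<psi> p) (\<psi> q) = H.tree_dist p q"
    and d\<pi>: "\<forall>a\<in>Z. \<forall>b\<in>Z. dZ a b = H.tree_dist (\<pi> a) (\<pi> b)"
    and \<pi>\<psi>: "\<forall>p\<in>sphere 0 1. H.tree_dist (\<pi> (\<psi> p)) p = 0"
    using H.factors_through_tree by (elim exE conjE)
  have "lipschitz_map (sphere 0 1) dist Z dZ \<psi>"
    unfolding lipschitz_map_def
  proof (intro conjI exI[of _ H.chain_lip] ballI)
    show "\<psi> ` sphere 0 1 \<subseteq> Z" using maps(1) by blast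
    show "dZ (\<psi> p) (\<psi> q) \<le> H.chain_lip * dist p q"
      if "p \<in> sphere 0 1" "q \<in> sphere 0 1" for p q
      using d\<psi> H.tree_dist_le_dist[OF that] that by simp
  qed
  moreover have "lipschitz_map Z dZ UNIV heis_cc_dist (\<lambda>a. f (\<pi> a))"
    unfolding lipschitz_map_def
  proof (intro conjI exI[of _ 93] ballI)
    show "heis_cc_dist (f (\<pi> a)) (f (\<pi> b)) \<le> 93 * dZ a b" if ab: "a \<in> Z" "b \<in> Z" for a b
    proof -
      have \<pi>: "\<pi> a \<in> sphere 0 1" "\<pi> b \<in> sphere 0 1" and d: "dZ a b = H.tree_dist (\<pi> a) (\<pi> b)"
        using maps(2) d\<pi> ab by blast+
      show ?thesis unfolding f d by (rule heis_cc_dist_le[OF H.tree_dist_lower_bounds[OF \<pi>]])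
    qed
  qed simp
  moreover have "\<forall>p\<in>sphere 0 1. f p = f (\<pi> (\<psi> p))"
  proof
    fix p :: "real^'n" assume p: "p \<in> sphere 0 1"
    have "H.f (\<pi> (\<psi> p)) = H.f p"
      by (rule H.tree_dist_eq_0_imp_f_eq) (use p maps \<pi>\<psi> in blast)+
    then show "f p = f (\<pi> (\<psi> p))" by (simp add: H.f_def f)
  qed
  ultimately show ?thesis using tree by blast
qed

end
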